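(* Let $N\geq 2$ and let $g:\mathbb{R}\to\mathbb{R}$ be locally Lipschitz continuous. Suppose there exists $a>0$ such that $g$ is convex on $[a,+\infty)$ and $$\int_a^{+\infty}\frac{ds}{\sqrt{G(s)}}<+\infty,\qquad\text{where } G(s)=\int_a^s g(\sigma)\,d\sigma .$$ Then every large solution $u$ of $-\Delta u+g(u)=0$ in an open ball $B\subset\mathbb{R}^N$ is radial, i.e. $u(x)$ depends only on the distance from $x$ to the center of $B$.
   Context: A solution is a classical ($C^2$) solution in the open ball $B$. A large solution of $-\Delta u+g(u)=0$ in $B$ is a solution such that $u(x)\to\infty$ as $x\in B$ approaches the boundary, i.e. $\lim_{\mathrm{dist}(x,\partial B)\to 0}u(x)=\infty$. In the integral condition (the Keller-Osserman condition), it is understood that $G(s)>0$ for all $s>a$, so that the integrand is well defined. *)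

theory Defs
  imports "HOL-Analysis.Analysis"
begin

definition partial_deriv :: "('a::euclidean_space \<Rightarrow> real) \<Rightarrow> 'a \<Rightarrow> 'a \<Rightarrow> real" where
  "partial_deriv f b x = frechet_derivative f (at x) b"

definition C1_on :: "'a::euclidean_space set \<Rightarrow> ('a \<Rightarrow> real) \<Rightarrow> bool" where
  "C1_on S f \<longleftrightarrow>
     (\<forall>x\<in>S. f differentiable (at x)) \<and> (\<forall>b\<in>Basis. continuous_on S (partial_deriv f b))"

definition C2_on :: "'a::euclidean_space set \<Rightarrow> ('a \<Rightarrow> real) \<Rightarrow> bool" where
  "C2_on S f \<longleftrightarrow> C1_on S f \<and> (\<forall>b\<in>Basis. C1_on S (partial_deriv f b))"

definition laplacian :: "('a::euclidean_space \<Rightarrow> real) \<Rightarrow> 'a \<Rightarrow> real" where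
  "laplacian f x = (\<Sum>b\<in>Basis. partial_deriv (partial_deriv f b) b x)"

text \<open>Only the values of \<open>u\<close> on the open set \<open>B\<close> matter in the definitions below,
  because \<open>at x\<close> only sees an arbitrarily small neighbourhood of \<open>x\<close>.\<close>

definition classical_solution ::
    "(real \<Rightarrow> real) \<Rightarrow> 'a::euclidean_space set \<Rightarrow> ('a \<Rightarrow> real) \<Rightarrow> bool" where
  "classical_solution g B u \<longleftrightarrow> C2_on B u \<and> (\<forall>x\<in>B. - laplacian u x + g (u x) = 0)"

definition large_solution ::
    "(real \<Rightarrow> real) \<Rightarrow> 'a::euclidean_space set \<Rightarrow> ('a \<Rightarrow> real) \<Rightarrow> bool" where
  "large_solution g B u \<longleftrightarrow> classical_solution g B u \<and>
     filterlim u at_top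
       (inf (filtercomap (\<lambda>x. infdist x (frontier B)) (at_right 0)) (principal B))"

definition locally_lipschitz :: "(real \<Rightarrow> real) \<Rightarrow> bool" where
  "locally_lipschitz g \<longleftrightarrow> (\<forall>s. \<exists>r>0. \<exists>L. L-lipschitz_on (ball s r) g)"

definition primitive_from :: "(real \<Rightarrow> real) \<Rightarrow> real \<Rightarrow> real \<Rightarrow> real" where
  "primitive_from g a s = integral {a..s} g"

text \<open>Positivity of the primitive is part of the condition: it makes the integrand meaningful
  on \<open>{a<..}\<close> (in HOL, \<open>1 / sqrt 0 = 0\<close> and \<open>sqrt\<close> is negative on negative arguments).\<close>

definition keller_osserman :: "(real \<Rightarrow> real) \<Rightarrow> real \<Rightarrow> bool" where
  "keller_osserman g a \<longleftrightarrow>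
     (\<forall>s>a. primitive_from g a s > 0) \<and>
     (\<integral>\<^sup>+s\<in>{a<..}. ennreal (1 / sqrt (primitive_from g a s)) \<partial>lborel) < \<infinity>"

definition radial_on :: "'a::euclidean_space \<Rightarrow> 'a set \<Rightarrow> ('a \<Rightarrow> real) \<Rightarrow> bool" where
  "radial_on c B u \<longleftrightarrow> (\<exists>\<phi>. \<forall>x\<in>B. u x = \<phi> (dist x c))"

end

theory Submission
  imports Defs
begin

text \<open>
  Let \<open>F = sqrt (2 * G)\<close> and let \<open>\<psi> s\<close> be the integral of \<open>1 / F\<close> from \<open>s\<close> to infinity. Comparing \<open>u\<close> with
  \<open>\<psi>\<close> near the boundary gives \<open>u x / u y \<longlongrightarrow> 1\<close> for \<open>norm x = norm y \<longlongrightarrow> R\<close>. With this, convexity of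
  \<open>g\<close> makes the maximum principle applicable to \<open>u \<circ> Q1 + u \<circ> Q2 - 2 * u\<close> on an annulus, for
  orthogonal \<open>Q1\<close> and \<open>Q2\<close>, although \<open>u\<close> is infinite on the outer sphere. Applied to small rotations this bounds
  the first rotational derivatives of \<open>u\<close>, and its second ones from above. The equation in
  polar coordinates then says that \<open>r ^ (N - 1) * u\<^sub>r\<close> increases along rays, so \<open>u\<^sub>r\<close> tends to
  infinity at the boundary and dominates the tangential gradient. Hence \<open>u\<close> increases in the
  direction \<open>e\<close> near every boundary point \<open>p\<close> with \<open>p \<bullet> e > 0\<close>, which is what the method of moving
  planes needs at the boundary; it yields \<open>u y \<le> u x\<close> whenever \<open>norm x = norm y\<close>.
\<close>

section \<open>Gradient and Laplacian at a point\<close>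

text \<open>Two infinities obstruct the usual symmetry proof: \<open>u\<close> has no boundary
  values, and since \<open>g\<close> is only locally Lipschitz and \<open>u\<close> is unbounded,
  the quotient \<open>(g (u x) - g (u y)) / (u x - u y)\<close> need not stay bounded near the
  boundary. The barriers control \<open>u\<close> on spheres only up to a factor near 1 and an
  additive constant; this is enough because convexity lets the multiple
  \<open>(1 + \<epsilon>) * u\<close> absorb the error. The second rotational derivatives are
  bounded from above only, which is what convexity provides and also what is required: in the radial
  equation the tangential part of the Laplacian is subtracted from \<open>g (u x)\<close>, which is
  large near the boundary. A bounded radial flux along one ray would keep \<open>u\<close> bounded
  there, so blow-up without any rate makes \<open>u\<^sub>r\<close> large, and monotonicity in the
  radius spreads this to a neighbourhood of the boundary point. In the moving plane argument, points
  where the comparison fails can only accumulate inside the ball, and Lipschitz constants of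
  \<open>g\<close> are used only where the two compared values are close.\<close>

text \<open>\<open>jet2 f x p l\<close>: \<open>f\<close> is twice differentiable at \<open>x\<close>, with gradient \<open>p\<close> and Laplacian \<open>l\<close>.\<close>

definition jet2 :: "('a::euclidean_space \<Rightarrow> real) \<Rightarrow> 'a \<Rightarrow> 'a \<Rightarrow> real \<Rightarrow> bool" where
  "jet2 f x p l \<longleftrightarrow> (\<exists>P H. (\<forall>\<^sub>F y in nhds x. (f has_derivative (\<lambda>h. P y \<bullet> h)) (at y)) \<and> P x = p \<and>
     (P has_derivative H) (at x) \<and> l = (\<Sum>b\<in>Basis. H b \<bullet> b))"

lemma jet2I:
  assumes "\<forall>\<^sub>F y in nhds x. (f has_derivative (\<lambda>h. P y \<bullet> h)) (at y)"
    and "(P has_derivative H) (at x)" and "P x = p" and "l = (\<Sum>b\<in>Basis. H b \<bullet> b)"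
  shows "jet2 f x p l"
  using assms unfolding jet2_def by blast

section \<open>Calculus of gradient and Laplacian\<close>

lemma jet2_has_derivative:
  assumes "jet2 f x p l"
  shows "(f has_derivative (\<lambda>h. p \<bullet> h)) (at x)"
  using assms unfolding jet2_def by (auto dest: eventually_nhds_x_imp_x)

lemma jet2_isCont: "jet2 f x p l \<Longrightarrow> isCont f x"
  using jet2_has_derivative has_derivative_continuous by blast

lemma jet2_cong:
  assumes "jet2 f x p l" and "\<forall>\<^sub>F y in nhds x. f' y = f y"
  shows "jet2 f' x p l"
proof -
  obtain P H where PH: "\<forall>\<^sub>F y in nhds x. (f has_derivative (\<lambda>h. P y \<bullet> h)) (at y)" "P x = p"
     "(P has_derivative H) (at x)" "l = (\<Sum>b\<in>Basis. H b \<bullet> b)"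
    using assms(1) unfolding jet2_def by auto
  have "\<forall>\<^sub>F y in nhds x. \<forall>\<^sub>F z in nhds y. f' z = f z"
    using assms(2) by (simp add: eventually_eventually)
  with PH(1) have "\<forall>\<^sub>F y in nhds x. (f' has_derivative (\<lambda>h. P y \<bullet> h)) (at y)"
  proof eventually_elim
    case (elim y)
    have "\<forall>\<^sub>F z in at y. f z = f' z"
      using elim(2) by (auto simp: eventually_at_filter elim: eventually_mono)
    moreover have "f y = f' y"
      using eventually_nhds_x_imp_x[OF elim(2)] by simp
    ultimately show ?case
      using has_derivative_transform_eventually[OF elim(1)] by simp
  qed
  then show ?thesis
    using PH unfolding jet2_def by blast
qed

lemma jet2_const: "jet2 (\<lambda>_. c) x 0 0"
  by (rule jet2I[where P = "\<lambda>_. 0" and H = "\<lambda>_. 0"]) auto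

lemma jet2_inner: "jet2 (\<lambda>x. x \<bullet> e) x e 0"
  by (rule jet2I[where P = "\<lambda>_. e" and H = "\<lambda>_. 0"])
    (auto intro!: always_eventually derivative_eq_intros simp: inner_commute)

lemma jet2_add:
  assumes "jet2 f x p l" "jet2 g x q k"
  shows "jet2 (\<lambda>x. f x + g x) x (p + q) (l + k)"
proof -
  obtain P H where 1: "\<forall>\<^sub>F y in nhds x. (f has_derivative (\<lambda>h. P y \<bullet> h)) (at y)" "P x = p"
     "(P has_derivative H) (at x)" "l = (\<Sum>b\<in>Basis. H b \<bullet> b)"
    using assms(1) unfolding jet2_def by auto
  obtain Q K where 2: "\<forall>\<^sub>F y in nhds x. (g has_derivative (\<lambda>h. Q y \<bullet> h)) (at y)" "Q x = q"
     "(Q has_derivative K) (at x)" "k = (\<Sum>b\<in>Basis. K b \<bullet> b)"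
    using assms(2) unfolding jet2_def by auto
  show ?thesis
  proof (rule jet2I[where P = "\<lambda>y. P y + Q y" and H = "\<lambda>h. H h + K h"])
    show "\<forall>\<^sub>F y in nhds x. ((\<lambda>x. f x + g x) has_derivative (\<lambda>h. (P y + Q y) \<bullet> h)) (at y)"
      using 1(1) 2(1) by eventually_elim (auto intro!: derivative_eq_intros simp: inner_add_left)
  qed (use 1 2 in \<open>auto intro!: derivative_eq_intros simp: inner_add_left sum.distrib\<close>)
qed

lemma jet2_compose:
  assumes "jet2 f x p l"
    and "\<forall>\<^sub>F s in nhds (f x). (\<phi> has_real_derivative \<phi>1 s) (at s)"
    and "(\<phi>1 has_real_derivative d2) (at (f x))"
  shows "jet2 (\<lambda>y. \<phi> (f y)) x (\<phi>1 (f x) *\<^sub>R p) (\<phi>1 (f x) * l + d2 * (p \<bullet> p))"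
proof -
  obtain P H where 1: "\<forall>\<^sub>F y in nhds x. (f has_derivative (\<lambda>h. P y \<bullet> h)) (at y)" "P x = p"
     "(P has_derivative H) (at x)" "l = (\<Sum>b\<in>Basis. H b \<bullet> b)"
    using assms(1) unfolding jet2_def by auto
  have fd: "(f has_derivative (\<lambda>h. p \<bullet> h)) (at x)"
    by (rule jet2_has_derivative[OF assms(1)])
  have fc: "isCont f x"
    using jet2_isCont[OF assms(1)] .
  show ?thesis
  proof (rule jet2I[where P = "\<lambda>y. \<phi>1 (f y) *\<^sub>R P y" and
        H = "\<lambda>h. \<phi>1 (f x) *\<^sub>R H h + ((p \<bullet> h) * d2) *\<^sub>R p"])
    have "filterlim f (nhds (f x)) (nhds x)"
      using fc by (simp add: isCont_def tendsto_at_iff_tendsto_nhds)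
    then have "\<forall>\<^sub>F y in nhds x. (\<phi> has_real_derivative \<phi>1 (f y)) (at (f y))"
      using assms(2) by (rule eventually_compose_filterlim[rotated])
    with 1(1) show "\<forall>\<^sub>F y in nhds x. ((\<lambda>y. \<phi> (f y)) has_derivative (\<lambda>h. (\<phi>1 (f y) *\<^sub>R P y) \<bullet> h)) (at y)"
    proof eventually_elim
      case (elim y)
      show ?case
        using has_derivative_compose[OF elim(1) elim(2)[unfolded has_field_derivative_def]]
        by simp
    qed
    have "((\<lambda>y. \<phi>1 (f y)) has_derivative (\<lambda>h. d2 * (p \<bullet> h))) (at x)"
      using has_derivative_compose[OF fd assms(3)[unfolded has_field_derivative_def]] by simp
    from has_derivative_scaleR[OF this 1(3)]
    show "((\<lambda>y. \<phi>1 (f y) *\<^sub>R P y) has_derivative (\<lambda>h. \<phi>1 (f x) *\<^sub>R H h + ((p \<bullet> h) * d2) *\<^sub>R p)) (at x)"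
      by (simp add: 1(2) mult.commute)
    have "p \<bullet> p = (\<Sum>b\<in>Basis. (p \<bullet> b) * (p \<bullet> b))"
      by (rule euclidean_inner)
    then have "d2 * (p \<bullet> p) = (\<Sum>b\<in>Basis. (p \<bullet> b) * d2 * (p \<bullet> b))"
      by (simp add: sum_distrib_left mult.commute mult.left_commute)
    then show "\<phi>1 (f x) * l + d2 * (p \<bullet> p) =
        (\<Sum>b\<in>Basis. (\<phi>1 (f x) *\<^sub>R H b + ((p \<bullet> b) * d2) *\<^sub>R p) \<bullet> b)"
      by (simp add: 1(4) sum_distrib_left inner_add_left sum.distrib mult.assoc)
  qed (simp add: 1)
qed

lemma jet2_cmult:
  assumes "jet2 f x p l"
  shows "jet2 (\<lambda>y. c * f y) x (c *\<^sub>R p) (c * l)"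
proof -
  have "\<forall>\<^sub>F s in nhds (f x). ((*) c has_real_derivative c) (at s)"
    by (auto intro!: always_eventually derivative_eq_intros)
  from jet2_compose[OF assms this, of 0] show ?thesis
    by simp
qed

lemma jet2_diff:
  assumes "jet2 f x p l" "jet2 g x q k"
  shows "jet2 (\<lambda>x. f x - g x) x (p - q) (l - k)"
  using jet2_add[OF assms(1) jet2_cmult[OF assms(2), of "-1"]] by simp

lemma jet2_translate:
  assumes "jet2 f (x + t) p l"
  shows "jet2 (\<lambda>y. f (y + t)) x p l"
proof -
  obtain P H where 1: "\<forall>\<^sub>F y in nhds (x + t). (f has_derivative (\<lambda>h. P y \<bullet> h)) (at y)" "P (x + t) = p"
     "(P has_derivative H) (at (x + t))" "l = (\<Sum>b\<in>Basis. H b \<bullet> b)"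
    using assms(1) unfolding jet2_def by auto
  have sh: "((\<lambda>y. y + t) has_derivative (\<lambda>h. h)) (at y)" for y :: 'a
    by (auto intro!: derivative_eq_intros)
  show ?thesis
  proof (rule jet2I[where P = "\<lambda>y. P (y + t)" and H = H])
    have "filterlim (\<lambda>y. y + t) (nhds (x + t)) (nhds x)"
      by (intro tendsto_intros filterlim_ident)
    then have "\<forall>\<^sub>F y in nhds x. (f has_derivative (\<lambda>h. P (y + t) \<bullet> h)) (at (y + t))"
      using 1(1) by (rule eventually_compose_filterlim[rotated])
    then show "\<forall>\<^sub>F y in nhds x. ((\<lambda>y. f (y + t)) has_derivative (\<lambda>h. P (y + t) \<bullet> h)) (at y)"
      by eventually_elim (use has_derivative_compose[OF sh] in auto)
    show "((\<lambda>y. P (y + t)) has_derivative H) (at x)"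
      by (rule has_derivative_compose[OF sh 1(3)])
  qed (use 1 in auto)
qed

lemma jet2_sqdist:
  fixes x y :: "'a::euclidean_space"
  shows "jet2 (\<lambda>x. (x - y) \<bullet> (x - y)) x (2 *\<^sub>R (x - y)) (2 * real DIM('a))"
  by (rule jet2I[where P = "\<lambda>x. 2 *\<^sub>R (x - y)" and H = "\<lambda>h. 2 *\<^sub>R h"])
    (auto intro!: always_eventually derivative_eq_intros simp: inner_commute algebra_simps)

text \<open>The Laplacian of the norm is the curvature term by which a ball differs from the
  one-dimensional problem: it has the favourable sign in the lower barrier and must be compensated
  in the upper one.\<close>

lemma jet2_norm:
  fixes x :: "'a::euclidean_space"
  assumes "x \<noteq> 0"
  shows "jet2 norm x (x /\<^sub>R norm x) ((real DIM('a) - 1) / norm x)"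
proof -
  have n: "norm x > 0" and xx: "x \<bullet> x = norm x ^ 2"
    using assms by (auto simp: power2_norm_eq_inner)
  have ev: "\<forall>\<^sub>F s in nhds (x \<bullet> x). s > 0"
    by (rule eventually_nhds_in_open[of "{0<..}", simplified]) (use assms in auto)
  have 1: "\<forall>\<^sub>F s in nhds ((x - 0) \<bullet> (x - 0)). (sqrt has_real_derivative inverse (sqrt s) / 2) (at s)"
    using ev by (simp, eventually_elim) (rule DERIV_real_sqrt)
  have "((\<lambda>s. inverse (sqrt s) / 2) has_real_derivative - (1 / (4 * norm x ^ 3))) (at ((x - 0) \<bullet> (x - 0)))"
    using n by (auto intro!: derivative_eq_intros simp: xx real_sqrt_unique power2_eq_square power3_eq_cube field_simps)
  note j = jet2_compose[OF jet2_sqdist[of 0 x] 1 this]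
  have f: "sqrt ((y - 0) \<bullet> (y - 0)) = norm y" for y :: 'a
    by (simp add: norm_eq_sqrt_inner)
  have "jet2 (\<lambda>y. norm y) x ((inverse (norm x) / 2) *\<^sub>R (2 *\<^sub>R (x - 0)))
     (inverse (norm x) / 2 * (2 * real DIM('a)) + - (1 / (4 * norm x ^ 3)) * (2 *\<^sub>R (x - 0) \<bullet> 2 *\<^sub>R (x - 0)))"
    using j unfolding f .
  also have "inverse (norm x) / 2 * (2 * real DIM('a)) + - (1 / (4 * norm x ^ 3)) * (2 *\<^sub>R (x - 0) \<bullet> 2 *\<^sub>R (x - 0))
     = (real DIM('a) - 1) / norm x"
    using n by (simp add: xx field_simps power2_eq_square power3_eq_cube)
  finally show ?thesis
    by simp
qed

text \<open>The Laplacian is the trace of the Hessian, and a trace may be computed in any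
  orthonormal basis. Besides the invariance of the equation this gives, in
  \<open>radial_flux_mono\<close>, the splitting into radial and tangential second
  derivatives.\<close>

lemma trace_orthogonal:
  fixes H Q :: "'a::euclidean_space \<Rightarrow> 'a"
  assumes "linear H" "orthogonal_transformation Q"
  shows "(\<Sum>b\<in>Basis. H (Q b) \<bullet> Q b) = (\<Sum>b\<in>Basis. H b \<bullet> b)"
proof -
  interpret H: linear H by fact
  define Q' where "Q' = inv Q"
  have Q': "orthogonal_transformation Q'"
    unfolding Q'_def by (rule orthogonal_transformation_inv[OF assms(2)])
  have QQ: "Q (Q' y) = y" for y
    unfolding Q'_def using orthogonal_transformation_surj[OF assms(2)] by (simp add: surj_f_inv_f)
  have adj: "Q b \<bullet> c = b \<bullet> Q' c" for b c
    using assms(2) unfolding orthogonal_transformation_def by (metis QQ)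
  have rep: "y = (\<Sum>c\<in>Basis. (y \<bullet> c) *\<^sub>R c)" for y :: 'a
    by (simp add: euclidean_representation)
  \<comment> \<open>Expanding both slots in \<open>Basis\<close> leaves the coefficients
    \<open>(b \<bullet> Q' c) * (b \<bullet> Q' d)\<close>, whose sum over \<open>b\<close> is
    \<open>Q' c \<bullet> Q' d\<close>, a Kronecker delta.\<close>
  have "(\<Sum>b\<in>Basis. H (Q b) \<bullet> Q b) =
     (\<Sum>b\<in>Basis. \<Sum>c\<in>Basis. \<Sum>d\<in>Basis. ((b \<bullet> Q' c) * (b \<bullet> Q' d)) * (H c \<bullet> d))"
  proof (rule sum.cong[OF refl])
    fix b :: 'a
    have "H (Q b) = (\<Sum>c\<in>Basis. (Q b \<bullet> c) *\<^sub>R H c)"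
      by (subst rep[of "Q b"]) (simp add: H.sum H.scale del: euclidean_representation)
    then have "H (Q b) \<bullet> Q b = (\<Sum>c\<in>Basis. (Q b \<bullet> c) * (H c \<bullet> Q b))"
      by (simp add: inner_sum_left)
    also have "\<dots> = (\<Sum>c\<in>Basis. \<Sum>d\<in>Basis. (Q b \<bullet> c) * ((Q b \<bullet> d) * (H c \<bullet> d)))"
      by (intro sum.cong refl, subst (2) rep[of "Q b"])
        (simp add: inner_sum_right sum_distrib_left del: euclidean_representation)
    finally show "H (Q b) \<bullet> Q b = (\<Sum>c\<in>Basis. \<Sum>d\<in>Basis. ((b \<bullet> Q' c) * (b \<bullet> Q' d)) * (H c \<bullet> d))"
      by (simp add: adj mult.assoc)
  qed
  also have "\<dots> = (\<Sum>c\<in>Basis. \<Sum>b\<in>Basis. \<Sum>d\<in>Basis. ((b \<bullet> Q' c) * (b \<bullet> Q' d)) * (H c \<bullet> d))"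
    by (rule sum.swap)
  also have "\<dots> = (\<Sum>c\<in>Basis. \<Sum>d\<in>Basis. (\<Sum>b\<in>Basis. (b \<bullet> Q' c) * (b \<bullet> Q' d)) * (H c \<bullet> d))"
    by (rule sum.cong[OF refl]) (subst sum.swap, simp add: sum_distrib_right)
  also have "\<dots> = (\<Sum>c\<in>Basis. \<Sum>d\<in>Basis. (Q' c \<bullet> Q' d) * (H c \<bullet> d))"
    by (simp add: euclidean_inner[of "Q' _" "Q' _"] inner_commute)
  also have "\<dots> = (\<Sum>c\<in>Basis. \<Sum>d\<in>Basis. (if c = d then 1 else 0) * (H c \<bullet> d))"
    using Q' by (intro sum.cong refl) (auto simp: orthogonal_transformation_def inner_Basis)
  also have "\<dots> = (\<Sum>b\<in>Basis. H b \<bullet> b)"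
    by (intro sum.cong refl) (simp add: if_distrib[where f = "\<lambda>x. x * _"] sum.delta cong: if_cong)
  finally show ?thesis .
qed

text \<open>The gradient is left existential because only continuity and the Laplacian of such
  compositions are read off later.\<close>

lemma jet2_orthogonal:
  fixes Q :: "'a::euclidean_space \<Rightarrow> 'a"
  assumes "jet2 f (Q x) p l" "orthogonal_transformation Q"
  shows "\<exists>q. jet2 (\<lambda>y. f (Q y)) x q l"
proof -
  obtain P H where 1: "\<forall>\<^sub>F y in nhds (Q x). (f has_derivative (\<lambda>h. P y \<bullet> h)) (at y)" "P (Q x) = p"
     "(P has_derivative H) (at (Q x))" "l = (\<Sum>b\<in>Basis. H b \<bullet> b)"
    using assms(1) unfolding jet2_def by auto
  define Q' where "Q' = inv Q"
  have Q': "orthogonal_transformation Q'"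
    unfolding Q'_def by (rule orthogonal_transformation_inv[OF assms(2)])
  have QQ: "Q (Q' y) = y" for y
    unfolding Q'_def using orthogonal_transformation_surj[OF assms(2)] by (simp add: surj_f_inv_f)
  have adj: "c \<bullet> Q b = Q' c \<bullet> b" for b c
    using assms(2) unfolding orthogonal_transformation_def by (metis QQ)
  have bl: "bounded_linear Q" "bounded_linear Q'"
    using orthogonal_transformation_linear assms(2) Q' by (auto intro: linear_conv_bounded_linear[THEN iffD1])
  have dQ: "(Q has_derivative Q) (at y)" and dQ': "(Q' has_derivative Q') (at y)" for y
    using bl bounded_linear_imp_has_derivative by auto
  have "jet2 (\<lambda>y. f (Q y)) x (Q' p) l"
  proof (rule jet2I[where P = "\<lambda>y. Q' (P (Q y))" and H = "\<lambda>h. Q' (H (Q h))"])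
    have "filterlim Q (nhds (Q x)) (nhds x)"
      using has_derivative_continuous[OF dQ] by (simp add: isCont_def tendsto_at_iff_tendsto_nhds)
    then have "\<forall>\<^sub>F y in nhds x. (f has_derivative (\<lambda>h. P (Q y) \<bullet> h)) (at (Q y))"
      using 1(1) by (rule eventually_compose_filterlim[rotated])
    then show "\<forall>\<^sub>F y in nhds x. ((\<lambda>y. f (Q y)) has_derivative (\<lambda>h. Q' (P (Q y)) \<bullet> h)) (at y)"
      by eventually_elim (use has_derivative_compose[OF dQ] in \<open>fastforce simp: adj\<close>)
    show "((\<lambda>y. Q' (P (Q y))) has_derivative (\<lambda>h. Q' (H (Q h)))) (at x)"
      by (intro has_derivative_compose[OF _ dQ'] has_derivative_compose[OF dQ 1(3)])
    have "linear H"
      using 1(3) has_derivative_linear by blast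
    from trace_orthogonal[OF this assms(2)]
    show "l = (\<Sum>b\<in>Basis. Q' (H (Q b)) \<bullet> b)"
      by (simp add: 1(4) adj)
  qed (simp add: 1)
  then show ?thesis ..
qed

text \<open>Second derivative test along coordinate lines: were \<open>H b \<bullet> b\<close>
  positive, the derivative in direction \<open>b\<close>, zero at \<open>x\<close>, would be
  positive shortly after \<open>x\<close>, and \<open>f\<close> would rise above
  \<open>f x\<close>.\<close>

lemma jet2_max:
  assumes "jet2 f x p l" and "\<forall>\<^sub>F y in nhds x. f y \<le> f x"
  shows "p = 0" "l \<le> 0"
proof -
  obtain P H where 1: "\<forall>\<^sub>F y in nhds x. (f has_derivative (\<lambda>h. P y \<bullet> h)) (at y)" "P x = p"
     "(P has_derivative H) (at x)" "l = (\<Sum>b\<in>Basis. H b \<bullet> b)"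
    using assms(1) unfolding jet2_def by auto
  have "\<forall>\<^sub>F y in nhds x. (f has_derivative (\<lambda>h. P y \<bullet> h)) (at y) \<and> f y \<le> f x"
    using 1(1) assms(2) by eventually_elim auto
  then obtain r where r: "r > 0" "\<And>y. dist y x < r \<Longrightarrow> (f has_derivative (\<lambda>h. P y \<bullet> h)) (at y)"
     "\<And>y. dist y x < r \<Longrightarrow> f y \<le> f x"
    unfolding eventually_nhds_metric by blast
  have "(\<lambda>h. p \<bullet> h) = (\<lambda>h. 0)"
    by (rule differential_zero_maxmin[of x "ball x r" f])
      (use r jet2_has_derivative[OF assms(1)] in \<open>auto simp: dist_commute\<close>)
  then have "p \<bullet> p = 0"
    by metis
  then show p0: "p = 0"
    by simp
  have "H b \<bullet> b \<le> 0" if b: "b \<in> Basis" for b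
  proof (rule ccontr)
    assume "\<not> H b \<bullet> b \<le> 0"
    then have pos: "H b \<bullet> b > 0" by simp
    have line: "((\<lambda>t. x + t *\<^sub>R b) has_derivative (\<lambda>t. t *\<^sub>R b)) (at t)" for t
      by (auto intro!: derivative_eq_intros)
    have lH: "linear H"
      using 1(3) has_derivative_linear by blast
    have "((\<lambda>t. P (x + t *\<^sub>R b)) has_derivative (\<lambda>t. H (t *\<^sub>R b))) (at 0)"
      by (rule has_derivative_compose[OF line]) (use 1(3) in simp)
    then have "((\<lambda>t. P (x + t *\<^sub>R b) \<bullet> b) has_derivative (\<lambda>t. H (t *\<^sub>R b) \<bullet> b)) (at 0)"
      by (rule has_derivative_inner_left)
    then have "((\<lambda>t. P (x + t *\<^sub>R b) \<bullet> b) has_real_derivative H b \<bullet> b) (at 0)"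
      unfolding has_field_derivative_def
      by (rule has_derivative_eq_rhs) (auto simp: linear_cmul[OF lH] mult.commute)
    from DERIV_pos_inc_right[OF this pos]
    obtain d where d: "d > 0" "\<And>h. h > 0 \<Longrightarrow> h < d \<Longrightarrow> 0 < P (x + h *\<^sub>R b) \<bullet> b"
      using p0 1(2) by auto
    define T where "T = min d r / 2"
    have T: "T > 0" "T < d" "T < r"
      using d(1) r(1) by (auto simp: T_def)
    have nb: "norm b = 1"
      using b by simp
    have df: "((\<lambda>t. f (x + t *\<^sub>R b)) has_real_derivative P (x + t *\<^sub>R b) \<bullet> b) (at t)" if "0 \<le> t" "t \<le> T" for t
    proof -
      have "dist (x + t *\<^sub>R b) x < r"
        using that T nb by (simp add: dist_norm)
      from has_derivative_compose[OF line r(2)[OF this]]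
      show ?thesis
        unfolding has_field_derivative_def by (rule has_derivative_eq_rhs) (auto simp: mult.commute)
    qed
    have "f (x + 0 *\<^sub>R b) < f (x + T *\<^sub>R b)"
    proof (rule DERIV_pos_imp_increasing_open[OF T(1)])
      show "\<exists>y. ((\<lambda>t. f (x + t *\<^sub>R b)) has_real_derivative y) (at t) \<and> 0 < y" if "0 < t" "t < T" for t
        using df[of t] d(2)[of t] that T by force
      show "continuous_on {0..T} (\<lambda>t. f (x + t *\<^sub>R b))"
        by (intro continuous_at_imp_continuous_on ballI DERIV_isCont) (use df in auto)
    qed
    moreover have "f (x + T *\<^sub>R b) \<le> f x"
      using r(3)[of "x + T *\<^sub>R b"] T nb by (simp add: dist_norm)
    ultimately show False by simp
  qed
  then show "l \<le> 0"
    using 1(4) by (simp add: sum_nonpos)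
qed

lemma jet2_min:
  assumes "jet2 f x p l" and "\<forall>\<^sub>F y in nhds x. f x \<le> f y"
  shows "p = 0" "l \<ge> 0"
  using jet2_max[OF jet2_cmult[OF assms(1), of "-1"]] assms(2) by auto

text \<open>The annulus is open at \<open>R\<close>, where \<open>f\<close> need not have a limit.
  The bound beyond \<open>R2\<close> replaces the missing boundary values: a maximum over a compact
  part is one over the whole annulus, and the strict inequality on the inner sphere makes it
  interior.\<close>

lemma annulus_max_attained:
  fixes f :: "'a::euclidean_space \<Rightarrow> real"
  assumes "continuous_on {x. R1 \<le> norm x \<and> norm x < R} f"
    and x0: "R1 \<le> norm x0" "norm x0 < R"
    and R2: "R2 < R" "\<And>x. R2 \<le> norm x \<Longrightarrow> R1 \<le> norm x \<Longrightarrow> norm x < R \<Longrightarrow> f x \<le> f x0"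
    and inner: "\<And>x. norm x = R1 \<Longrightarrow> f x < f x0"
  obtains x where "R1 < norm x" "norm x < R" "f x0 \<le> f x"
    "\<And>y. R1 \<le> norm y \<Longrightarrow> norm y < R \<Longrightarrow> f y \<le> f x" "\<forall>\<^sub>F y in nhds x. f y \<le> f x"
proof -
  \<comment> \<open>The outer radius must reach \<open>x0\<close>, so that \<open>f x0\<close> is
    dominated by the maximum over \<open>K\<close>; points of the annulus outside \<open>K\<close>
    lie beyond \<open>R2\<close>.\<close>
  define K where "K = {x::'a. R1 \<le> norm x \<and> norm x \<le> max R2 (norm x0)}"
  have "K = cball 0 (max R2 (norm x0)) \<inter> {x. R1 \<le> norm x}"
    by (auto simp: K_def)
  moreover have "closed {x::'a. R1 \<le> norm x}"
    by (intro closed_Collect_le continuous_intros)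
  ultimately have "compact K"
    by (simp add: compact_Int_closed)
  moreover have "x0 \<in> K"
    using x0 by (auto simp: K_def)
  moreover have "continuous_on K f"
    by (rule continuous_on_subset[OF assms(1)]) (use x0 R2 in \<open>auto simp: K_def\<close>)
  ultimately obtain x where x: "x \<in> K" "\<And>y. y \<in> K \<Longrightarrow> f y \<le> f x"
    using continuous_attains_sup[of K f] by blast
  have 1: "f x0 \<le> f x"
    using x(2) \<open>x0 \<in> K\<close> by blast
  have 2: "R1 < norm x" "norm x < R"
    using inner[of x] 1 x(1) R2(1) x0 by (auto simp: K_def max_def order_less_le split: if_splits)
  have 3: "f y \<le> f x" if "R1 \<le> norm y" "norm y < R" for y
  proof (cases "y \<in> K")
    case False
    then have "R2 \<le> norm y"
      using that by (auto simp: K_def)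
    then show ?thesis
      using R2(2)[of y] that 1 by force
  qed (use x in auto)
  have "open {y::'a. R1 < norm y \<and> norm y < R}"
    by (intro open_Collect_conj open_Collect_less continuous_intros)
  from eventually_nhds_in_open[OF this, of x] have "\<forall>\<^sub>F y in nhds x. f y \<le> f x"
    using 2 3 by (auto elim: eventually_mono)
  with 1 2 3 show ?thesis
    using that by blast
qed

section \<open>The Keller-Osserman profile\<close>

text \<open>\<open>F\<close> is the square root of \<open>2 * G\<close>, and \<open>\<psi> s\<close> is the integral of \<open>1 / F\<close> over \<open>{s..}\<close>; \<open>\<psi>\<close> linearises
  the one-dimensional solution, as \<open>\<psi> (v t) = R - t\<close> for \<open>v'' = g v\<close> with \<open>v' = F v\<close> and blow-up at \<open>R\<close>.\<close>

locale ko_profile =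
  fixes g :: "real \<Rightarrow> real" and b \<sigma> \<beta> :: real and F \<psi> :: "real \<Rightarrow> real"
  assumes convex: "convex_on {b..} g"
    and sigma_pos: "\<sigma> > 0"
    and slope: "\<And>s t. b \<le> s \<Longrightarrow> s \<le> t \<Longrightarrow> \<sigma> * (t - s) \<le> g t - g s"
    and g_pos: "g b > 0"
    and beta_less: "\<beta> < b"
    and F_pos: "\<And>s. b \<le> s \<Longrightarrow> F s > 0"
    and F_deriv: "\<And>s. b \<le> s \<Longrightarrow> (F has_real_derivative g s / F s) (at s)"
    and ratio_antimono: "\<And>s t. b \<le> s \<Longrightarrow> s \<le> t \<Longrightarrow> (t - \<beta>) / F t \<le> (s - \<beta>) / F s"
    and psi_deriv: "\<And>s. b \<le> s \<Longrightarrow> (\<psi> has_real_derivative - (1 / F s)) (at s)"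
    and psi_pos: "\<And>s. b \<le> s \<Longrightarrow> \<psi> s > 0"
    and psi_lim: "(\<psi> \<longlongrightarrow> 0) at_top"

text \<open>Converts the Lebesgue integral into a bound for increments of antiderivatives;
  \<open>K\<close> is the value of the integral.\<close>

lemma keller_osserman_bound:
  assumes "keller_osserman g a"
  obtains K where "\<And>p q f \<Phi>. \<lbrakk>a < p; p \<le> q; continuous_on {p..q} f;
    \<And>s. p \<le> s \<Longrightarrow> s \<le> q \<Longrightarrow> 0 \<le> f s \<and> f s \<le> 1 / sqrt (primitive_from g a s);
    \<And>s. p \<le> s \<Longrightarrow> s \<le> q \<Longrightarrow> (\<Phi> has_real_derivative f s) (at s)\<rbrakk> \<Longrightarrow> \<Phi> q - \<Phi> p \<le> K"
proof -
  let ?I = "\<integral>\<^sup>+s\<in>{a<..}. ennreal (1 / sqrt (primitive_from g a s)) \<partial>lborel"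
  show ?thesis
  proof (rule that[of "enn2real ?I"])
    fix p q :: real and f \<Phi> :: "real \<Rightarrow> real"
    assume pq: "a < p" "p \<le> q" and fc: "continuous_on {p..q} f"
      and f: "\<And>s. p \<le> s \<Longrightarrow> s \<le> q \<Longrightarrow> 0 \<le> f s \<and> f s \<le> 1 / sqrt (primitive_from g a s)"
      and Phi: "\<And>s. p \<le> s \<Longrightarrow> s \<le> q \<Longrightarrow> (\<Phi> has_real_derivative f s) (at s)"
    \<comment> \<open>Continuity is known on \<open>{p..q}\<close> only; the cut-off makes the
      integrand Borel on the whole line.\<close>
    define h where "h = (\<lambda>x. if x \<in> {p..q} then f x else 0)"
    have "h \<in> borel_measurable borel"
      unfolding h_def using fc by (intro borel_measurable_continuous_on_if) auto
    then have "(\<integral>\<^sup>+x. ennreal (h x) * indicator {p..q} x \<partial>lborel) = \<Phi> q - \<Phi> p"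
      by (rule nn_integral_FTC_Icc) (use pq f Phi in \<open>auto simp: h_def\<close>)
    moreover have "(\<integral>\<^sup>+x. ennreal (h x) * indicator {p..q} x \<partial>lborel) \<le> ?I"
      by (rule nn_integral_mono) (use pq f in \<open>auto simp: h_def indicator_def intro: ennreal_leI\<close>)
    ultimately have "ennreal (\<Phi> q - \<Phi> p) \<le> ?I"
      by simp
    moreover have "?I < top"
      using assms by (simp add: keller_osserman_def)
    ultimately show "\<Phi> q - \<Phi> p \<le> enn2real ?I"
      by (metis enn2real_ennreal enn2real_mono enn2real_nonneg linorder_linear order_trans)
  qed
qed

text \<open>Otherwise \<open>g\<close> stays below \<open>g a\<close> to the right of
  \<open>a\<close>, so \<open>G s\<close> is at most \<open>C * (s - a)\<close> and
  \<open>1 / sqrt G\<close> is not integrable at infinity.\<close>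

lemma exists_increasing_pair:
  assumes "continuous_on UNIV g" "keller_osserman g a"
  obtains s t where "a \<le> s" "s < t" "g s < g t"
proof (rule ccontr)
  assume "\<not> thesis"
  then have "\<not> (a < t \<and> g a < g t)" for t
    using that[of a t] by auto
  then have ni: "g t \<le> g a" if "a \<le> t" for t
    using that by (metis less_le not_less)
  define C where "C = max (g a) 1"
  have C: "C > 0" by (simp add: C_def)
  obtain K where K: "\<And>p q f \<Phi>. \<lbrakk>a < p; p \<le> q; continuous_on {p..q} f;
    \<And>s. p \<le> s \<Longrightarrow> s \<le> q \<Longrightarrow> 0 \<le> f s \<and> f s \<le> 1 / sqrt (primitive_from g a s);
    \<And>s. p \<le> s \<Longrightarrow> s \<le> q \<Longrightarrow> (\<Phi> has_real_derivative f s) (at s)\<rbrakk> \<Longrightarrow> \<Phi> q - \<Phi> p \<le> K"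
    using keller_osserman_bound[OF assms(2)] by blast
  have G: "0 < primitive_from g a s" "primitive_from g a s \<le> C * (s - a)" if "a < s" for s
  proof -
    show "0 < primitive_from g a s"
      using assms(2) that by (simp add: keller_osserman_def)
    have "g integrable_on {a..s}"
      by (rule integrable_continuous_interval[OF continuous_on_subset[OF assms(1)]]) auto
    then have "integral {a..s} g \<le> integral {a..s} (\<lambda>_. C)"
      by (rule integral_le) (use ni in \<open>auto simp: C_def le_max_iff_disj\<close>)
    then show "primitive_from g a s \<le> C * (s - a)"
      using that by (simp add: primitive_from_def mult.commute)
  qed
  have bd: "2 / C * sqrt (C * (q - a)) - 2 / C * sqrt (C * 1) \<le> K" if "a + 1 \<le> q" for q
  proof -
    have "2 / C * sqrt (C * (q - a)) - 2 / C * sqrt (C * (a + 1 - a)) \<le> K"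
    proof (rule K[where f = "\<lambda>s. 1 / sqrt (C * (s - a))" and \<Phi> = "\<lambda>q. 2 / C * sqrt (C * (q - a))"
          and p = "a + 1" and q = q])
      show "continuous_on {a + 1..q} (\<lambda>s. 1 / sqrt (C * (s - a)))"
        using C by (intro continuous_intros) auto
      fix s assume s: "a + 1 \<le> s" "s \<le> q"
      have "sqrt (primitive_from g a s) \<le> sqrt (C * (s - a))"
        using G(2)[of s] s by simp
      moreover have "sqrt (primitive_from g a s) > 0"
        using G(1)[of s] s by simp
      ultimately show "0 \<le> 1 / sqrt (C * (s - a)) \<and> 1 / sqrt (C * (s - a)) \<le> 1 / sqrt (primitive_from g a s)"
        using C s by (auto intro: divide_left_mono)
    next
      fix s assume s: "a + 1 \<le> s" "s \<le> q"
      show "((\<lambda>q. 2 / C * sqrt (C * (q - a))) has_real_derivative 1 / sqrt (C * (s - a))) (at s)"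
      proof -
        have "C * (s - a) > 0"
          using C s by simp
        then show ?thesis
          using C by (auto intro!: derivative_eq_intros simp: divide_simps)
      qed
    qed (use that in auto)
    then show ?thesis by simp
  qed
  \<comment> \<open>At the point \<open>q\<close> below, the antiderivative
    \<open>2 / C * sqrt (C * (q - a))\<close> is at least \<open>2 * k\<close>, whereas
    \<open>bd\<close> keeps it at most \<open>k - 1\<close>.\<close>
  define k where "k = K + 2 / C * sqrt C + 1"
  have "k \<ge> 1"
    using bd[of "a + 1"] C by (auto simp: k_def)
  define q where "q = a + 1 + C * k ^ 2"
  have "C * k \<le> sqrt (C * (q - a))"
    using C \<open>k \<ge> 1\<close> by (intro real_le_rsqrt) (simp add: q_def power2_eq_square algebra_simps)
  then have "2 * k \<le> 2 / C * sqrt (C * (q - a))"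
    using C by (simp add: field_simps)
  moreover have "2 / C * sqrt (C * (q - a)) - 2 / C * sqrt (C * 1) \<le> K"
    using C by (intro bd) (simp add: q_def)
  ultimately show False
    using \<open>k \<ge> 1\<close> by (simp add: k_def)
qed

text \<open>By convexity the secant slope of one increasing pair persists to the right, which gives
  \<open>\<sigma>\<close>. Monotonicity of \<open>(s - \<beta>) / F s\<close> amounts to
  \<open>2 * G s \<le> (s - \<beta>) * g s\<close>, and \<open>\<beta>\<close> is moved left until
  the trapezoidal bound for \<open>G\<close> yields this.\<close>

lemma ko_profile_exists:
  assumes cont: "continuous_on UNIV g" and conv: "convex_on {a..} g" and ko: "keller_osserman g a"
  shows "\<exists>b \<sigma> \<beta> F \<psi>. ko_profile g b \<sigma> \<beta> F \<psi>"
proof -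
  obtain s0 t0 where st: "a \<le> s0" "s0 < t0" "g s0 < g t0"
    using exists_increasing_pair[OF cont ko] by blast
  define \<sigma> where "\<sigma> = (g t0 - g s0) / (t0 - s0)"
  have sig: "\<sigma> > 0" using st by (simp add: \<sigma>_def)
  have slope: "\<sigma> * (t - s) \<le> g t - g s" if "t0 \<le> s" "s \<le> t" for s t
  proof (cases "s = t")
    case False
    have 1: "\<sigma> \<le> (g s - g s0) / (s - s0)"
    proof (cases "s = t0")
      case False
      then show ?thesis
        using convex_on_slope_le(1)[OF conv, of s0 s t0] st that
        by (simp add: \<sigma>_def) (metis (no_types, lifting) minus_diff_eq minus_divide_divide)
    qed (simp add: \<sigma>_def)
    have "(g s0 - g t) / (s0 - t) \<le> (g s - g t) / (s - t)" "(g s0 - g s) / (s0 - s) \<le> (g s0 - g t) / (s0 - t)"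
      using convex_on_slope_le[OF conv, of s0 t s] st that False by auto
    then have "(g s0 - g s) / (s0 - s) \<le> (g s - g t) / (s - t)"
      by linarith
    then have "\<sigma> \<le> (g t - g s) / (t - s)"
      using 1 by (metis (no_types, lifting) minus_diff_eq minus_divide_divide order_trans)
    then show ?thesis
      using False that by (simp add: pos_le_divide_eq)
  qed simp
  \<comment> \<open>The second term of the maximum gives
    \<open>1 - g t0 \<le> \<sigma> * (b - t0)\<close>, and with \<open>slope\<close> this forces
    \<open>g b \<ge> 1\<close>.\<close>
  define b where "b = max t0 (t0 + (1 - g t0) / \<sigma>) + 1"
  have bt: "b > t0" "b > a" using st by (auto simp: b_def)
  have gb: "g b > 0"
  proof -
    have "1 - g t0 \<le> \<sigma> * (b - t0)"
      using sig by (simp add: b_def max_def field_simps)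
    then show ?thesis
      using slope[of t0 b] bt by simp
  qed
  have slope': "\<sigma> * (t - s) \<le> g t - g s" if "b \<le> s" "s \<le> t" for s t
    using slope[of s t] that bt by simp
  have gpos: "g s > 0" if "b \<le> s" for s
    using slope'[of b s] that gb sig by (smt (verit) mult_nonneg_nonneg)
  define G where "G = primitive_from g a"
  have Gpos: "G s > 0" if "a < s" for s
    using ko that by (simp add: G_def keller_osserman_def)
  have prim: "((\<lambda>s. integral {p..s} h) has_real_derivative h s) (at s)"
    if "p < s" "continuous_on {p..s+1} h" for p s and h :: "real \<Rightarrow> real"
  proof -
    have "((\<lambda>s. integral {p..s} h) has_real_derivative h s) (at s within {p..s+1})"
      using that by (intro integral_has_real_derivative) auto
    moreover have "at s within {p..s+1} = at s"
      by (rule at_within_interior) (use that in auto)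
    ultimately show ?thesis by simp
  qed
  have G': "(G has_real_derivative g s) (at s)" if "a < s" for s
    unfolding G_def primitive_from_def[abs_def]
    by (rule prim[OF that]) (rule continuous_on_subset[OF cont], simp)
  define F where "F = (\<lambda>s. sqrt (2 * G s))"
  have Fpos: "F s > 0" if "a < s" for s
    using Gpos[OF that] by (simp add: F_def)
  have F2: "F s * F s = 2 * G s" if "a < s" for s
    using Gpos[OF that] by (simp add: F_def)
  have F': "(F has_real_derivative g s / F s) (at s)" if "a < s" for s
    using Gpos[OF that] unfolding F_def
    by (auto intro!: derivative_eq_intros G'[OF that] simp: divide_simps)
  \<comment> \<open>So far to the left that both \<open>2 * G b \<le> g b * (b - \<beta>)\<close>
    and \<open>g b \<le> \<sigma> * (b - \<beta>)\<close>, the two estimates that enter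
    \<open>key\<close>.\<close>
  define \<beta> where "\<beta> = b - 2 * G b / g b - g b / \<sigma> - 1"
  have "2 * G b / g b > 0" "g b / \<sigma> > 0"
    using gb sig Gpos[OF bt(2)] by auto
  then have beta: "\<beta> < b" "2 * G b / g b \<le> b - \<beta>" "g b / \<sigma> \<le> b - \<beta>"
    by (auto simp: \<beta>_def)
  \<comment> \<open>The trapezoidal rule overestimates the integral of a convex function.\<close>
  have trap: "2 * G s \<le> 2 * G b + (s - b) * (g b + g s)" if "b \<le> s" for s
  proof (cases "s = b")
    case False
    define k where "k = (g s - g b) / (s - b)"
    have sb: "s > b" using False that by simp
    \<comment> \<open>Up to a constant, \<open>D\<close> is the integral of \<open>g\<close> minus
      its chord over \<open>{b..s}\<close>; convexity makes its derivative nonpositive.\<close>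
    define D where "D = (\<lambda>t. G t - g b * (t - b) - k * (t - b)^2 / 2)"
    have "D s \<le> D b"
    proof (rule DERIV_nonpos_imp_nonincreasing[OF that])
      fix t assume t: "b \<le> t" "t \<le> s"
      have "g t \<le> g b + (t - b) * k"
      proof (cases "t = b \<or> t = s")
        case False
        then have tt: "b < t" "t < s" using t by auto
        have "(g b - g t) / (b - t) \<le> (g b - g s) / (b - s)"
          by (rule convex_on_slope_le(1)[OF conv]) (use tt bt in auto)
        then have "(g t - g b) / (t - b) \<le> k"
          unfolding k_def by (metis minus_diff_eq minus_divide_divide)
        then show ?thesis using tt by (simp add: field_simps)
      qed (use sb in \<open>auto simp: k_def\<close>)
      moreover have "(D has_real_derivative g t - g b - k * (t - b)) (at t)"
        unfolding D_def using t bt by (auto intro!: derivative_eq_intros G')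
      ultimately show "\<exists>y. (D has_real_derivative y) (at t) \<and> y \<le> 0"
        by (intro exI[of _ "g t - g b - k * (t - b)"]) (simp add: algebra_simps)
    qed
    moreover have "k * (s - b)^2 = (g s - g b) * (s - b)"
      using sb by (simp add: k_def power2_eq_square)
    ultimately have "G s - g b * (s - b) - (g s - g b) * (s - b) / 2 \<le> G b"
      by (simp add: D_def)
    then show ?thesis
      by (simp add: field_simps)
  qed simp
  have key: "2 * G s \<le> (s - \<beta>) * g s" if "b \<le> s" for s
  proof -
    have 1: "g b + \<sigma> * (s - b) \<le> g s"
      using slope'[of b s] that by simp
    have "2 * G b \<le> g b * (b - \<beta>)"
      using beta(2) gb by (simp add: pos_divide_le_eq mult.commute)
    moreover have "g b * (s - b) \<le> (\<sigma> * (b - \<beta>)) * (s - b)"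
      using beta(3) sig that by (intro mult_right_mono) (simp_all add: pos_divide_le_eq mult.commute)
    moreover have "(g b + \<sigma> * (s - b)) * (b - \<beta>) \<le> g s * (b - \<beta>)"
      using 1 beta(1) by (intro mult_right_mono) auto
    ultimately have "2 * G b + (s - b) * g b \<le> g s * (b - \<beta>)"
      by (simp add: algebra_simps)
    then show ?thesis
      using trap[OF that] by (simp add: algebra_simps)
  qed
  have anti: "(t - \<beta>) / F t \<le> (s - \<beta>) / F s" if "b \<le> s" "s \<le> t" for s t
  proof (rule DERIV_nonpos_imp_nonincreasing[OF that(2)])
    fix x assume x: "s \<le> x" "x \<le> t"
    then have bx: "b \<le> x" "a < x" using that bt by auto
    have "((\<lambda>x. (x - \<beta>) / F x) has_real_derivative (F x - (x - \<beta>) * (g x / F x)) / (F x * F x)) (at x)"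
      using Fpos[OF bx(2)] by (auto intro!: derivative_eq_intros F'[OF bx(2)])
    moreover have "F x - (x - \<beta>) * (g x / F x) = (F x * F x - (x - \<beta>) * g x) / F x"
      using Fpos[OF bx(2)] by (simp add: field_simps)
    then have "F x - (x - \<beta>) * (g x / F x) \<le> 0"
      using F2[OF bx(2)] key[OF bx(1)] Fpos[OF bx(2)] by (simp add: divide_nonpos_pos)
    ultimately show "\<exists>y. ((\<lambda>x. (x - \<beta>) / F x) has_real_derivative y) (at x) \<and> y \<le> 0"
      using Fpos[OF bx(2)] by (blast intro: divide_nonpos_pos mult_pos_pos)
  qed
  \<comment> \<open>\<open>F\<close> vanishes at \<open>a\<close>, and a two-sided derivative is
    wanted at \<open>b\<close>; hence a base point strictly between them.\<close>
  define b0 where "b0 = (a + b) / 2"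
  have b0: "a < b0" "b0 < b" using bt by (auto simp: b0_def)
  define J where "J = (\<lambda>s. integral {b0..s} (\<lambda>x. 1 / F x))"
  have Fcont: "continuous_on {b0..s} (\<lambda>x. 1 / F x)" for s
  proof -
    have "continuous_on {b0..s} F"
      by (intro continuous_at_imp_continuous_on ballI DERIV_isCont[OF F']) (use b0 in auto)
    then show ?thesis
      using b0 Fpos by (intro continuous_intros) (auto simp: less_imp_neq[THEN not_sym])
  qed
  have J': "(J has_real_derivative 1 / F s) (at s)" if "b0 < s" for s
    unfolding J_def by (rule prim[OF that Fcont])
  obtain K where K: "\<And>p q f \<Phi>. \<lbrakk>a < p; p \<le> q; continuous_on {p..q} f;
    \<And>s. p \<le> s \<Longrightarrow> s \<le> q \<Longrightarrow> 0 \<le> f s \<and> f s \<le> 1 / sqrt (primitive_from g a s);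
    \<And>s. p \<le> s \<Longrightarrow> s \<le> q \<Longrightarrow> (\<Phi> has_real_derivative f s) (at s)\<rbrakk> \<Longrightarrow> \<Phi> q - \<Phi> p \<le> K"
    using keller_osserman_bound[OF ko] by blast
  have Jbd: "J s - J b \<le> K" if "b \<le> s" for s
  proof (rule K[where f = "\<lambda>x. 1 / F x" and \<Phi> = J and p = b and q = s])
    show "continuous_on {b..s} (\<lambda>x. 1 / F x)"
      by (rule continuous_on_subset[OF Fcont[of s]]) (use b0 in auto)
    fix x assume x: "b \<le> x" "x \<le> s"
    have "sqrt (G x) \<le> F x" "sqrt (G x) > 0" "F x > 0"
      using Gpos[of x] Fpos[of x] x bt by (auto simp: F_def)
    then show "0 \<le> 1 / F x \<and> 1 / F x \<le> 1 / sqrt (primitive_from g a x)"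
      unfolding G_def[symmetric] by (simp add: frac_le)
  next
    fix x assume x: "b \<le> x" "x \<le> s"
    show "(J has_real_derivative 1 / F x) (at x)"
      using x b0 by (intro J') auto
  qed (use bt that in auto)
  have Jstrict: "J s < J t" if "b \<le> s" "s < t" for s t
  proof (rule DERIV_pos_imp_increasing[OF that(2)])
    fix x assume "s \<le> x" "x \<le> t"
    then have "b0 < x" "a < x" using that b0 bt by auto
    then show "\<exists>y. (J has_real_derivative y) (at x) \<and> 0 < y"
      using J' Fpos by (intro exI[of _ "1 / F x"]) simp
  qed
  \<comment> \<open>The supremum stands for the integral of \<open>1 / F\<close> from
    \<open>b0\<close> to infinity, so that \<open>L - J s\<close> is the tail beyond
    \<open>s\<close>.\<close>
  define L where "L = (SUP s\<in>{b..}. J s)"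
  have bdd: "bdd_above (J ` {b..})"
    using Jbd by (intro bdd_aboveI[of _ "K + J b"]) (auto simp: algebra_simps)
  have JL: "J s \<le> L" if "b \<le> s" for s
    unfolding L_def using that by (intro cSUP_upper bdd) auto
  have JL': "J s < L" if "b \<le> s" for s
    using Jstrict[of s "s+1"] JL[of "s+1"] that by simp
  have lim: "(J \<longlongrightarrow> L) at_top"
  proof (rule order_tendstoI)
    fix y assume "y < L"
    then obtain s where s: "b \<le> s" "y < J s"
      unfolding L_def using less_cSUP_iff[OF _ bdd, of y] by auto
    have "y < J t" if "s \<le> t" for t
      using s that Jstrict[of s t] by (cases "s = t") auto
    then show "\<forall>\<^sub>F t in at_top. y < J t"
      using eventually_at_top_linorder by blast
  next
    fix y assume "L < y"
    then show "\<forall>\<^sub>F t in at_top. J t < y"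
      using JL unfolding eventually_at_top_linorder by (meson le_less_trans)
  qed
  have "ko_profile g b \<sigma> \<beta> F (\<lambda>s. L - J s)"
  proof
    show "convex_on {b..} g"
      by (rule convex_on_subset[OF conv]) (use bt in auto)
    show "((\<lambda>s. L - J s) has_real_derivative - (1 / F s)) (at s)" if "b \<le> s" for s
      using J'[of s] that b0 by (auto intro!: derivative_eq_intros)
    show "((\<lambda>s. L - J s) \<longlongrightarrow> 0) at_top"
      using tendsto_diff[OF tendsto_const[of L] lim] by simp
  qed (use sig slope' gb beta Fpos F' anti JL' bt in auto)
  then show ?thesis by blast
qed

section \<open>Growth of the profile and its perturbation\<close>

context ko_profile
begin

lemma g_mono: "b \<le> s \<Longrightarrow> s \<le> t \<Longrightarrow> g s \<le> g t"
  using slope[of s t] sigma_pos by (smt (verit) mult_nonneg_nonneg)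

lemma g_pos': "b \<le> s \<Longrightarrow> 0 < g s"
  using g_mono[of b s] g_pos by simp

lemma F_mono:
  assumes "b \<le> s" "s \<le> t"
  shows "F s \<le> F t"
proof (rule DERIV_nonneg_imp_nondecreasing[OF assms(2)])
  fix x assume "s \<le> x" "x \<le> t"
  then show "\<exists>y. (F has_real_derivative y) (at x) \<and> 0 \<le> y"
    using assms F_deriv[of x] F_pos[of x] g_pos'[of x] by (intro exI[of _ "g x / F x"]) auto
qed

lemma psi_small:
  assumes "\<epsilon> > 0"
  obtains s1 where "b \<le> s1" "\<And>s. s1 \<le> s \<Longrightarrow> \<psi> s < \<epsilon>"
proof -
  have "\<forall>\<^sub>F s in at_top. \<psi> s < \<epsilon>"
    by (rule order_tendstoD(2)[OF psi_lim assms])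
  then obtain s where "\<And>t. s \<le> t \<Longrightarrow> \<psi> t < \<epsilon>"
    unfolding eventually_at_top_linorder by blast
  then show ?thesis
    using that[of "max b s"] by simp
qed

text \<open>If \<open>F s\<close> were \<open>O(s - \<beta>)\<close>, then the integral of \<open>1 / F\<close> would diverge logarithmically.\<close>

lemma F_superlinear:
  assumes "\<kappa> > 0"
  obtains s1 where "b \<le> s1" "\<And>s. s1 \<le> s \<Longrightarrow> \<kappa> * (s - \<beta>) \<le> F s"
proof -
  have "\<exists>s1\<ge>b. \<kappa> * (s1 - \<beta>) \<le> F s1"
  proof (rule ccontr)
    assume "\<not> ?thesis"
    then have lt: "F s < \<kappa> * (s - \<beta>)" if "b \<le> s" for s
      using that by (meson not_le)
    \<comment> \<open>Chosen so that \<open>ln (q - \<beta>) / \<kappa>\<close> exceeds its value at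
      \<open>b\<close> by exactly \<open>\<psi> b\<close>; the comparison below then forces
      \<open>\<psi> q \<le> 0\<close>.\<close>
    define q where "q = \<beta> + (b - \<beta>) * exp (\<kappa> * \<psi> b)"
    have "1 \<le> exp (\<kappa> * \<psi> b)"
      using assms psi_pos[of b] by simp
    then have "(b - \<beta>) * 1 \<le> (b - \<beta>) * exp (\<kappa> * \<psi> b)"
      using beta_less by (intro mult_left_mono) auto
    then have q: "b \<le> q"
      by (simp add: q_def)
    have "\<psi> q + ln (q - \<beta>) / \<kappa> \<le> \<psi> b + ln (b - \<beta>) / \<kappa>"
    proof (rule DERIV_nonpos_imp_nonincreasing[OF q])
      fix x assume x: "b \<le> x" "x \<le> q"
      have "((\<lambda>x. \<psi> x + ln (x - \<beta>) / \<kappa>) has_real_derivative - (1 / F x) + 1 / (\<kappa> * (x - \<beta>))) (at x)"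
        using x beta_less assms by (auto intro!: derivative_eq_intros psi_deriv simp: field_simps)
      moreover have "1 / (\<kappa> * (x - \<beta>)) \<le> 1 / F x"
        using lt[OF x(1)] F_pos[OF x(1)] by (intro divide_left_mono) auto
      ultimately show "\<exists>y. ((\<lambda>x. \<psi> x + ln (x - \<beta>) / \<kappa>) has_real_derivative y) (at x) \<and> y \<le> 0"
        by (intro exI[of _ "- (1 / F x) + 1 / (\<kappa> * (x - \<beta>))"]) simp
    qed
    moreover have "ln (q - \<beta>) / \<kappa> = ln (b - \<beta>) / \<kappa> + \<psi> b"
      using beta_less assms by (simp add: q_def ln_mult add_divide_distrib)
    ultimately show False
      using psi_pos[OF q] by simp
  qed
  then obtain s1 where s1: "b \<le> s1" "\<kappa> * (s1 - \<beta>) \<le> F s1" by blast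
  show ?thesis
  proof (rule that[OF s1(1)])
    fix s assume s: "s1 \<le> s"
    \<comment> \<open>\<open>ratio_antimono\<close> carries the inequality from the single point
      \<open>s1\<close> to everything on its right.\<close>
    have "(s - \<beta>) / F s \<le> (s1 - \<beta>) / F s1"
      by (rule ratio_antimono[OF s1(1) s])
    also have "\<dots> \<le> 1 / \<kappa>"
      using s1 assms F_pos[OF s1(1)] by (simp add: field_simps)
    finally show "\<kappa> * (s - \<beta>) \<le> F s"
      using assms F_pos[of s] s s1 by (simp add: field_simps)
  qed
qed

text \<open>Subtracting \<open>\<kappa> * (s - \<beta>)\<close> from \<open>F\<close> absorbs the curvature term \<open>(N - 1) / r\<close> of the Laplacian in
  the upper barrier.\<close>

lemma perturbed_psi:
  assumes "\<kappa> > 0"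
  obtains s1 \<psi>' where "b \<le> s1" "s0 \<le> s1" "\<And>s. s1 \<le> s \<Longrightarrow> 2 * \<kappa> * (s - \<beta>) \<le> F s"
    "\<And>s. s1 \<le> s \<Longrightarrow> (\<psi>' has_real_derivative - (1 / (F s - \<kappa> * (s - \<beta>)))) (at s)"
    "\<And>s. s1 \<le> s \<Longrightarrow> 0 < \<psi>' s"
    "\<And>s. s1 \<le> s \<Longrightarrow> \<psi>' s \<le> (1 + 2 * \<kappa> * (s - \<beta>) / F s) * \<psi> s"
proof -
  \<comment> \<open>The factor 2 leaves at least \<open>F s / 2\<close> after the subtraction, so
    the perturbed integrand stays positive and comparable with \<open>1 / F s\<close>.\<close>
  obtain s2 where s2: "b \<le> s2" "\<And>s. s2 \<le> s \<Longrightarrow> (2 * \<kappa>) * (s - \<beta>) \<le> F s"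
    using F_superlinear[of "2 * \<kappa>"] assms by auto
  define s1 where "s1 = max s2 s0 + 1"
  define f where "f = (\<lambda>s. 1 / (F s - \<kappa> * (s - \<beta>)))"
  have den: "F s - \<kappa> * (s - \<beta>) \<ge> F s / 2" "F s > 0" "s > \<beta>" if "s2 \<le> s" for s
    using s2(2)[OF that] F_pos[of s] that s2(1) beta_less by auto
  have fpos: "f s > 0" if "s2 \<le> s" for s
    using den[OF that] by (simp add: f_def)
  have fcont: "continuous_on {s2..s} f" for s
  proof -
    have "continuous_on {s2..s} F"
      by (intro continuous_at_imp_continuous_on ballI DERIV_isCont[OF F_deriv]) (use s2 in auto)
    then show ?thesis
      unfolding f_def using den by (intro continuous_intros) force+
  qed
  define J where "J = (\<lambda>s. integral {s2..s} f)"
  have J': "(J has_real_derivative f s) (at s)" if "s2 < s" for s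
  proof -
    have "(J has_real_derivative f s) (at s within {s2..s+1})"
      unfolding J_def using that fcont by (intro integral_has_real_derivative) auto
    moreover have "at s within {s2..s+1} = at s"
      by (rule at_within_interior) (use that in auto)
    ultimately show ?thesis by simp
  qed
  have s12: "s2 < s1" "b \<le> s1" using s2 by (auto simp: s1_def)
  \<comment> \<open>With \<open>y \<le> 1/2\<close> one has
    \<open>1 / (1 - y) \<le> 1 + 2 * y\<close>; this is where the correction factor in the bound for
    \<open>\<psi>'\<close> comes from.\<close>
  have f_le: "f s \<le> (1 + 2 * \<kappa> * (s - \<beta>) / F s) * (1 / F s)" if "s2 \<le> s" for s
  proof -
    define y where "y = \<kappa> * (s - \<beta>) / F s"
    have y: "0 \<le> y" "y \<le> 1/2"
      using s2(2)[OF that] den[OF that] assms by (auto simp: y_def field_simps)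
    have "1 \<le> (1 + 2 * y) * (1 - y)"
      using mult_left_mono[of y "1/2" "2 * y"] y by (simp add: algebra_simps)
    then have "1 / (1 - y) \<le> 1 + 2 * y"
      using y by (simp add: field_simps)
    moreover have "f s = 1 / (1 - y) * (1 / F s)"
      using den[OF that] by (simp add: f_def y_def field_simps)
    moreover have "1 + 2 * \<kappa> * (s - \<beta>) / F s = 1 + 2 * y"
      by (simp add: y_def)
    ultimately show ?thesis
      using den(2)[OF that] by (metis mult_right_mono divide_nonneg_pos zero_le_one)
  qed
  \<comment> \<open>The correction factor decreases by \<open>ratio_antimono\<close>, so it may be
    frozen at its value \<open>c\<close> in \<open>T\<close>: beyond \<open>T\<close> one has
    \<open>f \<le> c / F\<close>, and \<open>J + c * \<psi>\<close> decreases.\<close>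
  have incr: "J s - J T \<le> (1 + 2 * \<kappa> * (T - \<beta>) / F T) * \<psi> T" if "s1 \<le> T" "T \<le> s" for s T
  proof -
    define c where "c = 1 + 2 * \<kappa> * (T - \<beta>) / F T"
    have c: "c \<ge> 0"
      using den[of T] that s12 assms by (simp add: c_def)
    have "J s + c * \<psi> s \<le> J T + c * \<psi> T"
    proof (rule DERIV_nonpos_imp_nonincreasing[OF that(2)])
      fix x assume x: "T \<le> x" "x \<le> s"
      have bx: "b \<le> x" "s2 < x" using that x s12 by auto
      have "((\<lambda>x. J x + c * \<psi> x) has_real_derivative f x + c * - (1 / F x)) (at x)"
        by (auto intro!: derivative_eq_intros J' psi_deriv bx)
      moreover have "(1 + 2 * \<kappa> * ((x - \<beta>) / F x)) \<le> 1 + 2 * \<kappa> * ((T - \<beta>) / F T)"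
        using ratio_antimono[of T x] that x s12 assms by (intro add_left_mono mult_left_mono) auto
      then have "(1 + 2 * \<kappa> * (x - \<beta>) / F x) * (1 / F x) \<le> c * (1 / F x)"
        unfolding c_def using den(2)[of x] bx by (intro mult_right_mono) auto
      then have "f x + c * - (1 / F x) \<le> 0"
        using f_le[of x] bx by simp
      ultimately show "\<exists>y. ((\<lambda>x. J x + c * \<psi> x) has_real_derivative y) (at x) \<and> y \<le> 0"
        by blast
    qed
    moreover have "0 \<le> c * \<psi> s"
      using c psi_pos[of s] that s12 by simp
    ultimately show ?thesis
      unfolding c_def by linarith
  qed
  define L where "L = (SUP s\<in>{s1..}. J s)"
  have bdd: "bdd_above (J ` {s1..})"
  proof (rule bdd_aboveI)
    fix y assume "y \<in> J ` {s1..}"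
    then obtain s where "y = J s" "s1 \<le> s" by auto
    then show "y \<le> J s1 + (1 + 2 * \<kappa> * (s1 - \<beta>) / F s1) * \<psi> s1"
      using incr[of s1 s] by simp
  qed
  have strict: "J s < J t" if "s1 \<le> s" "s < t" for s t
  proof (rule DERIV_pos_imp_increasing[OF that(2)])
    fix x assume "s \<le> x" "x \<le> t"
    then show "\<exists>y. (J has_real_derivative y) (at x) \<and> 0 < y"
      using J'[of x] fpos[of x] that s12 by (intro exI[of _ "f x"]) simp
  qed
  have JL: "J s < L" if "s1 \<le> s" for s
  proof -
    have "J (s + 1) \<le> L"
      unfolding L_def using that by (intro cSUP_upper bdd) auto
    then show ?thesis
      using strict[of s "s+1"] that by simp
  qed
  show ?thesis
  proof (rule that[of s1 "\<lambda>s. L - J s"])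
    fix s assume s: "s1 \<le> s"
    show "2 * \<kappa> * (s - \<beta>) \<le> F s"
      using s2(2)[of s] s s12 by simp
    show "((\<lambda>s. L - J s) has_real_derivative - (1 / (F s - \<kappa> * (s - \<beta>)))) (at s)"
      using J'[of s] s s12 by (auto intro!: derivative_eq_intros simp: f_def)
    show "0 < L - J s"
      using JL[OF s] by simp
    have "L \<le> J s + (1 + 2 * \<kappa> * (s - \<beta>) / F s) * \<psi> s"
      unfolding L_def
    proof (rule cSUP_least)
      fix t assume "t \<in> {s1..}"
      moreover have "0 \<le> (1 + 2 * \<kappa> * (s - \<beta>) / F s) * \<psi> s"
        using incr[of s s] s by simp
      ultimately show "J t \<le> J s + (1 + 2 * \<kappa> * (s - \<beta>) / F s) * \<psi> s"
        using incr[OF s, of t] strict[of t s] by (cases "s \<le> t") auto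
    qed auto
    then show "L - J s \<le> (1 + 2 * \<kappa> * (s - \<beta>) / F s) * \<psi> s"
      by simp
  qed (use s12 in \<open>auto simp: s1_def\<close>)
qed

end

section \<open>Boundary behaviour of a large solution\<close>

text \<open>\<open>P\<close> and \<open>H\<close> are the gradient and the Hessian of \<open>u\<close>.\<close>

locale large_sol = ko_profile g b \<sigma> \<beta> F \<psi>
  for g b \<sigma> \<beta> F \<psi> +
  fixes u :: "'a::euclidean_space \<Rightarrow> real" and P :: "'a \<Rightarrow> 'a" and H :: "'a \<Rightarrow> 'a \<Rightarrow> 'a" and R :: real
  assumes R_pos: "R > 0"
    and u_deriv: "\<And>x. norm x < R \<Longrightarrow> (u has_derivative (\<lambda>h. P x \<bullet> h)) (at x)"
    and P_deriv: "\<And>x. norm x < R \<Longrightarrow> (P has_derivative H x) (at x)"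
    and H_cont: "\<And>v. v \<in> Basis \<Longrightarrow> continuous_on (ball 0 R) (\<lambda>x. H x v)"
    and lapl: "\<And>x. norm x < R \<Longrightarrow> (\<Sum>v\<in>Basis. H x v \<bullet> v) = g (u x)"
    and blowup: "\<And>M. \<exists>r<R. \<forall>x. r < norm x \<longrightarrow> norm x < R \<longrightarrow> M < u x"
    and g_lip: "locally_lipschitz g"
begin

lemma jet2_u:
  assumes "norm x < R"
  shows "jet2 u x (P x) (g (u x))"
proof (rule jet2I[where P = P and H = "H x"])
  have "open {y::'a. norm y < R}"
    by (intro open_Collect_less continuous_intros)
  from eventually_nhds_in_open[OF this, of x]
  show "\<forall>\<^sub>F y in nhds x. (u has_derivative (\<lambda>h. P y \<bullet> h)) (at y)"
    using assms by (auto elim!: eventually_mono intro: u_deriv)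
qed (use assms P_deriv lapl in auto)

lemma u_cont: "continuous_on (ball 0 R) u"
  by (intro continuous_at_imp_continuous_on ballI jet2_isCont[OF jet2_u]) simp

lemma blowupE:
  obtains r where "0 < r" "r < R" "\<And>x. r \<le> norm x \<Longrightarrow> norm x < R \<Longrightarrow> M < u x"
proof -
  obtain r where r: "r < R" "\<And>x. r < norm x \<Longrightarrow> norm x < R \<Longrightarrow> M < u x"
    using blowup by blast
  show ?thesis
    using r(1) R_pos by (intro that[of "(max r 0 + R) / 2"] r(2)) (auto simp: max_def split: if_splits)
qed

text \<open>At an interior maximum of \<open>\<psi> (u x + M) + norm x\<close> the gradient of \<open>u\<close> has norm \<open>F\<close>, and the
  Laplacian reduces to \<open>(g (u x + M) - g (u x)) / F + (N - 1) / norm x > 0\<close>.\<close>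

lemma psi_barrier_lower:
  assumes R1: "0 < R1" "R1 < R" "\<And>x. R1 \<le> norm x \<Longrightarrow> norm x < R \<Longrightarrow> b \<le> u x"
  obtains M where "M > 0" "\<And>x. R1 \<le> norm x \<Longrightarrow> norm x < R \<Longrightarrow> \<psi> (u x + M) + norm x \<le> R"
proof -
  obtain s1 where s1: "b \<le> s1" "\<And>s. s1 \<le> s \<Longrightarrow> \<psi> s < R - R1"
    using psi_small[of "R - R1"] R1 by auto
  \<comment> \<open>The shift lifts \<open>u + M\<close> above \<open>s1\<close> on the inner
    sphere, where the barrier inequality is therefore strict.\<close>
  define M where "M = s1 - b + 1"
  have M: "M > 0" using s1 by (simp add: M_def)
  define f where "f = (\<lambda>x. \<psi> (u x + M) + norm x)"
  have bM: "b < u x + M" if "R1 \<le> norm x" "norm x < R" for x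
    using R1(3)[OF that] M by simp
  have jet: "jet2 f x (- (1 / F (u x + M)) *\<^sub>R P x + x /\<^sub>R norm x)
     (- (1 / F (u x + M)) * g (u x) + g (u x + M) / F (u x + M) ^ 3 * (P x \<bullet> P x) + (real DIM('a) - 1) / norm x)"
    if x: "R1 \<le> norm x" "norm x < R" for x
  proof -
    have "jet2 (\<lambda>x. u x + M) x (P x + 0) (g (u x) + 0)"
      by (intro jet2_add jet2_u jet2_const x)
    then have 1: "jet2 (\<lambda>x. u x + M) x (P x) (g (u x))" by simp
    have 2: "\<forall>\<^sub>F s in nhds (u x + M). (\<psi> has_real_derivative - (1 / F s)) (at s)"
      using eventually_nhds_in_open[of "{b<..}" "u x + M"] bM[OF x]
      by (auto elim!: eventually_mono intro: psi_deriv)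
    have Fp: "F (u x + M) > 0" using F_pos bM[OF x] by simp
    have "((\<lambda>s. - (1 / F s)) has_real_derivative g (u x + M) / F (u x + M) ^ 3) (at (u x + M))"
      using Fp bM[OF x]
      by (auto intro!: derivative_eq_intros F_deriv simp: power3_eq_cube field_simps)
    from jet2_compose[OF 1 2 this] show ?thesis
      unfolding f_def using R1(1) x by (intro jet2_add jet2_norm) auto
  qed
  have "f x0 \<le> R" if x0: "R1 \<le> norm x0" "norm x0 < R" for x0
  proof (rule ccontr)
    assume "\<not> f x0 \<le> R"
    then have big: "f x0 > R" by simp
    obtain s2 where s2: "b \<le> s2" "\<And>s. s2 \<le> s \<Longrightarrow> \<psi> s < f x0 - R"
      using psi_small[of "f x0 - R"] big by auto
    obtain R2 where R2: "R2 < R" "\<And>x. R2 \<le> norm x \<Longrightarrow> norm x < R \<Longrightarrow> s2 < u x"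
      using blowupE[of s2] by blast
    have fc: "continuous_on {x. R1 \<le> norm x \<and> norm x < R} f"
      by (intro continuous_at_imp_continuous_on ballI) (use jet jet2_isCont in blast)
    have out: "f x \<le> f x0" if "R2 \<le> norm x" "R1 \<le> norm x" "norm x < R" for x
      using s2(2)[of "u x + M"] R2(2)[OF that(1,3)] M that by (simp add: f_def)
    have inn: "f x < f x0" if "norm x = R1" for x
    proof -
      have "s1 \<le> u x + M"
        using R1(2) R1(3)[of x] that by (simp add: M_def)
      then have "\<psi> (u x + M) < R - R1" by (rule s1(2))
      then show ?thesis using big that by (simp add: f_def)
    qed
    obtain x where x: "R1 < norm x" "norm x < R" "\<forall>\<^sub>F y in nhds x. f y \<le> f x"
      using annulus_max_attained[OF fc x0 R2(1) out inn] by blast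
    have j: "- (1 / F (u x + M)) *\<^sub>R P x + x /\<^sub>R norm x = 0"
      "- (1 / F (u x + M)) * g (u x) + g (u x + M) / F (u x + M) ^ 3 * (P x \<bullet> P x) + (real DIM('a) - 1) / norm x \<le> 0"
      using jet2_max[OF jet x(3)] x by auto
    define B where "B = F (u x + M)"
    have B: "B > 0" using F_pos[OF less_imp_le[OF bM]] x by (simp add: B_def)
    have nx: "norm x > 0" using R1 x by linarith
    \<comment> \<open>The vanishing gradient makes \<open>P x\<close> radial of length
      \<open>B\<close>, and \<open>P x \<bullet> P x\<close> then cancels two of the three powers of
      \<open>F\<close> in the second-order term.\<close>
    have "P x = B *\<^sub>R (x /\<^sub>R norm x)"
    proof -
      have "(1 / B) *\<^sub>R P x = x /\<^sub>R norm x"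
        using j(1) by (simp add: B_def)
      then have "B *\<^sub>R ((1 / B) *\<^sub>R P x) = B *\<^sub>R (x /\<^sub>R norm x)" by simp
      then show ?thesis using B by simp
    qed
    then have "norm (P x) = B"
      using B nx by simp
    then have PP: "P x \<bullet> P x = B\<^sup>2"
      by (simp add: dot_square_norm)
    have "0 \<le> (real DIM('a) - 1) / norm x"
      using DIM_ge_Suc0[where 'a='a] nx by simp
    then have "- (1 / B) * g (u x) + g (u x + M) / B ^ 3 * B\<^sup>2 \<le> 0"
      using j(2) unfolding PP B_def[symmetric] by linarith
    then have "g (u x + M) \<le> g (u x)"
      using B by (simp add: field_simps power2_eq_square power3_eq_cube)
    moreover have "\<sigma> * M \<le> g (u x + M) - g (u x)"
      using slope[of "u x" "u x + M"] R1(3)[of x] M x by simp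
    moreover have "\<sigma> * M > 0"
      using M sigma_pos by simp
    ultimately show False
      by linarith
  qed
  then show ?thesis
    using that[OF M] by (simp add: f_def)
qed

lemma sphere_bound:
  fixes f :: "'a \<Rightarrow> real"
  assumes "continuous_on (ball 0 R) f" "R1 < R"
  obtains M where "\<And>x. norm x = R1 \<Longrightarrow> f x \<le> M"
proof -
  have "compact (f ` sphere 0 R1)"
    by (intro compact_continuous_image continuous_on_subset[OF assms(1)]) (use assms in auto)
  then have "bounded (f ` sphere 0 R1)"
    by (rule compact_imp_bounded)
  then obtain M where "\<forall>y\<in>f ` sphere 0 R1. norm y \<le> M"
    unfolding bounded_iff by blast
  then show ?thesis
    by (intro that[of M]) force
qed

text \<open>Here the curvature term has the wrong sign. The derivative of
  \<open>F s - \<kappa> * (s - \<beta>)\<close> is \<open>g s / F s - \<kappa>\<close>, and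
  \<open>\<kappa>\<close> exceeds \<open>(N - 1) / norm x\<close> once
  \<open>norm x \<ge> R / 2\<close>. The cut-off at \<open>s1\<close> keeps the argument in the
  domain of \<open>\<psi>'\<close>.\<close>

lemma psi_barrier_upper:
  assumes \<kappa>: "\<kappa> = 2 * real DIM('a) / R"
    and s1: "b \<le> s1" "\<And>s. s1 \<le> s \<Longrightarrow> 2 * \<kappa> * (s - \<beta>) \<le> F s"
    and psi': "\<And>s. s1 \<le> s \<Longrightarrow> (\<psi>' has_real_derivative - (1 / (F s - \<kappa> * (s - \<beta>)))) (at s)"
      "\<And>s. s1 \<le> s \<Longrightarrow> 0 < \<psi>' s"
    and R1: "R / 2 \<le> R1" "R1 < R" "R - R1 \<le> \<psi>' s1"
  obtains M where "M \<ge> 0" "\<And>x. R1 \<le> norm x \<Longrightarrow> norm x < R \<Longrightarrow> R \<le> \<psi>' (max (u x - M) s1) + norm x"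
proof -
  obtain M0 where M0: "\<And>x. norm x = R1 \<Longrightarrow> u x \<le> M0"
    using sphere_bound[OF u_cont R1(2)] by blast
  \<comment> \<open>Makes the cut-off active on the inner sphere, where the left-hand quantity is
    thus \<open>\<psi>' s1 + R1 \<ge> R\<close>.\<close>
  define M where "M = max 0 (M0 - s1)"
  have M: "M \<ge> 0" by (simp add: M_def)
  define B where "B = (\<lambda>s. F s - \<kappa> * (s - \<beta>))"
  have kpos: "\<kappa> > 0" using R_pos by (simp add: \<kappa>)
  have B: "0 < B s" "B s \<le> F s" if "s1 \<le> s" for s
  proof -
    have "s > \<beta>" "F s > 0" using that s1 beta_less F_pos[of s] by auto
    moreover from this have "0 < \<kappa> * (s - \<beta>)" using kpos by simp
    ultimately show "0 < B s" "B s \<le> F s"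
      using s1(2)[OF that] by (auto simp: B_def)
  qed
  define f where "f = (\<lambda>x. \<psi>' (max (u x - M) s1) + norm x)"
  have "R \<le> f x0" if x0: "R1 \<le> norm x0" "norm x0 < R" for x0
  proof (rule ccontr)
    assume "\<not> R \<le> f x0"
    then have small: "f x0 < R" by simp
    have 1: "continuous_on {x. R1 \<le> norm x \<and> norm x < R} (\<lambda>x. max (u x - M) s1)"
      by (intro continuous_intros continuous_on_subset[OF u_cont]) auto
    have 2: "continuous_on {s1..} \<psi>'"
      by (intro continuous_at_imp_continuous_on ballI DERIV_isCont[OF psi'(1)]) auto
    have "continuous_on {x. R1 \<le> norm x \<and> norm x < R} (\<lambda>x. \<psi>' (max (u x - M) s1))"
      by (rule continuous_on_compose2[OF 2 1]) (simp add: image_subset_iff)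
    then have fc: "continuous_on {x. R1 \<le> norm x \<and> norm x < R} (\<lambda>x. - f x)"
      unfolding f_def by (intro continuous_intros)
    have out: "- f x \<le> - f x0" if "f x0 \<le> norm x" "R1 \<le> norm x" "norm x < R" for x
      using psi'(2)[of "max (u x - M) s1"] that by (simp add: f_def)
    have inn: "- f x < - f x0" if "norm x = R1" for x
      using M0[OF that] that R1 small by (auto simp: f_def M_def max_def)
    obtain x where x: "R1 < norm x" "norm x < R" "- f x0 \<le> - f x" "\<forall>\<^sub>F y in nhds x. - f y \<le> - f x"
      using annulus_max_attained[OF fc x0 small out inn] by blast
    \<comment> \<open>Where the cut-off is active, \<open>f x \<ge> \<psi>' s1 + R1 \<ge> R\<close>;
      so it is inactive at a minimum below \<open>R\<close>, and \<open>f\<close> is differentiable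
      there.\<close>
    have ux: "s1 < u x - M"
      using x R1 small by (auto simp: f_def max_def split: if_splits)
    define s where "s = u x - M"
    have bs: "s1 < s" "b < s" using ux s1 by (auto simp: s_def)
    have "isCont (\<lambda>x. u x - M) x"
      by (intro continuous_intros jet2_isCont[OF jet2_u] x)
    then have "((\<lambda>x. u x - M) \<longlongrightarrow> u x - M) (nhds x)"
      using tendsto_at_iff_tendsto_nhds[of "\<lambda>x. u x - M" x] by (simp only: isCont_def)
    then have "\<forall>\<^sub>F y in nhds x. s1 < u y - M"
      by (rule order_tendstoD) (rule ux)
    then have ev: "\<forall>\<^sub>F y in nhds x. f y = \<psi>' (u y - M) + norm y"
      by eventually_elim (simp add: f_def)
    have "jet2 (\<lambda>x. u x - M) x (P x - 0) (g (u x) - 0)"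
      by (intro jet2_diff jet2_u jet2_const x)
    then have 1: "jet2 (\<lambda>x. u x - M) x (P x) (g (u x))" by simp
    have 2: "\<forall>\<^sub>F s in nhds (u x - M). (\<psi>' has_real_derivative - (1 / B s)) (at s)"
      using eventually_nhds_in_open[of "{s1<..}" "u x - M"] ux
      by (auto elim!: eventually_mono intro: psi' simp: B_def)
    have Bp: "B s > 0" "B s \<le> F s" using B[of s] bs by auto
    have "(B has_real_derivative g s / F s - \<kappa>) (at s)"
      unfolding B_def using bs by (auto intro!: derivative_eq_intros F_deriv)
    then have 3: "((\<lambda>s. - (1 / B s)) has_real_derivative (g s / F s - \<kappa>) / (B s)\<^sup>2) (at (u x - M))"
      unfolding s_def[symmetric] using Bp
      by (auto intro!: derivative_eq_intros simp: power2_eq_square diff_divide_distrib)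
    have nx: "norm x > 0" using R1 R_pos x by linarith
    have "jet2 f x (- (1 / B s) *\<^sub>R P x + x /\<^sub>R norm x)
     (- (1 / B s) * g (u x) + (g s / F s - \<kappa>) / (B s)\<^sup>2 * (P x \<bullet> P x) + (real DIM('a) - 1) / norm x)"
      using jet2_cong[OF jet2_add[OF jet2_compose[OF 1 2 3] jet2_norm] ev] nx by (simp add: s_def)
    note j = jet2_min[OF this]
    have j: "- (1 / B s) *\<^sub>R P x + x /\<^sub>R norm x = 0"
     "0 \<le> - (1 / B s) * g (u x) + (g s / F s - \<kappa>) / (B s)\<^sup>2 * (P x \<bullet> P x) + (real DIM('a) - 1) / norm x"
      using j x(4) by auto
    have "P x = B s *\<^sub>R (x /\<^sub>R norm x)"
    proof -
      have "(1 / B s) *\<^sub>R P x = x /\<^sub>R norm x"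
        using j(1) by simp
      then have "B s *\<^sub>R ((1 / B s) *\<^sub>R P x) = B s *\<^sub>R (x /\<^sub>R norm x)" by simp
      then show ?thesis using Bp by simp
    qed
    then have "norm (P x) = B s"
      using Bp nx by simp
    then have PP: "P x \<bullet> P x = (B s)\<^sup>2"
      by (simp add: dot_square_norm)
    have "0 \<le> - (g (u x) / B s) + (g s / F s - \<kappa>) + (real DIM('a) - 1) / norm x"
      using j(2) Bp unfolding PP by simp
    \<comment> \<open>The numerator grows because \<open>s \<le> u x\<close>, and the denominator
      shrinks because \<open>B s \<le> F s\<close>.\<close>
    moreover have "g s / F s \<le> g (u x) / B s"
      using g_mono[of s "u x"] g_pos'[of s] bs M Bp by (intro frac_le) (auto simp: s_def)
    moreover have "(real DIM('a) - 1) / norm x \<le> (real DIM('a) - 1) / (R / 2)"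
      using x R1 R_pos DIM_ge_Suc0[where 'a='a] nx by (intro divide_left_mono) auto
    moreover have "(real DIM('a) - 1) / (R / 2) < \<kappa>"
      using R_pos by (simp add: \<kappa> field_simps)
    ultimately show False by linarith
  qed
  then show ?thesis
    using that[OF M] by (simp add: f_def)
qed


text \<open>The barriers enclose \<open>R - norm x\<close> between \<open>\<psi> S\<close> and
  \<open>\<psi>' T\<close>, where \<open>S\<close> and \<open>T\<close> are shifts of
  \<open>u x\<close> and \<open>u y\<close>. As \<open>1 / F\<close> decreases,
  \<open>(T - S) / F T \<le> \<psi> S - \<psi> T\<close>, and the excess of \<open>\<psi>'\<close>
  over \<open>\<psi>\<close> makes this
  \<open>T - S \<le> 2 * \<kappa> * (T - \<beta>) * \<psi> T\<close>, a small multiple of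
  \<open>T - \<beta>\<close> because \<open>\<psi>\<close> tends to 0.\<close>

lemma u_comparable_on_spheres:
  assumes "\<epsilon> > 0"
  obtains R1 C where "0 < R1" "R1 < R"
    "\<And>x y. norm x = norm y \<Longrightarrow> R1 \<le> norm x \<Longrightarrow> norm x < R \<Longrightarrow> u y \<le> (1 + \<epsilon>) * u x + C"
proof -
  define \<kappa> where "\<kappa> = 2 * real DIM('a) / R"
  have kpos: "\<kappa> > 0" using R_pos by (simp add: \<kappa>_def)
  \<comment> \<open>Solves \<open>(1 + \<epsilon>) * (1 - \<delta>) = 1\<close>, which turns
    \<open>T \<le> S + \<delta> * (T - \<beta>)\<close> into
    \<open>T \<le> (1 + \<epsilon>) * S - \<epsilon> * \<beta>\<close>.\<close>
  define \<delta> where "\<delta> = \<epsilon> / (1 + \<epsilon>)"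
  have del: "\<delta> > 0" using assms by (simp add: \<delta>_def)
  obtain s0 where s0: "b \<le> s0" "\<And>s. s0 \<le> s \<Longrightarrow> \<psi> s < \<delta> / (2 * \<kappa>)"
    using psi_small[of "\<delta> / (2 * \<kappa>)"] del kpos by auto
  obtain s1 \<psi>' where s1: "b \<le> s1" "s0 \<le> s1" "\<And>s. s1 \<le> s \<Longrightarrow> 2 * \<kappa> * (s - \<beta>) \<le> F s"
    and psi': "\<And>s. s1 \<le> s \<Longrightarrow> (\<psi>' has_real_derivative - (1 / (F s - \<kappa> * (s - \<beta>)))) (at s)"
    "\<And>s. s1 \<le> s \<Longrightarrow> 0 < \<psi>' s"
    "\<And>s. s1 \<le> s \<Longrightarrow> \<psi>' s \<le> (1 + 2 * \<kappa> * (s - \<beta>) / F s) * \<psi> s"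
    using perturbed_psi[OF kpos, of s0] by blast
  obtain r where r: "0 < r" "r < R" "\<And>x. r \<le> norm x \<Longrightarrow> norm x < R \<Longrightarrow> max b 0 < u x"
    using blowupE[of "max b 0"] by blast
  define R1 where "R1 = Max {r, R / 2, R - \<psi>' s1}"
  have R1: "r \<le> R1" "R / 2 \<le> R1" "R - \<psi>' s1 \<le> R1" "R1 < R" "0 < R1"
    using r R_pos psi'(2)[of s1] by (auto simp: R1_def max_def)
  have ub: "b \<le> u x" "0 \<le> u x" if "R1 \<le> norm x" "norm x < R" for x
    using r(3)[of x] that R1 by auto
  obtain M2 where M2: "M2 > 0" "\<And>x. R1 \<le> norm x \<Longrightarrow> norm x < R \<Longrightarrow> \<psi> (u x + M2) + norm x \<le> R"
    using psi_barrier_lower[OF R1(5,4) ub(1)] by blast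
  obtain M1 where M1: "M1 \<ge> 0" "\<And>x. R1 \<le> norm x \<Longrightarrow> norm x < R \<Longrightarrow> R \<le> \<psi>' (max (u x - M1) s1) + norm x"
    using psi_barrier_upper[OF \<kappa>_def s1(1) s1(3) psi'(1,2) R1(2,4)] R1(3) by auto
  define C where "C = M1 + (1 + \<epsilon>) * M2 + \<epsilon> * \<bar>\<beta>\<bar>"
  have "u y \<le> (1 + \<epsilon>) * u x + C" if xy: "norm x = norm y" and x: "R1 \<le> norm x" "norm x < R" for x y
  proof -
    define T where "T = max (u y - M1) s1"
    define S where "S = u x + M2"
    have T: "s1 \<le> T" "b \<le> T" "u y \<le> M1 + T" "T > \<beta>"
      using s1 beta_less by (auto simp: T_def)
    have S: "b \<le> S" using ub[OF x] M2 by (simp add: S_def)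
    have FT: "F T > 0" using F_pos T by simp
    have "\<psi> S \<le> \<psi>' T"
      using M2(2)[OF x] M1(2)[of y] x xy by (simp add: S_def T_def)
    also have "\<dots> \<le> (1 + 2 * \<kappa> * (T - \<beta>) / F T) * \<psi> T"
      by (rule psi'(3)[OF T(1)])
    finally have 1: "\<psi> S \<le> \<psi> T + 2 * \<kappa> * (T - \<beta>) * \<psi> T / F T"
      by (simp add: algebra_simps)
    have "T \<le> (1 + \<epsilon>) * S + \<epsilon> * \<bar>\<beta>\<bar>"
    proof (cases "T \<le> S")
      case True
      have "0 \<le> \<epsilon> * S" "0 \<le> \<epsilon> * \<bar>\<beta>\<bar>"
        using assms ub[OF x] M2 by (auto simp: S_def)
      then show ?thesis using True by (simp add: algebra_simps)
    next
      case False
      have "\<psi> T + T / F T \<le> \<psi> S + S / F T"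
      proof (rule DERIV_nonpos_imp_nonincreasing[of S T "\<lambda>t. \<psi> t + t / F T"])
        fix t assume t: "S \<le> t" "t \<le> T"
        have "((\<lambda>t. \<psi> t + t / F T) has_real_derivative - (1 / F t) + 1 / F T) (at t)"
          using FT t S by (auto intro!: derivative_eq_intros psi_deriv)
        moreover have "1 / F T \<le> 1 / F t"
          using F_mono[of t T] F_pos[of t] S t by (intro divide_left_mono) auto
        ultimately show "\<exists>y. ((\<lambda>t. \<psi> t + t / F T) has_real_derivative y) (at t) \<and> y \<le> 0"
          by (intro exI[of _ "- (1 / F t) + 1 / F T"]) simp
      qed (use False in simp)
      then have "T / F T \<le> S / F T + 2 * \<kappa> * (T - \<beta>) * \<psi> T / F T"
        using 1 by linarith
      then have "T \<le> S + 2 * \<kappa> * (T - \<beta>) * \<psi> T"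
        using FT by (simp add: add_divide_distrib[symmetric] divide_le_cancel)
      also have "2 * \<kappa> * (T - \<beta>) * \<psi> T = (2 * \<kappa> * \<psi> T) * (T - \<beta>)"
        by simp
      also have "\<dots> \<le> \<delta> * (T - \<beta>)"
        using s0(2)[of T] T s1 kpos by (intro mult_right_mono) (auto simp: field_simps)
      finally have "(1 + \<epsilon>) * T \<le> (1 + \<epsilon>) * (S + \<delta> * (T - \<beta>))"
        using assms by (intro mult_left_mono) auto
      also have "\<dots> = (1 + \<epsilon>) * S + \<epsilon> * (T - \<beta>)"
        using assms by (simp add: \<delta>_def distrib_left)
      finally have "T \<le> (1 + \<epsilon>) * S - \<epsilon> * \<beta>"
        by (simp add: algebra_simps)
      moreover have "- (\<epsilon> * \<beta>) \<le> \<epsilon> * \<bar>\<beta>\<bar>"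
        using mult_left_mono[of "-\<beta>" "\<bar>\<beta>\<bar>" \<epsilon>] assms by simp
      ultimately show ?thesis by linarith
    qed
    then show ?thesis
      using T(3) by (simp add: C_def S_def algebra_simps)
  qed
  then show ?thesis
    using that R1 by blast
qed

text \<open>By convexity \<open>(1 + \<epsilon>) * u - \<epsilon> * b\<close> is a supersolution up to the constant \<open>\<epsilon> * g b\<close>, and by
  \<open>u_comparable_on_spheres\<close> it dominates the average of \<open>u \<circ> Q1\<close> and \<open>u \<circ> Q2\<close> near the outer sphere.\<close>

lemma oscillation_on_spheres:
  assumes Q: "orthogonal_transformation Q1" "orthogonal_transformation Q2"
    and R1: "0 < R1" "R1 < R" "\<And>x. R1 \<le> norm x \<Longrightarrow> norm x < R \<Longrightarrow> b \<le> u x"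
    and m: "0 \<le> m" "\<And>x. norm x = R1 \<Longrightarrow> u (Q1 x) + u (Q2 x) - 2 * u x \<le> 2 * m"
    and x0: "R1 \<le> norm x0" "norm x0 < R"
  shows "u (Q1 x0) + u (Q2 x0) - 2 * u x0 \<le> 2 * m"
proof -
  have nQ: "norm (Q1 x) = norm x" "norm (Q2 x) = norm x" for x
    using Q by (auto intro: orthogonal_transformation_norm)
  define v where "v = (\<lambda>x. (u (Q1 x) + u (Q2 x)) / 2)"
  \<comment> \<open>\<open>\<sigma> * (\<epsilon> * K)\<close> equals the error
    \<open>\<epsilon> * g b\<close> in the supersolution inequality.\<close>
  define K where "K = g b / \<sigma>"
  have K: "K > 0" using g_pos sigma_pos by (simp add: K_def)
  have main: "v x0 - (1 + \<epsilon>) * u x0 + \<epsilon> * b \<le> m + \<epsilon> * K" if eps: "\<epsilon> > 0" for \<epsilon>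
  proof (rule ccontr)
    define f where "f = (\<lambda>x. v x - (1 + \<epsilon>) * u x + \<epsilon> * b)"
    assume "\<not> v x0 - (1 + \<epsilon>) * u x0 + \<epsilon> * b \<le> m + \<epsilon> * K"
    then have big: "f x0 > m + \<epsilon> * K" by (simp add: f_def)
    have jet: "\<exists>p. jet2 f x p ((g (u (Q1 x)) + g (u (Q2 x))) / 2 - (1 + \<epsilon>) * g (u x))" if x: "norm x < R" for x
    proof -
      obtain q1 q2 where q: "jet2 (\<lambda>x. u (Q1 x)) x q1 (g (u (Q1 x)))" "jet2 (\<lambda>x. u (Q2 x)) x q2 (g (u (Q2 x)))"
        using jet2_orthogonal[OF jet2_u Q(1)] jet2_orthogonal[OF jet2_u Q(2)] x nQ by metis
      have "jet2 (\<lambda>x. (1/2) * (u (Q1 x) + u (Q2 x)) - (1 + \<epsilon>) * u x + \<epsilon> * b) x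
        ((1/2) *\<^sub>R (q1 + q2) - (1 + \<epsilon>) *\<^sub>R P x + 0)
        ((1/2) * (g (u (Q1 x)) + g (u (Q2 x))) - (1 + \<epsilon>) * g (u x) + 0)"
        by (intro jet2_add jet2_diff jet2_cmult jet2_const q jet2_u x)
      then show ?thesis
        unfolding f_def v_def by auto
    qed
    \<comment> \<open>Only half of \<open>\<epsilon>\<close> is spent on comparing \<open>v\<close>
      with \<open>u\<close>; near the outer sphere the other half, times \<open>u x\<close>,
      outweighs all constants by the choice of \<open>R3\<close>.\<close>
    obtain R2 C where R2: "0 < R2" "R2 < R"
      "\<And>x y. norm x = norm y \<Longrightarrow> R2 \<le> norm x \<Longrightarrow> norm x < R \<Longrightarrow> u y \<le> (1 + \<epsilon> / 2) * u x + C"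
      using u_comparable_on_spheres[of "\<epsilon> / 2"] eps by auto
    obtain R3 where R3: "R3 < R" "\<And>x. R3 \<le> norm x \<Longrightarrow> norm x < R \<Longrightarrow> (C + \<epsilon> * b - f x0) / (\<epsilon> / 2) < u x"
      using blowupE[of "(C + \<epsilon> * b - f x0) / (\<epsilon> / 2)"] by blast
    have fc: "continuous_on {x. R1 \<le> norm x \<and> norm x < R} f"
      by (intro continuous_at_imp_continuous_on ballI) (use jet jet2_isCont in blast)
    have out: "f x \<le> f x0" if x: "max R2 R3 \<le> norm x" "R1 \<le> norm x" "norm x < R" for x
    proof -
      have "v x \<le> (1 + \<epsilon> / 2) * u x + C"
        using R2(3)[of x "Q1 x"] R2(3)[of x "Q2 x"] x nQ by (simp add: v_def)
      moreover have "C + \<epsilon> * b - f x0 < \<epsilon> / 2 * u x"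
        using R3(2)[of x] x eps by (simp add: field_simps)
      ultimately show ?thesis
        unfolding f_def by (simp add: algebra_simps)
    qed
    have inn: "f x < f x0" if x: "norm x = R1" for x
    proof -
      have "\<epsilon> * b \<le> \<epsilon> * u x"
        using R1(2) R1(3)[of x] x eps by simp
      moreover have "v x - u x \<le> m"
        using m(2)[OF x] by (simp add: v_def field_simps)
      moreover have "\<epsilon> * K > 0" using eps K by simp
      ultimately have "f x \<le> m" "m < f x0"
        using big unfolding f_def by (simp_all add: algebra_simps)
      then show ?thesis by simp
    qed
    have R23: "max R2 R3 < R" using R2 R3 by simp
    obtain x where x: "R1 < norm x" "norm x < R" "f x0 \<le> f x" "\<forall>\<^sub>F y in nhds x. f y \<le> f x"
      using annulus_max_attained[OF fc x0 R23 out inn] by blast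
    have l: "(g (u (Q1 x)) + g (u (Q2 x))) / 2 \<le> (1 + \<epsilon>) * g (u x)"
      using jet[OF x(2)] jet2_max(2)[OF _ x(4)] by fastforce
    have ub: "b \<le> u x" "b \<le> u (Q1 x)" "b \<le> u (Q2 x)"
      using R1(3)[of x] R1(3)[of "Q1 x"] R1(3)[of "Q2 x"] x nQ by auto
    have gv: "g (v x) \<le> (g (u (Q1 x)) + g (u (Q2 x))) / 2"
    proof -
      have "g ((1 - 1/2) *\<^sub>R u (Q1 x) + (1/2) *\<^sub>R u (Q2 x)) \<le> (1 - 1/2) * g (u (Q1 x)) + (1/2) * g (u (Q2 x))"
        by (rule convex_onD[OF convex]) (use ub in auto)
      then show ?thesis by (simp add: v_def add_divide_distrib)
    qed
    define U where "U = (1 + \<epsilon>) * u x - \<epsilon> * b"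
    have "\<epsilon> * b \<le> \<epsilon> * u x" using eps ub by simp
    then have bU: "b \<le> U" using ub by (simp add: U_def algebra_simps)
    have gU: "(1 + \<epsilon>) * g (u x) \<le> g U + \<epsilon> * g b"
    proof -
      \<comment> \<open>The weight for which \<open>u x\<close> is the convex combination of
        \<open>U\<close> and \<open>b\<close>.\<close>
      define t where "t = \<epsilon> / (1 + \<epsilon>)"
      have t: "0 \<le> t" "t \<le> 1" "(1 + \<epsilon>) * t = \<epsilon>" "(1 + \<epsilon>) * (1 - t) = 1"
        using eps by (auto simp: t_def field_simps)
      have "(1 - t) *\<^sub>R U + t *\<^sub>R b = u x"
      proof -
        have "(1 + \<epsilon>) * ((1 - t) * U + t * b) = (1 + \<epsilon>) * (1 - t) * U + (1 + \<epsilon>) * t * b"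
          by (simp add: algebra_simps)
        also have "\<dots> = (1 + \<epsilon>) * u x"
          unfolding t by (simp add: U_def)
        finally show ?thesis using eps by simp
      qed
      moreover have "g ((1 - t) *\<^sub>R U + t *\<^sub>R b) \<le> (1 - t) * g U + t * g b"
        by (rule convex_onD[OF convex]) (use t bU in auto)
      ultimately have "(1 + \<epsilon>) * g (u x) \<le> (1 + \<epsilon>) * ((1 - t) * g U + t * g b)"
        using eps by (intro mult_left_mono) auto
      also have "\<dots> = (1 + \<epsilon>) * (1 - t) * g U + (1 + \<epsilon>) * t * g b"
        by (simp add: algebra_simps)
      finally show ?thesis unfolding t by simp
    qed
    have fx: "v x - U > \<epsilon> * K" "v x - U > 0"
    proof -
      have "v x - U = f x" by (simp add: f_def U_def)
      moreover have "\<epsilon> * K > 0" using eps K by simp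
      ultimately show "v x - U > \<epsilon> * K" "v x - U > 0" using big x(3) m(1) by linarith+
    qed
    have "\<sigma> * (v x - U) \<le> g (v x) - g U"
      using slope[OF bU, of "v x"] fx by simp
    also have "\<dots> \<le> \<epsilon> * g b" using gv gU l by linarith
    also have "\<dots> = \<sigma> * (\<epsilon> * K)" using sigma_pos by (simp add: K_def)
    finally show False using fx(1) sigma_pos by simp
  qed
  \<comment> \<open>Passage to \<open>\<epsilon> = 0\<close>: \<open>A\<close> dominates the
    coefficient of \<open>\<epsilon>\<close> in \<open>main\<close>.\<close>
  have "v x0 - u x0 \<le> m"
  proof (rule field_le_epsilon)
    fix e :: real assume e: "e > 0"
    define A where "A = \<bar>K + u x0 - b\<bar> + 1"
    have A: "A > 0" by (simp add: A_def)
    have "v x0 - u x0 \<le> m + (e / A) * (K + u x0 - b)"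
      using main[of "e / A"] e A by (simp add: algebra_simps)
    also have "(e / A) * (K + u x0 - b) \<le> (e / A) * A"
      using e A by (intro mult_left_mono) (auto simp: A_def)
    also have "\<dots> = e" using A by simp
    finally show "v x0 - u x0 \<le> m + e" by simp
  qed
  then show ?thesis by (simp add: v_def field_simps)
qed

end

section \<open>Rotations and radial monotonicity\<close>

text \<open>For orthonormal \<open>e\<close> and \<open>f\<close> this is the rotation by
  \<open>t\<close> in their plane, turning \<open>e\<close> towards \<open>f\<close>. Writing it as
  a correction to \<open>x\<close> avoids a basis of the orthogonal complement.\<close>

definition plane_rotation :: "'a::euclidean_space \<Rightarrow> 'a \<Rightarrow> real \<Rightarrow> 'a \<Rightarrow> 'a" where
  "plane_rotation e f t x = x + ((cos t - 1) * (x \<bullet> e) - sin t * (x \<bullet> f)) *\<^sub>R e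
     + (sin t * (x \<bullet> e) + (cos t - 1) * (x \<bullet> f)) *\<^sub>R f"

lemma orthogonal_plane_rotation:
  assumes "e \<bullet> e = 1" "f \<bullet> f = 1" "e \<bullet> f = 0"
  shows "orthogonal_transformation (plane_rotation e f t)"
  unfolding orthogonal_transformation_def
proof (intro conjI allI)
  show "linear (plane_rotation e f t)"
    by (rule linearI) (auto simp: plane_rotation_def algebra_simps)
  fix x y
  have fe: "f \<bullet> e = 0" using assms(3) by (simp add: inner_commute)
  have cs: "cos t * cos t + sin t * sin t = 1"
    using sin_cos_squared_add[of t] by (simp add: power2_eq_square)
  have exp: "(x + p *\<^sub>R e + q *\<^sub>R f) \<bullet> (y + p' *\<^sub>R e + q' *\<^sub>R f)
      = x \<bullet> y + (p' * (x \<bullet> e) + q' * (x \<bullet> f) + p * (y \<bullet> e) + q * (y \<bullet> f) + p * p' + q * q')" for p q p' q'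
    by (simp add: inner_add_left inner_add_right assms fe inner_commute[of e y] inner_commute[of f y] distrib_left)
  have poly: "((c - 1) * a' - s * b') * a + (s * a' + (c - 1) * b') * b + ((c - 1) * a - s * b) * a'
      + (s * a + (c - 1) * b) * b' + ((c - 1) * a - s * b) * ((c - 1) * a' - s * b')
      + (s * a + (c - 1) * b) * (s * a' + (c - 1) * b') = (c * c + s * s - 1) * (a * a' + b * b')"
    for a b a' b' c s :: real
    by (simp add: algebra_simps)
  show "plane_rotation e f t x \<bullet> plane_rotation e f t y = x \<bullet> y"
    unfolding plane_rotation_def exp poly cs by simp
qed

lemma has_vector_derivative_plane_curve:
  assumes "(p has_real_derivative p') (at t)" "(q has_real_derivative q') (at t)"
  shows "((\<lambda>t. x + p t *\<^sub>R e + q t *\<^sub>R f) has_vector_derivative p' *\<^sub>R e + q' *\<^sub>R f) (at t)"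
proof -
  have "((\<lambda>t. p t *\<^sub>R e) has_vector_derivative p' *\<^sub>R e) (at t)" "((\<lambda>t. q t *\<^sub>R f) has_vector_derivative q' *\<^sub>R f) (at t)"
    using has_vector_derivative_scaleR[OF assms(1) has_vector_derivative_const[of e]]
      has_vector_derivative_scaleR[OF assms(2) has_vector_derivative_const[of f]] by simp_all
  from has_vector_derivative_add[OF has_vector_derivative_add[OF has_vector_derivative_const[of x] this(1)] this(2)]
  show ?thesis by simp
qed

lemma plane_rotation_deriv:
  "((\<lambda>t. plane_rotation e f t x) has_vector_derivative
    (- sin t * (x \<bullet> e) - cos t * (x \<bullet> f)) *\<^sub>R e + (cos t * (x \<bullet> e) - sin t * (x \<bullet> f)) *\<^sub>R f) (at t)"
proof -
  have "((\<lambda>t. (cos t - 1) * (x \<bullet> e) - sin t * (x \<bullet> f)) has_real_derivative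
      - sin t * (x \<bullet> e) - cos t * (x \<bullet> f)) (at t)"
    "((\<lambda>t. sin t * (x \<bullet> e) + (cos t - 1) * (x \<bullet> f)) has_real_derivative
      cos t * (x \<bullet> e) - sin t * (x \<bullet> f)) (at t)"
    by (auto intro!: derivative_eq_intros)
  from has_vector_derivative_plane_curve[OF this] show ?thesis
    unfolding plane_rotation_def by simp
qed

lemma plane_rotation_deriv2:
  "((\<lambda>t. (- sin t * (x \<bullet> e) - cos t * (x \<bullet> f)) *\<^sub>R e + (cos t * (x \<bullet> e) - sin t * (x \<bullet> f)) *\<^sub>R f) has_vector_derivative
    (- cos t * (x \<bullet> e) + sin t * (x \<bullet> f)) *\<^sub>R e + (- sin t * (x \<bullet> e) - cos t * (x \<bullet> f)) *\<^sub>R f) (at t)"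
proof -
  have "((\<lambda>t. - sin t * (x \<bullet> e) - cos t * (x \<bullet> f)) has_real_derivative
      - cos t * (x \<bullet> e) + sin t * (x \<bullet> f)) (at t)"
    "((\<lambda>t. cos t * (x \<bullet> e) - sin t * (x \<bullet> f)) has_real_derivative
      - sin t * (x \<bullet> e) - cos t * (x \<bullet> f)) (at t)"
    by (auto intro!: derivative_eq_intros)
  from has_vector_derivative_plane_curve[OF this, of 0 e f] show ?thesis by simp
qed

lemma norm_orthonormal_pair:
  assumes "e \<bullet> e = 1" "f \<bullet> f = 1" "e \<bullet> f = 0"
  shows "norm (p *\<^sub>R e + q *\<^sub>R f) = sqrt (p\<^sup>2 + q\<^sup>2)"
  using assms by (simp add: norm_eq_sqrt_inner inner_add_left inner_add_right inner_commute[of f e] power2_eq_square)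

lemma bessel_pair:
  fixes x :: "'a::euclidean_space"
  assumes "e \<bullet> e = 1" "f \<bullet> f = 1" "e \<bullet> f = 0"
  shows "(x \<bullet> e)\<^sup>2 + (x \<bullet> f)\<^sup>2 \<le> (norm x)\<^sup>2"
proof -
  have fe: "f \<bullet> e = 0" using assms(3) by (simp add: inner_commute)
  let ?z = "x - (x \<bullet> e) *\<^sub>R e - (x \<bullet> f) *\<^sub>R f"
  have "0 \<le> ?z \<bullet> ?z" by simp
  also have "?z \<bullet> ?z = x \<bullet> x - (x \<bullet> e)\<^sup>2 - (x \<bullet> f)\<^sup>2"
    by (simp add: inner_diff_left inner_diff_right assms fe inner_commute[of e x] inner_commute[of f x] power2_eq_square)
  finally show ?thesis by (simp add: power2_norm_eq_inner)
qed

text \<open>Velocity and acceleration of the orbit are the projection of \<open>x\<close> to the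
  plane, turned by some angle; Bessel's inequality bounds its length.\<close>

lemma norm_plane_rotation_deriv_le:
  fixes x :: "'a::euclidean_space"
  assumes "e \<bullet> e = 1" "f \<bullet> f = 1" "e \<bullet> f = 0"
  shows "norm ((- sin t * (x \<bullet> e) - cos t * (x \<bullet> f)) *\<^sub>R e + (cos t * (x \<bullet> e) - sin t * (x \<bullet> f)) *\<^sub>R f) \<le> norm x"
    and "norm ((- cos t * (x \<bullet> e) + sin t * (x \<bullet> f)) *\<^sub>R e + (- sin t * (x \<bullet> e) - cos t * (x \<bullet> f)) *\<^sub>R f) \<le> norm x"
proof -
  have cs: "cos t * cos t + sin t * sin t = 1"
    using sin_cos_squared_add[of t] by (simp add: power2_eq_square)
  have poly: "(- s * p - c * q)\<^sup>2 + (c * p - s * q)\<^sup>2 = (c * c + s * s) * (p\<^sup>2 + q\<^sup>2)"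
    "(- c * p + s * q)\<^sup>2 + (- s * p - c * q)\<^sup>2 = (c * c + s * s) * (p\<^sup>2 + q\<^sup>2)" for p q c s :: real
    by (simp_all add: power2_eq_square algebra_simps)
  have "sqrt ((x \<bullet> e)\<^sup>2 + (x \<bullet> f)\<^sup>2) \<le> norm x"
    using bessel_pair[OF assms, of x] by (intro real_le_lsqrt) auto
  then show "norm ((- sin t * (x \<bullet> e) - cos t * (x \<bullet> f)) *\<^sub>R e + (cos t * (x \<bullet> e) - sin t * (x \<bullet> f)) *\<^sub>R f) \<le> norm x"
    "norm ((- cos t * (x \<bullet> e) + sin t * (x \<bullet> f)) *\<^sub>R e + (- sin t * (x \<bullet> e) - cos t * (x \<bullet> f)) *\<^sub>R f) \<le> norm x"
    unfolding norm_orthonormal_pair[OF assms] poly cs by auto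
qed

text \<open>Works as a pair with \<open>second_derivative_le\<close>: a derivative bound on the
  inner sphere becomes one for second differences, which the maximum principle carries outwards,
  where it is turned back into a derivative bound.\<close>

lemma second_difference_le:
  fixes k :: "real \<Rightarrow> real"
  assumes k1: "\<And>t. (k has_real_derivative k1 t) (at t)"
    and k2: "\<And>t. (k1 has_real_derivative k2 t) (at t)" "\<And>t. k2 t \<le> C" and "t \<ge> 0"
  shows "k t + k (- t) - 2 * k 0 \<le> C * t\<^sup>2"
proof -
  define f where "f = (\<lambda>t. k t + k (- t) - C * t\<^sup>2)"
  define f1 where "f1 = (\<lambda>t. k1 t - k1 (- t) - 2 * C * t)"
  have m: "((\<lambda>t. k (- t)) has_real_derivative - k1 (- t)) (at t)"
    "((\<lambda>t. k1 (- t)) has_real_derivative - k2 (- t)) (at t)" for t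
    using k1[of "- t"] k2(1)[of "- t"] by (simp_all add: DERIV_mirror)
  have d1: "(f has_real_derivative f1 t) (at t)" for t
    unfolding f_def f1_def by (auto intro!: derivative_eq_intros k1 m)
  have d2: "(f1 has_real_derivative k2 t + k2 (- t) - 2 * C) (at t)" for t
    unfolding f1_def by (auto intro!: derivative_eq_intros k2(1) m)
  have "f1 t \<le> f1 0" if "t \<ge> 0" for t
  proof (rule DERIV_nonpos_imp_nonincreasing[OF that])
    fix x show "\<exists>y. (f1 has_real_derivative y) (at x) \<and> y \<le> 0"
      using d2[of x] k2(2)[of x] k2(2)[of "-x"] by (intro exI[of _ "k2 x + k2 (- x) - 2 * C"]) auto
  qed
  then have n: "f1 t \<le> 0" if "t \<ge> 0" for t using that by (force simp: f1_def)
  have "f t \<le> f 0"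
    by (rule DERIV_nonpos_imp_nonincreasing[OF \<open>t \<ge> 0\<close>]) (use d1 n in blast)
  then show ?thesis by (simp add: f_def)
qed

lemma second_derivative_le:
  fixes k :: "real \<Rightarrow> real"
  assumes k1: "\<And>t. (k has_real_derivative k1 t) (at t)"
    and k2: "(k1 has_real_derivative d) (at 0)"
    and le: "\<And>t. t > 0 \<Longrightarrow> k t + k (- t) - 2 * k 0 \<le> C * t\<^sup>2"
  shows "d \<le> C"
proof (rule ccontr)
  assume "\<not> d \<le> C"
  then have pos: "2 * d - 2 * C > 0" by simp
  define f where "f = (\<lambda>t. k t + k (- t) - C * t\<^sup>2)"
  define f1 where "f1 = (\<lambda>t. k1 t - k1 (- t) - 2 * C * t)"
  have m: "((\<lambda>t. k (- t)) has_real_derivative - k1 (- t)) (at t)" for t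
    using k1[of "- t"] by (simp add: DERIV_mirror)
  have m2: "((\<lambda>t. k1 (- t)) has_real_derivative - d) (at 0)"
    using k2 DERIV_mirror[of k1 d 0] by simp
  have d1: "(f has_real_derivative f1 t) (at t)" for t
    unfolding f_def f1_def by (auto intro!: derivative_eq_intros k1 m)
  have "(f1 has_real_derivative 2 * d - 2 * C) (at 0)"
    unfolding f1_def by (auto intro!: derivative_eq_intros k2 m2)
  from DERIV_pos_inc_right[OF this pos]
  obtain r where r: "r > 0" "\<And>h. h > 0 \<Longrightarrow> h < r \<Longrightarrow> 0 < f1 h"
    by (auto simp: f1_def)
  have "f 0 < f (r / 2)"
  proof (rule DERIV_pos_imp_increasing_open[of 0 "r / 2" f])
    show "\<exists>y. (f has_real_derivative y) (at t) \<and> 0 < y" if "0 < t" "t < r / 2" for t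
      using d1[of t] r(2)[of t] that by force
    show "continuous_on {0..r / 2} f"
      by (intro continuous_at_imp_continuous_on ballI DERIV_isCont[OF d1])
  qed (use r in simp)
  then show False
    using le[of "r / 2"] r(1) by (simp add: f_def)
qed

lemma orthogonal_transformation_reflection:
  assumes "n \<bullet> n = 1"
  shows "orthogonal_transformation (\<lambda>x::'a::euclidean_space. x - (2 * (x \<bullet> n)) *\<^sub>R n)"
  unfolding orthogonal_transformation_def
proof (intro conjI allI)
  show "linear (\<lambda>x::'a. x - (2 * (x \<bullet> n)) *\<^sub>R n)"
    by (rule linearI) (auto simp: algebra_simps)
  show "(v - (2 * (v \<bullet> n)) *\<^sub>R n) \<bullet> (w - (2 * (w \<bullet> n)) *\<^sub>R n) = v \<bullet> w" for v w
    using assms by (simp add: inner_diff_left inner_diff_right inner_commute[of n w])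
qed

text \<open>The reflection in the perpendicular bisector of \<open>a\<close> and \<open>e\<close>;
  it serves to move a standard basis vector into the radial direction.\<close>

lemma orthogonal_transformation_between_units:
  fixes a e :: "'a::euclidean_space"
  assumes "norm a = 1" "norm e = 1"
  obtains Q where "orthogonal_transformation Q" "Q a = e"
proof (cases "a = e")
  case True
  then show ?thesis using that[of "\<lambda>x. x"] by simp
next
  case False
  define n where "n = (a - e) /\<^sub>R norm (a - e)"
  have n0: "norm (a - e) > 0" using False by simp
  have nn: "n \<bullet> n = 1"
    using n0 by (simp add: n_def dot_square_norm power2_eq_square)
  have aa: "a \<bullet> a = 1" "e \<bullet> e = 1" using assms by (simp_all add: dot_square_norm)
  have "2 * (a \<bullet> (a - e)) = (norm (a - e))\<^sup>2"
    unfolding power2_norm_eq_inner by (simp add: inner_diff_left inner_diff_right aa inner_commute[of e a])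
  then have "2 * (a \<bullet> n) = (norm (a - e))\<^sup>2 / norm (a - e)"
    by (simp add: n_def divide_inverse_commute)
  then have "2 * (a \<bullet> n) = norm (a - e)"
    using n0 by (simp add: power2_eq_square)
  then have "a - (2 * (a \<bullet> n)) *\<^sub>R n = e"
    using n0 by (simp add: n_def)
  then show ?thesis
    using that[OF orthogonal_transformation_reflection[OF nn]] by simp
qed

section \<open>Tangential and radial derivatives of the solution\<close>

context large_sol
begin

lemma u_curve_deriv:
  assumes "(c has_vector_derivative d) (at t)" "norm (c t) < R"
  shows "((\<lambda>t. u (c t)) has_real_derivative P (c t) \<bullet> d) (at t)"
  using has_derivative_compose[OF assms(1)[unfolded has_vector_derivative_def] u_deriv[OF assms(2)]]
  unfolding has_field_derivative_def by (rule has_derivative_eq_rhs) (auto simp: mult.commute)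

lemma P_curve_deriv:
  assumes "(c has_vector_derivative d) (at t)" "(w has_vector_derivative d') (at t)" "norm (c t) < R"
  shows "((\<lambda>t. P (c t) \<bullet> w t) has_real_derivative H (c t) d \<bullet> w t + P (c t) \<bullet> d') (at t)"
proof -
  have lin: "linear (H (c t))"
    using P_deriv[OF assms(3)] has_derivative_linear by blast
  have "((\<lambda>t. P (c t)) has_derivative (\<lambda>h. H (c t) (h *\<^sub>R d))) (at t)"
    using has_derivative_compose[OF assms(1)[unfolded has_vector_derivative_def] P_deriv[OF assms(3)]] .
  from has_derivative_inner[OF this assms(2)[unfolded has_vector_derivative_def]]
  show ?thesis
    unfolding has_field_derivative_def
    by (rule has_derivative_eq_rhs) (auto simp: linear_cmul[OF lin] algebra_simps)
qed

lemma H_bound: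
  assumes "R1 < R"
  obtains A where "A \<ge> 0" "\<And>y. norm y = R1 \<Longrightarrow> norm (P y) \<le> A"
    "\<And>y v. norm y = R1 \<Longrightarrow> \<bar>H y v \<bullet> v\<bar> \<le> A * (norm v)\<^sup>2"
proof -
  have "continuous_on (ball 0 R) P"
    by (intro continuous_at_imp_continuous_on ballI has_derivative_continuous[OF P_deriv]) simp
  then have "continuous_on (ball 0 R) (\<lambda>y. norm (P y) + (\<Sum>b\<in>Basis. norm (H y b)))"
    by (intro continuous_intros H_cont)
  from sphere_bound[OF this assms] obtain A where
    A: "\<And>y. norm y = R1 \<Longrightarrow> norm (P y) + (\<Sum>b\<in>Basis. norm (H y b)) \<le> A"
    by blast
  show ?thesis
  proof (rule that[of "max 0 A"])
    fix y :: 'a assume y: "norm y = R1"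
    have sp: "0 \<le> (\<Sum>b\<in>Basis. norm (H y b))" by (simp add: sum_nonneg)
    show "norm (P y) \<le> max 0 A" using A[OF y] sp by linarith
    fix v :: 'a
    have lin: "linear (H y)"
      using P_deriv[of y] y assms has_derivative_linear by blast
    have "H y v = H y (\<Sum>b\<in>Basis. (v \<bullet> b) *\<^sub>R b)"
      by (simp add: euclidean_representation)
    also have "\<dots> = (\<Sum>b\<in>Basis. (v \<bullet> b) *\<^sub>R H y b)"
      by (simp add: linear_sum[OF lin] linear_cmul[OF lin])
    finally have "norm (H y v) \<le> (\<Sum>b\<in>Basis. norm ((v \<bullet> b) *\<^sub>R H y b))"
      using norm_sum by metis
    also have "\<dots> \<le> (\<Sum>b\<in>Basis. norm v * norm (H y b))"
      by (intro sum_mono) (simp add: Basis_le_norm mult_right_mono)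
    also have "\<dots> \<le> norm v * max 0 A"
      unfolding sum_distrib_left[symmetric]
    proof (rule mult_left_mono)
      show "(\<Sum>b\<in>Basis. norm (H y b)) \<le> max 0 A"
        using A[OF y] norm_ge_zero[of "P y"] by linarith
    qed simp
    finally have "norm (H y v) \<le> norm v * max 0 A" .
    then have "norm (H y v) * norm v \<le> norm v * max 0 A * norm v"
      by (rule mult_right_mono) simp
    with Cauchy_Schwarz_ineq2[of "H y v" v] show "\<bar>H y v \<bullet> v\<bar> \<le> max 0 A * (norm v)\<^sup>2"
      by (simp add: power2_eq_square algebra_simps)
  qed simp
qed

text \<open>The orbit of \<open>x\<close> under rotation towards \<open>f\<close> has velocity
  \<open>norm x *\<^sub>R f\<close> and acceleration \<open>- x\<close> at time 0; hence the term
  \<open>P x \<bullet> x\<close>. On the inner sphere compactness bounds the derivatives along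
  orbits, and \<open>oscillation_on_spheres\<close> transports the finite differences to larger
  radii. Replacing \<open>f\<close> by \<open>- f\<close> makes the first bound two-sided.\<close>

lemma rotational_derivative_bounds:
  assumes R1: "0 < R1" "R1 < R" "\<And>x. R1 \<le> norm x \<Longrightarrow> norm x < R \<Longrightarrow> b \<le> u x"
  obtains C where "C \<ge> 0"
    "\<And>x f :: 'a. \<lbrakk>R1 \<le> norm x; norm x < R; norm f = 1; x \<bullet> f = 0\<rbrakk> \<Longrightarrow> norm x * (P x \<bullet> f) \<le> C"
    "\<And>x f. \<lbrakk>R1 \<le> norm x; norm x < R; norm f = 1; x \<bullet> f = 0\<rbrakk> \<Longrightarrow>
       (norm x)\<^sup>2 * (H x f \<bullet> f) - P x \<bullet> x \<le> C"
proof -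
  obtain A where A: "A \<ge> 0" "\<And>y. norm y = R1 \<Longrightarrow> norm (P y) \<le> A"
    "\<And>y v. norm y = R1 \<Longrightarrow> \<bar>H y v \<bullet> v\<bar> \<le> A * (norm v)\<^sup>2"
    using H_bound[OF R1(2)] by blast
  define C where "C = A * R1\<^sup>2 + A * R1"
  have C: "0 \<le> C" "A * R1 \<le> C" using A R1 by (auto simp: C_def)
  show ?thesis
  proof (rule that[OF C(1)])
    fix x f :: 'a
    assume x: "R1 \<le> norm x" "norm x < R" and f: "norm f = 1" "x \<bullet> f = 0"
    define r where "r = norm x"
    have r: "r > 0" using x R1(1) unfolding r_def by linarith
    define e where "e = x /\<^sub>R r"
    have xe: "x = r *\<^sub>R e" "norm e = 1" using r by (auto simp: e_def r_def)
    have ef: "e \<bullet> e = 1" "f \<bullet> f = 1" "e \<bullet> f = 0"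
      using xe(2) f by (auto simp: dot_square_norm e_def)
    define Q where "Q = plane_rotation e f"
    have Q: "orthogonal_transformation (Q t)" for t
      unfolding Q_def by (rule orthogonal_plane_rotation[OF ef])
    have nQ: "norm (Q t y) = norm y" for t y
      by (rule orthogonal_transformation_norm[OF Q])
    define d1 where "d1 = (\<lambda>(y::'a) t. (- sin t * (y \<bullet> e) - cos t * (y \<bullet> f)) *\<^sub>R e + (cos t * (y \<bullet> e) - sin t * (y \<bullet> f)) *\<^sub>R f)"
    define d2 where "d2 = (\<lambda>(y::'a) t. (- cos t * (y \<bullet> e) + sin t * (y \<bullet> f)) *\<^sub>R e + (- sin t * (y \<bullet> e) - cos t * (y \<bullet> f)) *\<^sub>R f)"
    have Q1: "((\<lambda>t. Q t y) has_vector_derivative d1 y t) (at t)" for y t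
      unfolding Q_def d1_def by (rule plane_rotation_deriv)
    have Q2: "(d1 y has_vector_derivative d2 y t) (at t)" for y t
      unfolding d1_def d2_def by (rule plane_rotation_deriv2)
    have nd: "norm (d1 y t) \<le> norm y" "norm (d2 y t) \<le> norm y" for y t
      unfolding d1_def d2_def by (rule norm_plane_rotation_deriv_le[OF ef])+
    define k where "k = (\<lambda>y t. u (Q t y))"
    have k1: "(k y has_real_derivative P (Q t y) \<bullet> d1 y t) (at t)" if "norm y < R" for y t
      unfolding k_def by (rule u_curve_deriv[OF Q1]) (simp add: nQ that)
    have k2: "((\<lambda>t. P (Q t y) \<bullet> d1 y t) has_real_derivative H (Q t y) (d1 y t) \<bullet> d1 y t + P (Q t y) \<bullet> d2 y t) (at t)"
      if "norm y < R" for y t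
      by (rule P_curve_deriv[OF Q1 Q2]) (simp add: nQ that)
    have Q0: "Q 0 y = y" for y by (simp add: Q_def plane_rotation_def)
    have k0: "k y 0 = u y" for y by (simp add: k_def Q0)
    have b1: "\<bar>P (Q t y) \<bullet> d1 y t\<bar> \<le> A * R1" if y: "norm y = R1" for y t
    proof -
      have "\<bar>P (Q t y) \<bullet> d1 y t\<bar> \<le> norm (P (Q t y)) * norm (d1 y t)"
        by (rule Cauchy_Schwarz_ineq2)
      also have "\<dots> \<le> A * R1"
        using A(2)[of "Q t y"] nd(1)[of y t] nQ y A(1) by (intro mult_mono) auto
      finally show ?thesis .
    qed
    have b2: "H (Q t y) (d1 y t) \<bullet> d1 y t + P (Q t y) \<bullet> d2 y t \<le> C" if y: "norm y = R1" for y t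
    proof -
      have "\<bar>P (Q t y) \<bullet> d2 y t\<bar> \<le> norm (P (Q t y)) * norm (d2 y t)"
        by (rule Cauchy_Schwarz_ineq2)
      also have "\<dots> \<le> A * R1"
        using A(2)[of "Q t y"] nd(2)[of y t] nQ y A(1) by (intro mult_mono) auto
      finally have 1: "P (Q t y) \<bullet> d2 y t \<le> A * R1" by linarith
      have "H (Q t y) (d1 y t) \<bullet> d1 y t \<le> A * (norm (d1 y t))\<^sup>2"
        using A(3)[of "Q t y" "d1 y t"] nQ y by auto
      also have "\<dots> \<le> A * R1\<^sup>2"
        using nd(1)[of y t] y A(1) by (intro mult_left_mono power_mono) auto
      finally show ?thesis using 1 by (simp add: C_def)
    qed
    \<comment> \<open>Taking both orthogonal maps equal to \<open>Q t\<close> turns the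
      second-difference principle into one for first differences.\<close>
    have first: "k x t - u x \<le> C * t" if t: "t \<ge> 0" for t
    proof -
      have "k y t - A * R1 * t \<le> k y 0 - A * R1 * 0" if y: "norm y = R1" for y
      proof (rule DERIV_nonpos_imp_nonincreasing[OF t])
        fix s
        have "((\<lambda>t. k y t - A * R1 * t) has_real_derivative P (Q s y) \<bullet> d1 y s - A * R1) (at s)"
          using y R1 by (auto intro!: derivative_eq_intros k1)
        then show "\<exists>z. ((\<lambda>t. k y t - A * R1 * t) has_real_derivative z) (at s) \<and> z \<le> 0"
          using b1[OF y, of s] by (intro exI conjI) auto
      qed
      then have "u (Q t y) + u (Q t y) - 2 * u y \<le> 2 * (A * R1 * t)" if "norm y = R1" for y
        using that k0 by (force simp: k_def)
      from oscillation_on_spheres[OF Q Q R1 _ this x]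
      have "u (Q t x) + u (Q t x) - 2 * u x \<le> 2 * (A * R1 * t)"
        using A R1 t by simp
      moreover have "A * R1 * t \<le> C * t" using C(2) t by (rule mult_right_mono)
      ultimately show ?thesis by (simp add: k_def)
    qed
    \<comment> \<open>Now the two maps are the opposite rotations \<open>Q t\<close> and
      \<open>Q (- t)\<close>.\<close>
    have second: "k x t + k x (- t) - 2 * k x 0 \<le> C * t\<^sup>2" if t: "t > 0" for t
    proof -
      have "u (Q t y) + u (Q (- t) y) - 2 * u y \<le> 2 * (C * t\<^sup>2 / 2)" if y: "norm y = R1" for y
        using second_difference_le[OF k1 k2 b2[OF y], of t] y R1(2) t k0 by (simp add: k_def)
      from oscillation_on_spheres[OF Q Q R1 _ this x]
      show ?thesis using C by (simp add: k_def Q0)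
    qed
    have d0: "d1 x 0 = r *\<^sub>R f" "d2 x 0 = - x"
      using f ef by (simp_all add: d1_def d2_def xe(1))
    have "(k x has_real_derivative P x \<bullet> (r *\<^sub>R f)) (at 0)"
      using k1[OF x(2), of 0] by (simp add: Q0 d0)
    then have dk: "((\<lambda>t. k x t - C * t) has_real_derivative P x \<bullet> (r *\<^sub>R f) - C) (at 0)"
      by (auto intro!: derivative_eq_intros)
    show "norm x * (P x \<bullet> f) \<le> C"
    proof (rule ccontr)
      assume "\<not> norm x * (P x \<bullet> f) \<le> C"
      then have "P x \<bullet> (r *\<^sub>R f) - C > 0" by (simp add: r_def)
      from DERIV_pos_inc_right[OF dk this] obtain h where
        "h > 0" "k x 0 - C * 0 < k x h - C * h"
        by (metis add_0 dense)
      then show False using first[of h] k0 by simp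
    qed
    have "H (Q 0 x) (d1 x 0) \<bullet> d1 x 0 + P (Q 0 x) \<bullet> d2 x 0 \<le> C"
      by (rule second_derivative_le[OF k1[OF x(2)] k2[OF x(2)] second])
    moreover have "linear (H x)"
      using P_deriv[OF x(2)] has_derivative_linear by blast
    ultimately show "(norm x)\<^sup>2 * (H x f \<bullet> f) - P x \<bullet> x \<le> C"
      by (simp add: Q0 d0 linear_cmul r_def power2_eq_square mult.assoc)
  qed
qed


text \<open>In an orthonormal frame containing \<open>e\<close>, the upper bound for each tangential
  second derivative gives \<open>g (u x) \<le> H x e \<bullet> e + n * (P x \<bullet> e) / r + n * C
  / r\<^sup>2\<close>. Near the boundary \<open>g (u x)\<close> exceeds the last term, so the first
  two have nonnegative sum; times \<open>r ^ n\<close> this is the derivative of the flux.\<close>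

lemma radial_flux_mono:
  obtains C R3 where "C \<ge> 0" "0 < R3" "R3 < R"
    "\<And>x f :: 'a. \<lbrakk>R3 \<le> norm x; norm x < R; norm f = 1; x \<bullet> f = 0\<rbrakk> \<Longrightarrow> norm x * (P x \<bullet> f) \<le> C"
    "\<And>(e :: 'a) s t. \<lbrakk>norm e = 1; R3 \<le> s; s \<le> t; t < R\<rbrakk> \<Longrightarrow>
       s ^ (DIM('a) - 1) * (P (s *\<^sub>R e) \<bullet> e) \<le> t ^ (DIM('a) - 1) * (P (t *\<^sub>R e) \<bullet> e)"
proof -
  define n where "n = DIM('a) - 1"
  obtain R1 where R1: "0 < R1" "R1 < R" "\<And>x. R1 \<le> norm x \<Longrightarrow> norm x < R \<Longrightarrow> b < u x"
    using blowupE[of b] by blast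
  obtain C where C: "C \<ge> 0"
    "\<And>x f :: 'a. \<lbrakk>R1 \<le> norm x; norm x < R; norm f = 1; x \<bullet> f = 0\<rbrakk> \<Longrightarrow> norm x * (P x \<bullet> f) \<le> C"
    "\<And>x f :: 'a. \<lbrakk>R1 \<le> norm x; norm x < R; norm f = 1; x \<bullet> f = 0\<rbrakk> \<Longrightarrow>
       (norm x)\<^sup>2 * (H x f \<bullet> f) - P x \<bullet> x \<le> C"
    using rotational_derivative_bounds[OF R1(1,2) less_imp_le[OF R1(3)]] by blast
  \<comment> \<open>Beyond \<open>R2\<close>, \<open>slope\<close> makes
    \<open>g (u x) - g b\<close> at least \<open>n * C / R1\<^sup>2\<close>, which dominates the
    tangential error.\<close>
  obtain R2 where R2: "0 < R2" "R2 < R" "\<And>x. R2 \<le> norm x \<Longrightarrow> norm x < R \<Longrightarrow> b + real n * C / R1\<^sup>2 / \<sigma> < u x"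
    using blowupE by blast
  define R3 where "R3 = max R1 R2"
  have R3: "0 < R3" "R3 < R" "R1 \<le> R3" "R2 \<le> R3" using R1 R2 by (auto simp: R3_def)
  have mono: "s ^ n * (P (s *\<^sub>R e) \<bullet> e) \<le> t ^ n * (P (t *\<^sub>R e) \<bullet> e)"
    if e: "norm e = 1" and st: "R3 \<le> s" "s \<le> t" "t < R" for e :: 'a and s t
  proof (rule DERIV_nonneg_imp_nondecreasing[OF st(2), of "\<lambda>t. t ^ n * (P (t *\<^sub>R e) \<bullet> e)"])
    fix r assume "s \<le> r" "r \<le> t"
    then have r: "R3 \<le> r" "r < R" "0 < r" using st R3 by auto
    define x where "x = r *\<^sub>R e"
    have nx: "norm x = r" using e r by (simp add: x_def)
    have xR: "R1 \<le> norm x" "norm x < R" "R2 \<le> norm x" using nx r R3 by auto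
    have lin: "linear (H x)"
      using P_deriv[OF xR(2)] has_derivative_linear by blast
    obtain b0 :: 'a where b0: "b0 \<in> Basis" using nonempty_Basis by blast
    obtain Q where Q: "orthogonal_transformation Q" "Q b0 = e"
      using orthogonal_transformation_between_units[of b0 e] b0 e by auto
    have Qi: "Q v \<bullet> Q w = v \<bullet> w" for v w using Q(1) by (simp add: orthogonal_transformation_def)
    have "g (u x) = (\<Sum>v\<in>Basis. H x (Q v) \<bullet> Q v)"
      using lapl[OF xR(2)] trace_orthogonal[OF lin Q(1)] by simp
    also have "\<dots> = H x e \<bullet> e + (\<Sum>v\<in>Basis - {b0}. H x (Q v) \<bullet> Q v)"
      by (subst sum.remove[OF finite_Basis b0]) (simp add: Q(2))
    also have "\<dots> \<le> H x e \<bullet> e + (\<Sum>v\<in>Basis - {b0 :: 'a}. (C + r * (P x \<bullet> e)) / r\<^sup>2)"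
    proof (intro add_left_mono sum_mono)
      fix v :: 'a assume v: "v \<in> Basis - {b0}"
      have "x \<bullet> Q v = r * (Q b0 \<bullet> Q v)" by (simp add: x_def Q(2))
      also have "\<dots> = 0" using v b0 by (auto simp: Qi inner_Basis)
      finally have "x \<bullet> Q v = 0" .
      moreover have "norm (Q v) = 1" using v Q(1) by (simp add: orthogonal_transformation_norm)
      ultimately have "r\<^sup>2 * (H x (Q v) \<bullet> Q v) - P x \<bullet> x \<le> C"
        using C(3)[OF xR(1,2)] nx by blast
      then show "H x (Q v) \<bullet> Q v \<le> (C + r * (P x \<bullet> e)) / r\<^sup>2"
        using r by (simp add: field_simps) (simp add: x_def)
    qed
    also have "\<dots> = H x e \<bullet> e + real n * ((C + r * (P x \<bullet> e)) / r\<^sup>2)"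
      using b0 by (simp add: n_def)
    finally have g1: "g (u x) \<le> H x e \<bullet> e + real n * ((C + r * (P x \<bullet> e)) / r\<^sup>2)" .
    have "real n * C / r\<^sup>2 \<le> real n * C / R1\<^sup>2"
      using R1 r R3 C(1) by (intro divide_left_mono power_mono) auto
    also have "\<dots> \<le> \<sigma> * (u x - b)"
    proof -
      have "real n * C / R1\<^sup>2 / \<sigma> < u x - b"
        using R2(3)[OF xR(3,2)] by linarith
      then show ?thesis
        using sigma_pos by (simp only: pos_divide_less_eq mult.commute less_imp_le)
    qed
    also have "\<dots> \<le> g (u x) - g b"
      using R1(3)[OF xR(1,2)] by (intro slope) auto
    finally have g2: "real n * C / r\<^sup>2 \<le> g (u x)" using g_pos by simp
    have "real n * ((C + r * (P x \<bullet> e)) / r\<^sup>2) = real n * C / r\<^sup>2 + real n * (P x \<bullet> e) / r"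
      using r by (simp add: field_simps power2_eq_square)
    with g1 g2 have pos: "0 \<le> H x e \<bullet> e + real n * (P x \<bullet> e) / r"
      by linarith
    have c: "((\<lambda>t. t *\<^sub>R e) has_vector_derivative e) (at r)"
      using has_vector_derivative_scaleR[OF DERIV_ident has_vector_derivative_const[of e]] by simp
    have "((\<lambda>t. P (t *\<^sub>R e) \<bullet> e) has_real_derivative H x e \<bullet> e + P x \<bullet> 0) (at r)"
      unfolding x_def by (rule P_curve_deriv[OF c has_vector_derivative_const]) (use nx xR x_def in auto)
    then have "((\<lambda>t. t ^ n * (P (t *\<^sub>R e) \<bullet> e)) has_real_derivative
        real n * r ^ (n - 1) * (P x \<bullet> e) + (H x e \<bullet> e) * r ^ n) (at r)"
      by (auto intro!: derivative_eq_intros simp: x_def)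
    moreover have "real n * r ^ (n - 1) * (P x \<bullet> e) + (H x e \<bullet> e) * r ^ n
        = r ^ n * (H x e \<bullet> e + real n * (P x \<bullet> e) / r)"
      \<comment> \<open>For \<open>n = 0\<close> the truncated exponent \<open>n - 1\<close> is
        harmless, its term having the factor \<open>real n\<close>.\<close>
      using r by (cases n) (auto simp: field_simps)
    ultimately show "\<exists>y. ((\<lambda>t. t ^ n * (P (t *\<^sub>R e) \<bullet> e)) has_real_derivative y) (at r) \<and> 0 \<le> y"
      using pos r by (intro exI[of _ "r ^ n * (H x e \<bullet> e + real n * (P x \<bullet> e) / r)"] conjI) auto
  qed
  show ?thesis
    by (rule that[OF C(1) R3(1,2)]) (use C(2) mono R3 n_def in auto)
qed

text \<open>Blow-up makes the flux on the ray through \<open>p\<close> exceed any \<open>M\<close>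
  at some radius \<open>r0\<close>. Continuity keeps this at \<open>r0\<close> for nearby
  directions, monotonicity keeps it at larger radii. In the splitting of \<open>e\<close> into a
  radial and a tangential part, the radial contribution then outweighs the bounded tangential
  one.\<close>

lemma gradient_positive_near_boundary:
  fixes p e :: 'a
  assumes p: "norm p = R" and pe: "p \<bullet> e > 0"
  shows "\<forall>\<^sub>F x in nhds p. norm x < R \<longrightarrow> P x \<bullet> e > 0"
proof -
  define n where "n = DIM('a) - 1"
  obtain C R3 where C: "C \<ge> 0" and R3: "0 < R3" "R3 < R"
    and tang: "\<And>x f :: 'a. \<lbrakk>R3 \<le> norm x; norm x < R; norm f = 1; x \<bullet> f = 0\<rbrakk> \<Longrightarrow> norm x * (P x \<bullet> f) \<le> C"
    and mono: "\<And>(e :: 'a) s t. \<lbrakk>norm e = 1; R3 \<le> s; s \<le> t; t < R\<rbrakk> \<Longrightarrow>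
       s ^ n * (P (s *\<^sub>R e) \<bullet> e) \<le> t ^ n * (P (t *\<^sub>R e) \<bullet> e)"
    using radial_flux_mono unfolding n_def by blast
  \<comment> \<open>Half the limit of \<open>(x /\<^sub>R norm x) \<bullet> e\<close> at
    \<open>p\<close>, hence a lower bound for it nearby.\<close>
  define c0 where "c0 = (p \<bullet> e) / (2 * R)"
  have c0: "c0 > 0" using pe R_pos by (simp add: c0_def)
  define D where "D = C / R3 * norm e"
  have D: "D \<ge> 0" using C R3 by (simp add: D_def)
  \<comment> \<open>So that \<open>c0 * (M / R ^ n) = D + 1\<close> beats the tangential
    contribution, which is at least \<open>- D\<close>.\<close>
  define M where "M = (D + 1) * R ^ n / c0"
  have M: "M > 0" using D R_pos c0 by (simp add: M_def)
  define ph where "ph = p /\<^sub>R R"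
  have ph: "norm ph = 1" using p R_pos by (simp add: ph_def)
  obtain r0 where r0: "R3 \<le> r0" "r0 < R" "M < r0 ^ n * (P (r0 *\<^sub>R ph) \<bullet> ph)"
  proof (rule ccontr)
    assume "\<not> thesis"
    then have "\<not> (R3 \<le> t \<and> t < R \<and> M < t ^ n * (P (t *\<^sub>R ph) \<bullet> ph))" for t
      using that by blast
    then have le: "t ^ n * (P (t *\<^sub>R ph) \<bullet> ph) \<le> M" if "R3 \<le> t" "t < R" for t
      using that by (meson not_less)
    define B where "B = M / R3 ^ n"
    have B: "B > 0" using M R3 by (simp add: B_def)
    have le': "P (t *\<^sub>R ph) \<bullet> ph \<le> B" if t: "R3 \<le> t" "t < R" for t
    proof -
      have "P (t *\<^sub>R ph) \<bullet> ph \<le> M / t ^ n"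
        using le[OF t] t R3 by (simp add: pos_le_divide_eq mult.commute)
      also have "\<dots> \<le> B"
        unfolding B_def using t R3 M by (intro divide_left_mono power_mono) auto
      finally show ?thesis .
    qed
    obtain r where r: "0 < r" "r < R" "\<And>x. r \<le> norm x \<Longrightarrow> norm x < R \<Longrightarrow> u (R3 *\<^sub>R ph) + B * R < u x"
      using blowupE by blast
    define t where "t = max r R3"
    have t: "R3 \<le> t" "t < R" "r \<le> t" using r R3 by (auto simp: t_def)
    have "u (t *\<^sub>R ph) - B * t \<le> u (R3 *\<^sub>R ph) - B * R3"
    proof (rule DERIV_nonpos_imp_nonincreasing[OF t(1), of "\<lambda>t. u (t *\<^sub>R ph) - B * t"])
      fix s assume "R3 \<le> s" "s \<le> t"
      then have s: "R3 \<le> s" "s < R" "norm (s *\<^sub>R ph) < R" using t R3 ph by auto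
      have c: "((\<lambda>t. t *\<^sub>R ph) has_vector_derivative ph) (at s)"
        using has_vector_derivative_scaleR[OF DERIV_ident has_vector_derivative_const[of ph]] by simp
      have "((\<lambda>t. u (t *\<^sub>R ph) - B * t) has_real_derivative P (s *\<^sub>R ph) \<bullet> ph - B) (at s)"
        by (auto intro!: derivative_eq_intros u_curve_deriv[OF c s(3)])
      then show "\<exists>y. ((\<lambda>t. u (t *\<^sub>R ph) - B * t) has_real_derivative y) (at s) \<and> y \<le> 0"
        using le'[OF s(1,2)] by (intro exI conjI) auto
    qed
    moreover have "u (R3 *\<^sub>R ph) + B * R < u (t *\<^sub>R ph)"
      using r(3)[of "t *\<^sub>R ph"] t ph R3 by simp
    moreover have "B * t \<le> B * R" "0 \<le> B * R3" using t B R3 by auto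
    ultimately show False by linarith
  qed
  define \<phi> where "\<phi> = (\<lambda>x. r0 ^ n * (P (r0 *\<^sub>R (x /\<^sub>R norm x)) \<bullet> (x /\<^sub>R norm x)))"
  have p0: "norm p \<noteq> 0" using p R_pos by simp
  have hat: "((\<lambda>x. x /\<^sub>R norm x) \<longlongrightarrow> ph) (nhds p)"
    unfolding ph_def p[symmetric] by (intro tendsto_intros filterlim_ident p0)
  have "isCont P (r0 *\<^sub>R ph)"
    by (rule has_derivative_continuous[OF P_deriv]) (use r0 R3 ph in auto)
  then have Pc: "((\<lambda>x. P (r0 *\<^sub>R (x /\<^sub>R norm x))) \<longlongrightarrow> P (r0 *\<^sub>R ph)) (nhds p)"
    by (rule isCont_tendsto_compose) (intro tendsto_intros hat)
  have "(\<phi> \<longlongrightarrow> r0 ^ n * (P (r0 *\<^sub>R ph) \<bullet> ph)) (nhds p)"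
    unfolding \<phi>_def by (intro tendsto_intros hat Pc)
  then have "\<forall>\<^sub>F x in nhds p. M < \<phi> x"
    by (rule order_tendstoD(1)) (rule r0(3))
  moreover have "((\<lambda>x. norm x) \<longlongrightarrow> norm p) (nhds p)"
    by (intro tendsto_intros filterlim_ident)
  then have "\<forall>\<^sub>F x in nhds p. r0 < norm x"
    by (rule order_tendstoD(1)) (use p r0 in simp)
  moreover have "((\<lambda>x. (x /\<^sub>R norm x) \<bullet> e) \<longlongrightarrow> ph \<bullet> e) (nhds p)"
    by (intro tendsto_intros hat)
  then have "\<forall>\<^sub>F x in nhds p. c0 < (x /\<^sub>R norm x) \<bullet> e"
    by (rule order_tendstoD(1)) (use pe R_pos in \<open>simp add: c0_def ph_def field_simps\<close>)
  ultimately show ?thesis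
  proof eventually_elim
    case (elim x)
    show ?case
    proof
      assume xR: "norm x < R"
      define r where "r = norm x"
      define a where "a = x /\<^sub>R norm x"
      have r: "r0 < r" "R3 \<le> r" "0 < r" "r < R" using elim(2) r0 R3 xR by (auto simp: r_def)
      have xa: "x = r *\<^sub>R a" "norm a = 1" using r by (auto simp: a_def r_def)
      have "\<phi> x = r0 ^ n * (P (r0 *\<^sub>R a) \<bullet> a)"
        by (simp only: \<phi>_def a_def)
      then have "M < r ^ n * (P x \<bullet> a)"
        using mono[OF xa(2) r0(1), of r] r elim(1) xa(1) by simp
      then have "M / r ^ n < P x \<bullet> a"
        using r by (simp add: pos_divide_less_eq mult.commute)
      moreover have "M / R ^ n \<le> M / r ^ n"
        using r M R_pos by (intro divide_left_mono power_mono) auto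
      ultimately have Pa: "M / R ^ n < P x \<bullet> a" by simp
      define \<tau> where "\<tau> = e - (a \<bullet> e) *\<^sub>R a"
      have aa: "a \<bullet> a = 1" using xa(2) by (simp add: dot_square_norm)
      have "- D \<le> P x \<bullet> \<tau>"
      proof (cases "\<tau> = 0")
        case False
        \<comment> \<open>The sign turns the upper bound \<open>tang\<close> into the required lower
          bound for \<open>P x \<bullet> \<tau>\<close>.\<close>
        define f where "f = - (\<tau> /\<^sub>R norm \<tau>)"
        have "norm f = 1" using False by (simp add: f_def)
        moreover have "x \<bullet> f = 0"
          by (simp add: f_def \<tau>_def xa(1) inner_diff_right aa)
        ultimately have "r * (P x \<bullet> f) \<le> C"
          using tang[of x f] r xR by (simp add: r_def)
        then have "P x \<bullet> f \<le> C / r" using r by (simp add: pos_le_divide_eq mult.commute)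
        also have "\<dots> \<le> C / R3" using r R3 C by (intro divide_left_mono) auto
        finally have "(P x \<bullet> f) * norm \<tau> \<le> C / R3 * norm \<tau>" by (rule mult_right_mono) simp
        moreover have "(P x \<bullet> f) * norm \<tau> = - (P x \<bullet> \<tau>)" using False by (simp add: f_def)
        moreover have "norm \<tau> \<le> norm e"
        proof -
          have "(norm \<tau>)\<^sup>2 = (norm e)\<^sup>2 - (a \<bullet> e)\<^sup>2"
            unfolding power2_norm_eq_inner \<tau>_def
            by (simp add: inner_diff_left inner_diff_right aa inner_commute[of e a] power2_eq_square)
          then have "(norm \<tau>)\<^sup>2 \<le> (norm e)\<^sup>2" by simp
          then show ?thesis by (rule power2_le_imp_le) simp
        qed
        then have "C / R3 * norm \<tau> \<le> D"
          unfolding D_def using C R3 by (intro mult_left_mono) auto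
        ultimately show ?thesis by linarith
      qed (use D in simp)
      moreover have "P x \<bullet> e = (a \<bullet> e) * (P x \<bullet> a) + P x \<bullet> \<tau>"
        by (simp add: \<tau>_def inner_diff_right)
      moreover have "c0 * (M / R ^ n) < (a \<bullet> e) * (P x \<bullet> a)"
        using elim(3) Pa c0 M R_pos by (intro mult_strict_mono) (auto simp: a_def)
      moreover have "c0 * (M / R ^ n) = D + 1"
        using c0 R_pos by (simp add: M_def)
      ultimately show "0 < P x \<bullet> e" by linarith
    qed
  qed
qed

end

section \<open>Moving planes\<close>

definition mirror :: "'a::euclidean_space \<Rightarrow> real \<Rightarrow> 'a \<Rightarrow> 'a" where
  "mirror e l x = x - (2 * (x \<bullet> e - l)) *\<^sub>R e"

lemma norm_mirror:
  assumes "e \<bullet> e = 1"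
  shows "(norm (mirror e l x))\<^sup>2 = (norm x)\<^sup>2 - 4 * l * (x \<bullet> e - l)"
  unfolding power2_norm_eq_inner mirror_def
  by (simp add: inner_diff_left inner_diff_right assms inner_commute[of e x]) (simp add: algebra_simps)

lemma norm_mirror_le:
  assumes "e \<bullet> e = 1" "0 < l" "l \<le> x \<bullet> e"
  shows "norm (mirror e l x) \<le> norm x"
proof -
  have "(norm (mirror e l x))\<^sup>2 \<le> (norm x)\<^sup>2"
    unfolding norm_mirror[OF assms(1)] using assms by simp
  then show ?thesis by (rule power2_le_imp_le) simp
qed

lemma mirror_on_plane: "x \<bullet> e = l \<Longrightarrow> mirror e l x = x"
  by (simp add: mirror_def)

lemma tendsto_mirror:
  assumes "(f \<longlongrightarrow> x) F" "(l \<longlongrightarrow> m) F"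
  shows "((\<lambda>t. mirror e (l t) (f t)) \<longlongrightarrow> mirror e m x) F"
  unfolding mirror_def by (intro tendsto_intros assms)

lemma continuous_mirror: "isCont (mirror e l) x"
  unfolding isCont_def by (intro tendsto_mirror tendsto_intros)

definition cap :: "'a::euclidean_space \<Rightarrow> real \<Rightarrow> real \<Rightarrow> 'a set" where
  "cap e R l = {x. norm x < R \<and> l < x \<bullet> e}"

lemma open_cap: "open (cap e R l)"
  unfolding cap_def by (intro open_Collect_conj open_Collect_less continuous_intros)

lemma connected_cap: "connected (cap e R l)"
proof -
  have "cap e R l = ball 0 R \<inter> {x. e \<bullet> x > l}"
    by (auto simp: cap_def inner_commute)
  then show ?thesis
    by (simp add: convex_connected convex_Int convex_halfspace_gt)
qed

section \<open>Comparison with the reflected solution\<close>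

context large_sol
begin

text \<open>On a cap with \<open>l > 0\<close> the expected sign is nonnegative: the cap is the side
  farther from the centre, where \<open>u\<close> should be larger.\<close>

definition mirror_diff :: "'a \<Rightarrow> real \<Rightarrow> 'a \<Rightarrow> real" where
  "mirror_diff e l x = u x - u (mirror e l x)"

lemma jet2_mirror_diff:
  assumes e: "e \<bullet> e = 1" and x: "norm x < R" "norm (mirror e l x) < R"
  shows "\<exists>p. jet2 (mirror_diff e l) x p (g (u x) - g (u (mirror e l x)))"
proof -
  define Q where "Q = (\<lambda>x::'a. x - (2 * (x \<bullet> e)) *\<^sub>R e)"
  have mQ: "mirror e l y = Q y + (2 * l) *\<^sub>R e" for y
    by (simp add: mirror_def Q_def algebra_simps)
  have "jet2 (\<lambda>y. u (y + (2 * l) *\<^sub>R e)) (Q x) (P (mirror e l x)) (g (u (mirror e l x)))"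
    by (rule jet2_translate) (use jet2_u[OF x(2)] mQ in simp)
  from jet2_orthogonal[where Q = Q, OF this] orthogonal_transformation_reflection[OF e]
  obtain q where "jet2 (\<lambda>y. u (mirror e l y)) x q (g (u (mirror e l x)))"
    unfolding mQ Q_def by blast
  from jet2_diff[OF jet2_u[OF x(1)] this] show ?thesis
    unfolding mirror_diff_def by blast
qed

lemma u_isCont: "norm x < R \<Longrightarrow> isCont u x"
  by (rule jet2_isCont[OF jet2_u])

text \<open>A limit on the sphere but off the plane has its mirror image inside the ball, so
  \<open>u (xs n)\<close> tends to infinity while the reflected values converge. A limit on both
  lies in the region where \<open>u\<close> increases in direction \<open>e\<close>, and
  \<open>xs n\<close> lies above its mirror image in that direction. The plane may vary with
  \<open>n\<close> because \<open>reflection_inequality\<close> takes limits of planes.\<close>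

lemma bad_limit_interior:
  assumes e: "e \<bullet> e = 1" and l: "ls \<longlonglongrightarrow> l" "0 < l" and x: "xs \<longlonglongrightarrow> x"
    and bad: "\<And>n. 0 < ls n" "\<And>n. xs n \<in> cap e R (ls n)" "\<And>n. mirror_diff e (ls n) (xs n) < 0"
  shows "norm x < R" "l \<le> x \<bullet> e"
proof -
  have xs: "norm (xs n) < R" "ls n < xs n \<bullet> e" for n
    using bad(2)[of n] by (auto simp: cap_def)
  show le: "l \<le> x \<bullet> e"
    by (rule LIMSEQ_le[OF l(1) tendsto_inner[OF x tendsto_const]]) (use xs in \<open>auto intro: less_imp_le\<close>)
  have xle: "norm x \<le> R"
    by (rule LIMSEQ_le_const2[OF tendsto_norm[OF x]]) (use xs in \<open>auto intro!: less_imp_le\<close>)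
  have mt: "(\<lambda>n. mirror e (ls n) (xs n)) \<longlonglongrightarrow> mirror e l x"
    by (rule tendsto_mirror[OF x l(1)])
  show "norm x < R"
  proof (rule ccontr)
    assume "\<not> norm x < R"
    then have nx: "norm x = R" using xle by simp
    show False
    proof (cases "x \<bullet> e = l")
      case False
      then have "0 < 4 * l * (x \<bullet> e - l)" using le l(2) by simp
      then have "(norm (mirror e l x))\<^sup>2 < R\<^sup>2"
        unfolding norm_mirror[OF e] using nx by simp
      then have z: "norm (mirror e l x) < R"
        using R_pos by (simp add: power2_less_imp_less)
      have "(\<lambda>n. u (mirror e (ls n) (xs n))) \<longlonglongrightarrow> u (mirror e l x)"
        by (rule isCont_tendsto_compose[OF u_isCont[OF z] mt])
      then have 1: "\<forall>\<^sub>F n in sequentially. u (mirror e (ls n) (xs n)) < u (mirror e l x) + 1"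
        by (rule order_tendstoD(2)) simp
      obtain r where r: "0 < r" "r < R" "\<And>y. r \<le> norm y \<Longrightarrow> norm y < R \<Longrightarrow> u (mirror e l x) + 1 < u y"
        using blowupE by blast
      have "\<forall>\<^sub>F n in sequentially. r < norm (xs n)"
        by (rule order_tendstoD(1)[OF tendsto_norm[OF x]]) (use nx r in simp)
      with 1 have "\<forall>\<^sub>F n in sequentially. False"
      proof eventually_elim
        case (elim n)
        then show ?case using r(3)[of "xs n"] xs[of n] bad(3)[of n] by (simp add: mirror_diff_def)
      qed
      then show False by simp
    next
      case True
      then have mx: "mirror e l x = x" by (rule mirror_on_plane)
      have "x \<bullet> e > 0" using True l(2) by simp
      from gradient_positive_near_boundary[OF nx this]
      obtain d where d: "d > 0" "\<And>y. dist y x < d \<Longrightarrow> norm y < R \<Longrightarrow> P y \<bullet> e > 0"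
        unfolding eventually_nhds_metric by blast
      have "\<forall>\<^sub>F n in sequentially. dist (xs n) x < d"
        using tendstoD[OF x d(1)] .
      moreover have "\<forall>\<^sub>F n in sequentially. dist (mirror e (ls n) (xs n)) x < d"
        using tendstoD[OF mt d(1)] by (simp add: mx)
      ultimately have "\<forall>\<^sub>F n in sequentially. False"
      proof eventually_elim
        case (elim n)
        define y where "y = mirror e (ls n) (xs n)"
        define s where "s = 2 * (xs n \<bullet> e - ls n)"
        have s: "s > 0" using xs[of n] by (simp add: s_def)
        have xy: "xs n = y + s *\<^sub>R e" by (simp add: y_def s_def mirror_def)
        have yR: "norm y < R"
          using norm_mirror_le[OF e bad(1)[of n], of "xs n"] xs[of n] by (simp add: y_def)
        have conv: "convex (ball x d \<inter> ball 0 R)"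
          by (intro convex_Int convex_ball)
        \<comment> \<open>The segment from the mirror image to \<open>xs n\<close> stays where the
          gradient is controlled, by convexity of both balls.\<close>
        have seg: "y + t *\<^sub>R e \<in> ball x d \<inter> ball 0 R" if "0 \<le> t" "t \<le> s" for t
        proof -
          have "(1 - t / s) *\<^sub>R y + (t / s) *\<^sub>R xs n \<in> ball x d \<inter> ball 0 R"
            by (rule convexD_alt[OF conv]) (use elim yR xs[of n] that s in \<open>auto simp: dist_commute y_def\<close>)
          moreover have "(1 - t / s) *\<^sub>R y + (t / s) *\<^sub>R xs n = y + t *\<^sub>R e"
            using s by (simp add: xy algebra_simps)
          ultimately show ?thesis by simp
        qed
        have c: "((\<lambda>t. y + t *\<^sub>R e) has_vector_derivative e) (at t)" for t
          using has_vector_derivative_add[OF has_vector_derivative_const[of y]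
              has_vector_derivative_scaleR[OF DERIV_ident has_vector_derivative_const[of e]]] by simp
        have "u (y + 0 *\<^sub>R e) < u (y + s *\<^sub>R e)"
        proof (rule DERIV_pos_imp_increasing[OF s, of "\<lambda>t. u (y + t *\<^sub>R e)"])
          fix t assume "0 \<le> t" "t \<le> s"
          then have t: "dist (y + t *\<^sub>R e) x < d" "norm (y + t *\<^sub>R e) < R"
            using seg[of t] by (auto simp: dist_commute)
          show "\<exists>z. ((\<lambda>t. u (y + t *\<^sub>R e)) has_real_derivative z) (at t) \<and> 0 < z"
            using u_curve_deriv[OF c t(2)] d(2)[OF t] by blast
        qed
        then show False
          using bad(3)[of n] by (simp add: mirror_diff_def y_def[symmetric] xy[symmetric])
      qed
      then show False by simp
    qed
  qed
qed


lemma g_local_lipschitz: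
  obtains \<rho> L where "\<rho> > 0" "L \<ge> 0" "\<And>p q. \<bar>p - s\<bar> < \<rho> \<Longrightarrow> \<bar>q - s\<bar> < \<rho> \<Longrightarrow> \<bar>g p - g q\<bar> \<le> L * \<bar>p - q\<bar>"
proof -
  obtain r L where r: "r > 0" "L-lipschitz_on (ball s r) g"
    using g_lip unfolding locally_lipschitz_def by blast
  show ?thesis
    by (rule that[OF r(1) lipschitz_on_nonneg[OF r(2)]])
      (use lipschitz_onD[OF r(2)] in \<open>auto simp: dist_real_def abs_minus_commute\<close>)
qed

text \<open>Strong maximum principle at a zero of \<open>mirror_diff\<close>. There \<open>u x\<close> and \<open>u (mirror e l x)\<close> agree, so the local
  Lipschitz constant of \<open>g\<close> suffices; the barrier is Hopf's \<open>exp (- \<alpha> * (dist x y)\<^sup>2) - exp (- \<alpha> * r\<^sup>2)\<close>.\<close>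

lemma touching_set_open:
  assumes e: "e \<bullet> e = 1" and l: "0 < l" and good: "\<And>x. x \<in> cap e R l \<Longrightarrow> 0 \<le> mirror_diff e l x"
    and x0: "x0 \<in> cap e R l" "mirror_diff e l x0 = 0"
  shows "\<forall>\<^sub>F y in nhds x0. mirror_diff e l y = 0"
proof -
  let ?m = "mirror e l"
  have capR: "norm x < R" "norm (?m x) < R" if "x \<in> cap e R l" for x
    using that norm_mirror_le[OF e l, of x] by (auto simp: cap_def)
  have eq: "u (?m x0) = u x0" using x0(2) by (simp add: mirror_diff_def)
  obtain \<rho> L where rho: "\<rho> > 0" and L: "L \<ge> 0"
    and lip: "\<And>p q. \<bar>p - u x0\<bar> < \<rho> \<Longrightarrow> \<bar>q - u x0\<bar> < \<rho> \<Longrightarrow> \<bar>g p - g q\<bar> \<le> L * \<bar>p - q\<bar>"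
    using g_local_lipschitz by blast
  have um: "isCont (\<lambda>x. u (?m x)) x0"
    by (rule isCont_o2[OF continuous_mirror u_isCont[OF capR(2)[OF x0(1)]]])
  have "\<forall>\<^sub>F x in nhds x0. dist (u x) (u x0) < \<rho>"
    using u_isCont[OF capR(1)[OF x0(1)]] tendsto_at_iff_tendsto_nhds[of u x0] tendstoD[OF _ rho]
    unfolding isCont_def by blast
  moreover have "\<forall>\<^sub>F x in nhds x0. dist (u (?m x)) (u (?m x0)) < \<rho>"
    using um tendsto_at_iff_tendsto_nhds[of "\<lambda>x. u (?m x)" x0] tendstoD[OF _ rho]
    unfolding isCont_def by blast
  moreover have "\<forall>\<^sub>F x in nhds x0. x \<in> cap e R l"
    by (rule eventually_nhds_in_open[OF open_cap x0(1)])
  ultimately have "\<forall>\<^sub>F x in nhds x0. dist (u x) (u x0) < \<rho> \<and> dist (u (?m x)) (u x0) < \<rho> \<and> x \<in> cap e R l"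
    unfolding eq by eventually_elim simp
  then obtain d where d: "d > 0" "\<And>x. dist x x0 < d \<Longrightarrow> dist (u x) (u x0) < \<rho> \<and> dist (u (?m x)) (u x0) < \<rho> \<and> x \<in> cap e R l"
    unfolding eventually_nhds_metric by blast
  define r where "r = d / 3"
  have r: "r > 0" using d(1) by (simp add: r_def)
  have zero: "mirror_diff e l y = 0" if y: "dist y x0 < r" for y
  proof (rule ccontr)
    have near: "dist x x0 < d" if "dist x y \<le> r" for x
      using dist_triangle[of x x0 y] that y r by (simp add: r_def)
    assume "mirror_diff e l y \<noteq> 0"
    then have wy: "mirror_diff e l y > 0" using good[of y] d(2)[OF near[of y]] r by fastforce
    define \<delta> where "\<delta> = mirror_diff e l y / 2"
    have del: "\<delta> > 0" using wy by (simp add: \<delta>_def)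
    have wc: "isCont (mirror_diff e l) x" if "dist x y \<le> r" for x
      using jet2_mirror_diff[OF e capR] d(2)[OF near[OF that]] jet2_isCont by blast
    have "(mirror_diff e l \<longlongrightarrow> mirror_diff e l y) (nhds y)"
      using wc[of y] r tendsto_at_iff_tendsto_nhds[of "mirror_diff e l" y] by (simp add: isCont_def)
    then have "\<forall>\<^sub>F x in nhds y. \<delta> < mirror_diff e l x"
      by (rule order_tendstoD) (use wy in \<open>simp add: \<delta>_def\<close>)
    then obtain r2 where r2: "r2 > 0" "\<And>x. dist x y < r2 \<Longrightarrow> \<delta> < mirror_diff e l x"
      unfolding eventually_nhds_metric by blast
    define r1 where "r1 = r2 / 2"
    have r1: "r1 > 0" "\<And>x. dist x y \<le> r1 \<Longrightarrow> \<delta> < mirror_diff e l x" using r2 by (auto simp: r1_def)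
    have x0r: "r1 < dist x0 y" "dist x0 y < r"
      using r1(2)[of x0] x0(2) del y by (force simp: dist_commute)+
    define N where "N = real DIM('a)"
    \<comment> \<open>Makes \<open>4 * \<alpha> * (dist x y)\<^sup>2 - 2 * N \<ge> L + 1\<close> for
      \<open>dist x y \<ge> r1\<close>, so that there the Laplacian of \<open>h\<close> exceeds
      \<open>L * h\<close>.\<close>
    define \<alpha> where "\<alpha> = max 1 ((2 * N + L + 1) / (4 * r1\<^sup>2))"
    have al: "\<alpha> \<ge> 1" "2 * N + L + 1 \<le> 4 * \<alpha> * r1\<^sup>2"
    proof -
      have "(2 * N + L + 1) / (4 * r1\<^sup>2) \<le> \<alpha>" by (simp add: \<alpha>_def)
      then show "2 * N + L + 1 \<le> 4 * \<alpha> * r1\<^sup>2"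
        using r1(1) by (simp add: pos_divide_le_eq algebra_simps)
    qed (simp add: \<alpha>_def)
    define h where "h = (\<lambda>x. exp (- \<alpha> * ((x - y) \<bullet> (x - y))) - exp (- \<alpha> * r\<^sup>2))"
    have sq: "(x - y) \<bullet> (x - y) = (dist x y)\<^sup>2" for x
      by (simp add: dist_norm power2_norm_eq_inner)
    have jh: "\<exists>p. jet2 h x p (exp (- \<alpha> * (dist x y)\<^sup>2) * (4 * \<alpha>\<^sup>2 * (dist x y)\<^sup>2 - 2 * \<alpha> * N))" for x
    proof -
      define s where "s = (x - y) \<bullet> (x - y)"
      have "\<forall>\<^sub>F s in nhds ((x - y) \<bullet> (x - y)). ((\<lambda>s. exp (- \<alpha> * s)) has_real_derivative - \<alpha> * exp (- \<alpha> * s)) (at s)"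
        by (intro always_eventually allI) (auto intro!: derivative_eq_intros)
      moreover have "((\<lambda>s. - \<alpha> * exp (- \<alpha> * s)) has_real_derivative \<alpha>\<^sup>2 * exp (- \<alpha> * s)) (at ((x - y) \<bullet> (x - y)))"
        unfolding s_def by (auto intro!: derivative_eq_intros simp: power2_eq_square)
      ultimately have "jet2 (\<lambda>x. exp (- \<alpha> * ((x - y) \<bullet> (x - y)))) x ((- \<alpha> * exp (- \<alpha> * s)) *\<^sub>R (2 *\<^sub>R (x - y)))
         (- \<alpha> * exp (- \<alpha> * s) * (2 * real DIM('a)) + \<alpha>\<^sup>2 * exp (- \<alpha> * s) * (2 *\<^sub>R (x - y) \<bullet> 2 *\<^sub>R (x - y)))"
        unfolding s_def by (rule jet2_compose[OF jet2_sqdist])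
      from jet2_diff[OF this jet2_const[of "exp (- \<alpha> * r\<^sup>2)"]]
      have "\<exists>p. jet2 h x p (- \<alpha> * exp (- \<alpha> * s) * (2 * real DIM('a)) + \<alpha>\<^sup>2 * exp (- \<alpha> * s) * (2 *\<^sub>R (x - y) \<bullet> 2 *\<^sub>R (x - y)) - 0)"
        unfolding h_def by blast
      also have "- \<alpha> * exp (- \<alpha> * s) * (2 * real DIM('a)) + \<alpha>\<^sup>2 * exp (- \<alpha> * s) * (2 *\<^sub>R (x - y) \<bullet> 2 *\<^sub>R (x - y)) - 0
          = exp (- \<alpha> * (dist x y)\<^sup>2) * (4 * \<alpha>\<^sup>2 * (dist x y)\<^sup>2 - 2 * \<alpha> * N)"
      proof -
        have "2 *\<^sub>R (x - y) \<bullet> 2 *\<^sub>R (x - y) = 4 * s" "s = (dist x y)\<^sup>2"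
          by (simp_all add: s_def sq)
        then show ?thesis
          by (simp add: N_def algebra_simps)
      qed
      finally show ?thesis .
    qed
    define f where "f = (\<lambda>x. mirror_diff e l x - \<delta> * h x)"
    have h1: "h x \<le> exp (- \<alpha> * (dist x y)\<^sup>2)" "h x \<le> 1" for x
    proof -
      show "h x \<le> exp (- \<alpha> * (dist x y)\<^sup>2)" by (simp add: h_def sq)
      also have "\<dots> \<le> 1" using al by simp
      finally show "h x \<le> 1" .
    qed
    \<comment> \<open>On the outer sphere \<open>h\<close> vanishes and on the inner one
      \<open>mirror_diff e l\<close> exceeds \<open>\<delta>\<close>; so \<open>f\<close> is
      nonnegative on both, and its negative value at \<open>x0\<close> forces an interior
      minimum.\<close>
    define K where "K = {x. r1 \<le> dist x y \<and> dist x y \<le> r}"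
    have "K = cball y r \<inter> {x. r1 \<le> dist x y}" by (auto simp: K_def dist_commute)
    moreover have "closed {x. r1 \<le> dist x y}"
      by (intro closed_Collect_le continuous_intros)
    ultimately have "compact K" by (simp add: compact_Int_closed)
    moreover have "x0 \<in> K" using x0r by (simp add: K_def)
    moreover have "continuous_on K f"
      unfolding f_def
      by (intro continuous_at_imp_continuous_on ballI continuous_intros)
        (use wc jh jet2_isCont K_def in blast)+
    ultimately obtain x where x: "x \<in> K" "\<And>z. z \<in> K \<Longrightarrow> f x \<le> f z"
      using continuous_attains_inf[of K f] by blast
    have "(dist x0 y)\<^sup>2 < r\<^sup>2" using x0r by (intro power_strict_mono) auto
    then have "h x0 > 0" using al by (simp add: h_def sq)
    then have "f x0 < 0" using x0(2) del by (simp add: f_def)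
    then have fx: "f x < 0" using x(2)[OF \<open>x0 \<in> K\<close>] by simp
    have wx: "mirror_diff e l x \<ge> 0" using good d(2)[OF near[of x]] x(1) by (auto simp: K_def)
    have "dist x y \<noteq> r"
    proof
      assume "dist x y = r"
      then have "h x = 0" by (simp add: h_def sq)
      then show False using fx wx by (simp add: f_def)
    qed
    moreover have "dist x y \<noteq> r1"
    proof
      assume "dist x y = r1"
      then have "\<delta> < mirror_diff e l x" using r1 by simp
      moreover have "\<delta> * h x \<le> \<delta>" using h1(2)[of x] del by simp
      ultimately show False using fx by (simp add: f_def)
    qed
    ultimately have xi: "r1 < dist x y" "dist x y < r" using x(1) by (auto simp: K_def)
    have "open {x. r1 < dist x y \<and> dist x y < r}"
      by (intro open_Collect_conj open_Collect_less continuous_intros)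
    from eventually_nhds_in_open[OF this, of x] xi
    have ev: "\<forall>\<^sub>F z in nhds x. f x \<le> f z"
      using x(2) by (auto simp: K_def elim!: eventually_mono)
    have xd: "dist (u x) (u x0) < \<rho>" "dist (u (?m x)) (u x0) < \<rho>" "x \<in> cap e R l"
      using d(2)[OF near[of x]] xi by auto
    define E where "E = exp (- \<alpha> * (dist x y)\<^sup>2)"
    have E: "E > 0" by (simp add: E_def)
    obtain p where "jet2 (mirror_diff e l) x p (g (u x) - g (u (?m x)))"
      using jet2_mirror_diff[OF e capR[OF xd(3)]] by blast
    moreover obtain q where "jet2 h x q (E * (4 * \<alpha>\<^sup>2 * (dist x y)\<^sup>2 - 2 * \<alpha> * N))"
      using jh unfolding E_def by blast
    ultimately have "jet2 f x (p - \<delta> *\<^sub>R q) (g (u x) - g (u (?m x)) - \<delta> * (E * (4 * \<alpha>\<^sup>2 * (dist x y)\<^sup>2 - 2 * \<alpha> * N)))"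
      unfolding f_def by (intro jet2_diff jet2_cmult)
    from jet2_min(2)[OF this ev]
    have 1: "\<delta> * (E * (4 * \<alpha>\<^sup>2 * (dist x y)\<^sup>2 - 2 * \<alpha> * N)) \<le> g (u x) - g (u (?m x))" by simp
    have "\<bar>g (u x) - g (u (?m x))\<bar> \<le> L * \<bar>u x - u (?m x)\<bar>"
      using lip xd by (simp add: dist_real_def)
    then have "g (u x) - g (u (?m x)) \<le> L * mirror_diff e l x"
      using wx by (simp add: mirror_diff_def)
    also have "\<dots> \<le> L * (\<delta> * E)"
    proof (rule mult_left_mono[OF _ L])
      have "mirror_diff e l x \<le> \<delta> * h x" using fx by (simp add: f_def)
      also have "\<dots> \<le> \<delta> * E" using h1(1)[of x] del by (simp add: E_def)
      finally show "mirror_diff e l x \<le> \<delta> * E" .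
    qed
    finally have "(\<delta> * E) * (4 * \<alpha>\<^sup>2 * (dist x y)\<^sup>2 - 2 * \<alpha> * N) \<le> (\<delta> * E) * L"
      using 1 by (simp add: mult_ac)
    then have 2: "4 * \<alpha>\<^sup>2 * (dist x y)\<^sup>2 - 2 * \<alpha> * N \<le> L"
      using del E by (simp add: mult_le_cancel_left_pos)
    have rr: "4 * \<alpha> * r1\<^sup>2 \<le> 4 * \<alpha> * (dist x y)\<^sup>2"
      using xi r1(1) al by (intro mult_left_mono power_mono) auto
    have "\<alpha> * (2 * N + L + 1) \<le> \<alpha> * (4 * \<alpha> * (dist x y)\<^sup>2)"
      using al(1) by (intro mult_left_mono order_trans[OF al(2) rr]) simp
    moreover have "L + 1 \<le> \<alpha> * (L + 1)"
      using mult_right_mono[OF al(1), of "L + 1"] L by simp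
    ultimately show False
      using 2 by (simp add: algebra_simps power2_eq_square)
  qed
  show ?thesis
    unfolding eventually_nhds_metric using r zero by blast
qed


text \<open>By connectedness of the cap, one zero would make \<open>mirror_diff e l\<close> vanish
  identically there. But on the way to \<open>R *\<^sub>R e\<close> the solution blows up, while the
  mirror images converge to the interior point \<open>z\<close>.\<close>

lemma no_touching:
  assumes e: "e \<bullet> e = 1" and l: "0 < l" "l < R" and good: "\<And>x. x \<in> cap e R l \<Longrightarrow> 0 \<le> mirror_diff e l x"
    and x0: "x0 \<in> cap e R l"
  shows "mirror_diff e l x0 \<noteq> 0"
proof
  assume w0: "mirror_diff e l x0 = 0"
  define Z where "Z = {x \<in> cap e R l. mirror_diff e l x = 0}"
  have capR: "norm x < R" "norm (mirror e l x) < R" if "x \<in> cap e R l" for x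
    using that norm_mirror_le[OF e l(1), of x] by (auto simp: cap_def)
  have "open Z"
  proof (subst open_subopen, rule ballI)
    fix x assume x: "x \<in> Z"
    then have "\<forall>\<^sub>F y in nhds x. mirror_diff e l y = 0"
      using touching_set_open[OF e l(1) good] by (simp add: Z_def)
    moreover have "\<forall>\<^sub>F y in nhds x. y \<in> cap e R l"
      by (rule eventually_nhds_in_open[OF open_cap]) (use x in \<open>simp add: Z_def\<close>)
    ultimately have "\<forall>\<^sub>F y in nhds x. y \<in> Z"
      by eventually_elim (simp add: Z_def)
    then show "\<exists>T. open T \<and> x \<in> T \<and> T \<subseteq> Z"
      unfolding eventually_nhds by blast
  qed
  have wc: "continuous_on (cap e R l) (mirror_diff e l)"
    by (intro continuous_at_imp_continuous_on ballI) (use jet2_mirror_diff[OF e capR] jet2_isCont in blast)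
  define Y where "Y = {x \<in> cap e R l. mirror_diff e l x > 0}"
  have "open (mirror_diff e l -` {0<..} \<inter> cap e R l)"
    by (rule continuous_on_open_vimage[OF open_cap, THEN iffD1, rule_format, OF wc]) simp
  moreover have "mirror_diff e l -` {0<..} \<inter> cap e R l = Y" by (auto simp: Y_def)
  ultimately have "open Y" by simp
  moreover have "cap e R l \<subseteq> Z \<union> Y"
    using good by (force simp: Z_def Y_def)
  moreover have "Z \<inter> Y \<inter> cap e R l = {}"
    by (auto simp: Z_def Y_def)
  ultimately have "Z \<inter> cap e R l = {} \<or> Y \<inter> cap e R l = {}"
    using connectedD[OF connected_cap \<open>open Z\<close>] by blast
  moreover have "x0 \<in> Z \<inter> cap e R l" using x0 w0 by (simp add: Z_def)
  ultimately have Ye: "Y \<inter> cap e R l = {}" by blast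
  have wz: "mirror_diff e l x = 0" if "x \<in> cap e R l" for x
    using good[OF that] that Ye by (force simp: Y_def)
  define z where "z = mirror e l (R *\<^sub>R e)"
  have "(norm z)\<^sup>2 = R\<^sup>2 - 4 * l * (R - l)"
    unfolding z_def norm_mirror[OF e] unfolding power2_norm_eq_inner using e by (simp add: power2_eq_square)
  moreover have "4 * l * (R - l) > 0" using l by simp
  ultimately have "(norm z)\<^sup>2 < R\<^sup>2" by simp
  then have zR: "norm z < R" using R_pos by (simp add: power2_less_imp_less)
  \<comment> \<open>The shift \<open>n + 2\<close> keeps the step strictly below
    \<open>R - l\<close>, so every \<open>X n\<close> lies in the cap.\<close>
  define X where "X = (\<lambda>n. (R - (R - l) / real (n + 2)) *\<^sub>R e)"
  have ne: "norm e = 1" using e by (simp add: norm_eq_sqrt_inner)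
  have t0: "(\<lambda>n. (R - l) / real (n + 2)) \<longlonglongrightarrow> 0"
    using LIMSEQ_ignore_initial_segment[OF lim_const_over_n, of "R - l" 2] by simp
  have X: "X \<longlonglongrightarrow> R *\<^sub>R e"
    unfolding X_def using tendsto_scaleR[OF tendsto_diff[OF tendsto_const t0] tendsto_const[of e], of R] by simp
  have sm: "0 < (R - l) / real (n + 2)" "(R - l) / real (n + 2) < R - l" for n
    using l by (auto simp: divide_less_eq)
  have Xcap: "X n \<in> cap e R l" for n
    using sm[of n] l e ne by (auto simp: cap_def X_def)
  have "(\<lambda>n. u (mirror e l (X n))) \<longlonglongrightarrow> u z"
    unfolding z_def by (rule isCont_tendsto_compose[OF u_isCont[OF zR[unfolded z_def]]])
      (intro tendsto_mirror X tendsto_const)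
  then have 1: "\<forall>\<^sub>F n in sequentially. u (mirror e l (X n)) < u z + 1"
    by (rule order_tendstoD(2)) simp
  obtain r where r: "0 < r" "r < R" "\<And>y. r \<le> norm y \<Longrightarrow> norm y < R \<Longrightarrow> u z + 1 < u y"
    using blowupE by blast
  have "\<forall>\<^sub>F n in sequentially. r < norm (X n)"
    by (rule order_tendstoD(1)[OF tendsto_norm[OF X]]) (use ne r in simp)
  with 1 have "\<forall>\<^sub>F n in sequentially. False"
  proof eventually_elim
    case (elim n)
    then show ?case using r(3)[of "X n"] capR[OF Xcap[of n]] wz[OF Xcap[of n]] by (simp add: mirror_diff_def)
  qed
  then show False by simp
qed


text \<open>The second derivative of \<open>t * sqrt t\<close> is unbounded at \<open>0\<close>. Dividing by \<open>K - t * sqrt t\<close>, with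
  \<open>t\<close> the distance to the plane, therefore keeps the minimum away from the plane and replaces
  Hopf's lemma.\<close>

lemma worst_point:
  assumes e: "e \<bullet> e = 1" and l: "0 < l" and bad: "z \<in> cap e R l" "mirror_diff e l z < 0"
    and K: "K = 2 * R * sqrt (2 * R) + 1"
  shows "\<exists>x\<in>cap e R l. mirror_diff e l x < 0 \<and>
    3 * (- mirror_diff e l x) / (4 * K * sqrt (x \<bullet> e - l)) \<le> g (u x) - g (u (mirror e l x))"
proof -
  have ne: "norm e = 1" using e by (simp add: norm_eq_sqrt_inner)
  have capR: "norm x < R" "norm (mirror e l x) < R" if "x \<in> cap e R l" for x
    using that norm_mirror_le[OF e l, of x] by (auto simp: cap_def)
  define T where "T = (\<lambda>t. t * sqrt t)"
  define \<phi> where "\<phi> = (\<lambda>x. K - T (x \<bullet> e - l))"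
  \<comment> \<open>\<open>K\<close> is 1 plus the value of \<open>T\<close> at
    \<open>2 * R\<close>, an upper bound for the distance to the plane; hence
    \<open>\<phi> \<ge> 1\<close>.\<close>
  have phi: "1 \<le> \<phi> x" "\<phi> x \<le> K" if "norm x < R" "l \<le> x \<bullet> e" for x
  proof -
    have "x \<bullet> e \<le> norm x" using Cauchy_Schwarz_ineq2[of x e] ne by simp
    then have "x \<bullet> e - l \<le> 2 * R" using that l R_pos by simp
    then have "T (x \<bullet> e - l) \<le> 2 * R * sqrt (2 * R)"
      unfolding T_def using that R_pos by (intro mult_mono) auto
    then show "1 \<le> \<phi> x" by (simp add: \<phi>_def K)
    show "\<phi> x \<le> K" using that by (simp add: \<phi>_def T_def)
  qed
  have phic: "isCont \<phi> x" for x
    unfolding \<phi>_def T_def by (intro continuous_intros)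
  define q where "q = (\<lambda>x. mirror_diff e l x / \<phi> x)"
  have wc: "isCont (mirror_diff e l) x" if "norm x < R" "l \<le> x \<bullet> e" for x
  proof -
    have "norm (mirror e l x) < R" using norm_mirror_le[OF e l that(2)] that(1) by simp
    then show ?thesis using jet2_mirror_diff[OF e that(1)] jet2_isCont by blast
  qed
  have qc: "isCont q x" if "norm x < R" "l \<le> x \<bullet> e" for x
    unfolding q_def using wc[OF that] phic phi(1)[OF that] by (intro continuous_intros) auto
  have zc: "norm z < R" "l \<le> z \<bullet> e" using bad by (auto simp: cap_def)
  have qz: "q z < 0" using bad phi(1)[OF zc] by (simp add: q_def divide_neg_pos)
  \<comment> \<open>The cap is not compact, but this sublevel set is:
    \<open>bad_limit_interior\<close> excludes limits on the sphere, and on the plane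
    \<open>mirror_diff\<close> vanishes, which contradicts \<open>q x \<le> q z < 0\<close>.\<close>
  define S where "S = {x \<in> cap e R l. q x \<le> q z}"
  have "seq_compact S"
    unfolding seq_compact_def
  proof (intro allI impI)
    fix f :: "nat \<Rightarrow> 'a" assume f: "\<forall>n. f n \<in> S"
    have "bounded (range f)"
      by (rule bounded_subset[of "ball 0 R"]) (use f in \<open>auto simp: S_def cap_def\<close>)
    then obtain x s where s: "strict_mono (s :: nat \<Rightarrow> nat)" "(f \<circ> s) \<longlonglongrightarrow> x"
      using bounded_imp_convergent_subsequence[of f] by auto
    have fs: "(f \<circ> s) n \<in> cap e R l" "q ((f \<circ> s) n) \<le> q z" for n
      using f by (auto simp: S_def)
    have wneg: "mirror_diff e l y < 0" if "norm y < R" "l \<le> y \<bullet> e" "q y \<le> q z" for y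
    proof -
      have "mirror_diff e l y / \<phi> y < 0" using qz that(3) by (simp add: q_def)
      then show ?thesis using phi(1)[OF that(1,2)] by (simp add: divide_less_0_iff)
    qed
    have "mirror_diff e l ((f \<circ> s) n) < 0" for n
      using fs[of n] by (intro wneg) (auto simp: cap_def)
    from bad_limit_interior[OF e tendsto_const l s(2) l fs(1) this]
    have x: "norm x < R" "l \<le> x \<bullet> e" by auto
    have "(\<lambda>n. q ((f \<circ> s) n)) \<longlonglongrightarrow> q x"
      by (rule isCont_tendsto_compose[OF qc[OF x] s(2)])
    then have qx: "q x \<le> q z"
      by (rule LIMSEQ_le_const2) (use fs in auto)
    have "x \<bullet> e \<noteq> l"
      using wneg[OF x qx] mirror_on_plane[of x e l] by (auto simp: mirror_diff_def)
    then have "x \<in> S" using x qx by (simp add: S_def cap_def)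
    then show "\<exists>l\<in>S. \<exists>r. strict_mono r \<and> (f \<circ> r) \<longlonglongrightarrow> l" using s by blast
  qed
  then have "compact S" by (simp add: compact_eq_seq_compact_metric)
  moreover have "z \<in> S" using bad by (simp add: S_def)
  moreover have "continuous_on S q"
    by (intro continuous_at_imp_continuous_on ballI qc) (auto simp: S_def cap_def)
  ultimately obtain x where x: "x \<in> S" "\<And>y. y \<in> S \<Longrightarrow> q x \<le> q y"
    using continuous_attains_inf[of S q] by blast
  have xc: "x \<in> cap e R l" "norm x < R" "l < x \<bullet> e" using x(1) by (auto simp: S_def cap_def)
  have qmin: "q x \<le> q y" if "y \<in> cap e R l" for y
    using x that by (cases "q y \<le> q z") (auto simp: S_def)
  \<comment> \<open>Minimality of \<open>q\<close> means that
    \<open>mirror_diff e l y + m * \<phi> y\<close> is nonnegative on the cap and zero at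
    \<open>x\<close>, which avoids differentiating the quotient.\<close>
  define m where "m = - q x"
  have m: "m > 0" using x(1) qz by (simp add: S_def m_def)
  have px: "1 \<le> \<phi> x" "\<phi> x \<le> K" using phi[of x] xc by auto
  have wx: "mirror_diff e l x = - m * \<phi> x" using px by (simp add: m_def q_def)
  define d where "d = x \<bullet> e - l"
  have d: "d > 0" using xc by (simp add: d_def)
  have T1: "(T has_real_derivative 3 / 2 * sqrt t) (at t)" if "t > 0" for t
    unfolding T_def using that
    by (auto intro!: derivative_eq_intros simp: field_simps)
  have T2: "((\<lambda>t. 3 / 2 * sqrt t) has_real_derivative 3 / (4 * sqrt t)) (at t)" if "t > 0" for t
    using that by (auto intro!: derivative_eq_intros simp: field_simps)
  have "jet2 (\<lambda>y. y \<bullet> e - l) x (e - 0) (0 - 0)"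
    by (intro jet2_diff jet2_inner jet2_const)
  then have j1: "jet2 (\<lambda>y. y \<bullet> e - l) x e 0" by simp
  have "\<forall>\<^sub>F t in nhds (x \<bullet> e - l). (T has_real_derivative 3 / 2 * sqrt t) (at t)"
    by (rule eventually_mono[OF eventually_nhds_in_open[of "{0<..}"]]) (use xc T1 in auto)
  from jet2_compose[OF j1 this T2]
  have j2: "jet2 (\<lambda>y. T (y \<bullet> e - l)) x ((3 / 2 * sqrt d) *\<^sub>R e) (3 / (4 * sqrt d))"
    using d e by (simp add: d_def)
  obtain p where "jet2 (mirror_diff e l) x p (g (u x) - g (u (mirror e l x)))"
    using jet2_mirror_diff[OF e capR[OF xc(1)]] by blast
  from jet2_add[OF this jet2_cmult[OF jet2_diff[OF jet2_const[of K] j2], of m]]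
  have j3: "jet2 (\<lambda>y. mirror_diff e l y + m * \<phi> y) x (p + m *\<^sub>R (0 - (3 / 2 * sqrt d) *\<^sub>R e))
     (g (u x) - g (u (mirror e l x)) + m * (0 - 3 / (4 * sqrt d)))"
    by (simp add: \<phi>_def)
  have "\<forall>\<^sub>F y in nhds x. y \<in> cap e R l"
    by (rule eventually_nhds_in_open[OF open_cap xc(1)])
  then have "\<forall>\<^sub>F y in nhds x. mirror_diff e l x + m * \<phi> x \<le> mirror_diff e l y + m * \<phi> y"
  proof eventually_elim
    case (elim y)
    have "\<phi> y \<ge> 1" using phi(1)[of y] elim by (auto simp: cap_def)
    then have "- m * \<phi> y \<le> mirror_diff e l y"
      using qmin[OF elim] by (simp add: q_def m_def pos_le_divide_eq)
    then show ?case using wx by simp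
  qed
  from jet2_min(2)[OF j3 this]
  have "m * (3 / (4 * sqrt d)) \<le> g (u x) - g (u (mirror e l x))" by simp
  moreover have "3 * (- mirror_diff e l x) / (4 * K * sqrt d) \<le> m * (3 / (4 * sqrt d))"
  proof -
    have "m * \<phi> x / K \<le> m" using px m by (simp add: pos_divide_le_eq)
    then have "m * \<phi> x / K * (3 / (4 * sqrt d)) \<le> m * (3 / (4 * sqrt d))"
      using d by (intro mult_right_mono) auto
    then show ?thesis by (simp add: wx mult_ac)
  qed
  ultimately show ?thesis
    using xc(1) wx m px by (intro bexI[of _ x]) (auto simp: d_def)
qed

text \<open>Worst points for bad planes tending to the supremum \<open>L\<close> of bad positions
  accumulate at an interior point \<open>y\<close>. Off the plane, \<open>y\<close> would be a
  touching point, excluded by \<open>no_touching\<close>. On the plane, both values of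
  \<open>u\<close> tend to \<open>u y\<close>, where \<open>g\<close> has a fixed Lipschitz
  constant, while \<open>worst_point\<close> demands one that grows like the inverse square root of
  the distance to the plane.\<close>

lemma reflection_inequality:
  assumes e: "e \<bullet> e = 1" and l: "0 < l" "l < R" and x: "x \<in> cap e R l"
  shows "0 \<le> mirror_diff e l x"
proof (rule ccontr)
  assume neg: "\<not> 0 \<le> mirror_diff e l x"
  define Bad where "Bad = {l. 0 < l \<and> l < R \<and> (\<exists>x\<in>cap e R l. mirror_diff e l x < 0)}"
  have lB: "l \<in> Bad" using neg l x by (auto simp: Bad_def not_le)
  have bdd: "bdd_above Bad" by (rule bdd_aboveI[of _ R]) (auto simp: Bad_def)
  define L where "L = Sup Bad"
  have L: "0 < L" "l \<le> L" using cSup_upper[OF lB bdd] l by (auto simp: L_def)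
  have good: "0 \<le> mirror_diff e k y" if "L < k" "k < R" "y \<in> cap e R k" for k y
  proof (rule ccontr)
    assume "\<not> 0 \<le> mirror_diff e k y"
    then have "k \<in> Bad" using that L by (auto simp: Bad_def not_le)
    then show False using cSup_upper[OF _ bdd, of k] that by (simp add: L_def)
  qed
  have "\<exists>k\<in>Bad. L - 1 / real (Suc n) < k" for n
    using less_cSup_iff[OF _ bdd, of "L - 1 / real (Suc n)"] lB by (auto simp: L_def)
  then obtain ls where ls: "\<And>n. ls n \<in> Bad" "\<And>n. L - 1 / real (Suc n) < ls n" by metis
  have lsL: "ls n \<le> L" for n using cSup_upper[OF ls(1) bdd] by (simp add: L_def)
  have lsl: "ls \<longlonglongrightarrow> L"
  proof (rule tendsto_sandwich[of "\<lambda>n. L - 1 / real (Suc n)" _ _ "\<lambda>_. L"])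
    have "(\<lambda>n. L - 1 / real (Suc n)) \<longlonglongrightarrow> L - 0"
      using LIMSEQ_inverse_real_of_nat by (intro tendsto_intros) (simp add: inverse_eq_divide)
    then show "(\<lambda>n. L - 1 / real (Suc n)) \<longlonglongrightarrow> L" by simp
  qed (use ls(2) lsL in \<open>auto intro!: always_eventually less_imp_le\<close>)
  define K where "K = 2 * R * sqrt (2 * R) + 1"
  have K: "K > 0" using R_pos by (simp add: K_def add_nonneg_pos)
  have "\<exists>x\<in>cap e R (ls n). mirror_diff e (ls n) x < 0 \<and>
    3 * (- mirror_diff e (ls n) x) / (4 * K * sqrt (x \<bullet> e - ls n)) \<le> g (u x) - g (u (mirror e (ls n) x))" for n
  proof -
    obtain z where "z \<in> cap e R (ls n)" "mirror_diff e (ls n) z < 0" "0 < ls n" using ls(1)[of n] by (auto simp: Bad_def)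
    then show ?thesis using worst_point[OF e _ _ _ K_def] by blast
  qed
  then obtain xs where xs: "\<And>n. xs n \<in> cap e R (ls n)" "\<And>n. mirror_diff e (ls n) (xs n) < 0"
    "\<And>n. 3 * (- mirror_diff e (ls n) (xs n)) / (4 * K * sqrt (xs n \<bullet> e - ls n)) \<le> g (u (xs n)) - g (u (mirror e (ls n) (xs n)))"
    by metis
  have "bounded (range xs)"
    by (rule bounded_subset[of "ball 0 R"]) (use xs(1) in \<open>auto simp: cap_def\<close>)
  then obtain y s where s: "strict_mono (s :: nat \<Rightarrow> nat)" "(xs \<circ> s) \<longlonglongrightarrow> y"
    using bounded_imp_convergent_subsequence[of xs] by auto
  have ls': "(ls \<circ> s) \<longlonglongrightarrow> L" by (rule LIMSEQ_subseq_LIMSEQ[OF lsl s(1)])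
  have y: "norm y < R" "L \<le> y \<bullet> e"
    using bad_limit_interior[OF e ls' L(1) s(2)] xs(1,2) ls(1) by (auto simp: Bad_def)
  have my: "norm (mirror e L y) < R" using norm_mirror_le[OF e L(1) y(2)] y(1) by simp
  have ne: "norm e = 1" using e by (simp add: norm_eq_sqrt_inner)
  have "y \<bullet> e \<le> norm y" using Cauchy_Schwarz_ineq2[of y e] ne by simp
  \<comment> \<open>This covers the start of the procedure: planes near \<open>R\<close> cannot all
    be bad, since the limit point is interior.\<close>
  then have LR: "L < R" using y by simp
  have t1: "(\<lambda>n. u ((xs \<circ> s) n)) \<longlonglongrightarrow> u y"
    by (rule isCont_tendsto_compose[OF u_isCont[OF y(1)] s(2)])
  have t2: "(\<lambda>n. u (mirror e ((ls \<circ> s) n) ((xs \<circ> s) n))) \<longlonglongrightarrow> u (mirror e L y)"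
    by (rule isCont_tendsto_compose[OF u_isCont[OF my] tendsto_mirror[OF s(2) ls']])
  show False
  proof (cases "y \<bullet> e = L")
    case False
    have goodL: "0 \<le> mirror_diff e L z" if z: "z \<in> cap e R L" for z
    proof -
      have zc: "norm z < R" "L < z \<bullet> e" using z by (auto simp: cap_def)
      \<comment> \<open>Planes decreasing to \<open>L\<close> that stay below \<open>R\<close> and
        still have \<open>z\<close> in their caps; they are good, and continuity passes this to
        \<open>L\<close>.\<close>
      define ks where "ks = (\<lambda>n. L + (min R (z \<bullet> e) - L) / real (n + 2))"
      have t0: "(\<lambda>n. (min R (z \<bullet> e) - L) / real (n + 2)) \<longlonglongrightarrow> 0"
        using LIMSEQ_ignore_initial_segment[OF lim_const_over_n, of "min R (z \<bullet> e) - L" 2] by simp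
      have kl: "ks \<longlonglongrightarrow> L"
        unfolding ks_def using tendsto_add[OF tendsto_const t0, of L] by simp
      have k: "L < ks n" "ks n < R" "ks n < z \<bullet> e" for n
      proof -
        have "0 < (min R (z \<bullet> e) - L) / real (n + 2)" "(min R (z \<bullet> e) - L) / real (n + 2) < min R (z \<bullet> e) - L"
          using zc LR by (auto simp: divide_less_eq)
        then show "L < ks n" "ks n < R" "ks n < z \<bullet> e" by (auto simp: ks_def)
      qed
      have mz: "norm (mirror e L z) < R" using norm_mirror_le[OF e L(1), of z] zc by simp
      have "(\<lambda>n. mirror_diff e (ks n) z) \<longlonglongrightarrow> mirror_diff e L z"
        unfolding mirror_diff_def
        by (intro tendsto_diff tendsto_const isCont_tendsto_compose[OF u_isCont[OF mz]] tendsto_mirror kl)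
      moreover have "0 \<le> mirror_diff e (ks n) z" for n
        using good[of "ks n" z] k[of n] zc by (simp add: cap_def)
      ultimately show ?thesis by (intro LIMSEQ_le_const) auto
    qed
    have yc: "y \<in> cap e R L" using y False by (simp add: cap_def)
    have "(\<lambda>n. mirror_diff e ((ls \<circ> s) n) ((xs \<circ> s) n)) \<longlonglongrightarrow> mirror_diff e L y"
      unfolding mirror_diff_def by (intro tendsto_diff t1 t2)
    then have "mirror_diff e L y \<le> 0"
      by (rule LIMSEQ_le_const2) (use xs(2) in \<open>auto intro: less_imp_le\<close>)
    then show False
      using goodL[OF yc] no_touching[OF e L(1) LR goodL yc] by simp
  next
    case True
    then have "mirror e L y = y" by (rule mirror_on_plane)
    note t2' = t2[unfolded this]
    obtain \<rho> M where rho: "\<rho> > 0" and M: "M \<ge> 0"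
      and lip: "\<And>p q. \<bar>p - u y\<bar> < \<rho> \<Longrightarrow> \<bar>q - u y\<bar> < \<rho> \<Longrightarrow> \<bar>g p - g q\<bar> \<le> M * \<bar>p - q\<bar>"
      using g_local_lipschitz by blast
    have "(\<lambda>n. M * sqrt ((xs \<circ> s) n \<bullet> e - (ls \<circ> s) n)) \<longlonglongrightarrow> M * sqrt (y \<bullet> e - L)"
      by (intro tendsto_intros s(2) ls')
    then have "\<forall>\<^sub>F n in sequentially. M * sqrt ((xs \<circ> s) n \<bullet> e - (ls \<circ> s) n) < 3 / (4 * K)"
      by (rule order_tendstoD(2)) (use True K in simp)
    moreover have "\<forall>\<^sub>F n in sequentially. dist (u ((xs \<circ> s) n)) (u y) < \<rho>"
      by (rule tendstoD[OF t1 rho])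
    moreover have "\<forall>\<^sub>F n in sequentially. dist (u (mirror e ((ls \<circ> s) n) ((xs \<circ> s) n))) (u y) < \<rho>"
      by (rule tendstoD[OF t2' rho])
    ultimately have "\<forall>\<^sub>F n in sequentially. False"
    proof eventually_elim
      case (elim n)
      define X k where "X = xs (s n)" and "k = ls (s n)"
      define W where "W = - mirror_diff e k X"
      define D where "D = sqrt (X \<bullet> e - k)"
      have W: "W > 0" using xs(2)[of "s n"] by (simp add: W_def X_def k_def)
      have D: "D > 0" using xs(1)[of "s n"] by (simp add: D_def X_def k_def cap_def)
      have "3 * W / (4 * K * D) \<le> g (u X) - g (u (mirror e k X))"
        using xs(3)[of "s n"] by (simp add: W_def D_def X_def k_def)
      also have "\<dots> \<le> M * \<bar>u X - u (mirror e k X)\<bar>"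
        using lip[of "u X" "u (mirror e k X)"] elim(2,3) by (simp add: dist_real_def X_def k_def)
      also have "\<bar>u X - u (mirror e k X)\<bar> = W" using W by (simp add: W_def mirror_diff_def)
      finally have "3 / (4 * K) * W / D \<le> M * W" by simp
      then have "3 / (4 * K) * W \<le> M * W * D"
        by (simp only: pos_divide_le_eq[OF D])
      then have "3 / (4 * K) * W \<le> (M * D) * W"
        by (simp only: mult_ac)
      then have "3 / (4 * K) \<le> M * D" using W by (simp only: mult_le_cancel_right_pos)
      then show False using elim(1) by (simp add: D_def X_def k_def)
    qed
    then show False by simp
  qed
qed

text \<open>Points of equal norm are mirror images in the plane through the centre normal to
  \<open>x - y\<close>, with \<open>x\<close> on the side of \<open>e\<close>.
  \<open>reflection_inequality\<close> requires positive positions, so this plane is reached as a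
  limit.\<close>

lemma u_le_if_norm_eq:
  assumes xy: "norm x = norm y" "norm x < R"
  shows "u y \<le> u x"
proof (cases "x = y")
  case False
  define e where "e = (x - y) /\<^sub>R norm (x - y)"
  have n: "norm (x - y) > 0" using False by simp
  have e: "e \<bullet> e = 1" using n by (simp add: e_def dot_square_norm power2_eq_square)
  have xx: "x \<bullet> x = y \<bullet> y" using xy(1) by (simp add: dot_square_norm)
  have "2 * (x \<bullet> (x - y)) = (norm (x - y))\<^sup>2"
    unfolding power2_norm_eq_inner by (simp add: inner_diff_left inner_diff_right inner_commute[of y x] xx)
  then have "2 * (x \<bullet> e) = (norm (x - y))\<^sup>2 / norm (x - y)"
    by (simp add: e_def divide_inverse_commute)
  then have xe: "2 * (x \<bullet> e) = norm (x - y)" using n by (simp add: power2_eq_square)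
  have m0: "mirror e 0 x = y"
    unfolding mirror_def using xe n by (simp add: e_def)
  have pos: "x \<bullet> e > 0" using xe n by linarith
  define a where "a = min R (x \<bullet> e)"
  have a: "a > 0" "a \<le> R" "a \<le> x \<bullet> e" using R_pos pos by (auto simp: a_def)
  define ks where "ks = (\<lambda>n. a / real (n + 2))"
  have kl: "ks \<longlonglongrightarrow> 0"
    unfolding ks_def using LIMSEQ_ignore_initial_segment[OF lim_const_over_n, of a 2] by simp
  have k: "0 < ks n" "ks n < a" for n using a by (auto simp: ks_def divide_less_eq)
  have "0 \<le> mirror_diff e (ks n) x" for n
    using reflection_inequality[OF e k(1)[of n], of x] k(2)[of n] a xy by (simp add: cap_def)
  moreover have "(\<lambda>n. mirror_diff e (ks n) x) \<longlonglongrightarrow> mirror_diff e 0 x"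
    unfolding mirror_diff_def
    by (intro tendsto_diff tendsto_const isCont_tendsto_compose[OF u_isCont] tendsto_mirror kl) (simp add: m0 xy(1)[symmetric] xy(2))
  ultimately have "0 \<le> mirror_diff e 0 x" by (intro LIMSEQ_le_const) auto
  then show ?thesis by (simp add: mirror_diff_def m0)
qed simp

lemma u_radial: "norm x = norm y \<Longrightarrow> norm x < R \<Longrightarrow> u x = u y"
  using u_le_if_norm_eq[of x y] u_le_if_norm_eq[of y x] by simp

end

section \<open>Radial symmetry\<close>

lemma locally_lipschitz_imp_continuous_on:
  assumes "locally_lipschitz g"
  shows "continuous_on UNIV g"
proof (intro continuous_at_imp_continuous_on ballI)
  fix s
  obtain r L where r: "r > 0" "L-lipschitz_on (ball s r) g"
    using assms unfolding locally_lipschitz_def by blast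
  then have "continuous_on (ball s r) g"
    by (simp add: lipschitz_on_continuous_on)
  then show "isCont g s"
    using r(1) by (simp add: continuous_on_eq_continuous_at)
qed

definition grad :: "('a::euclidean_space \<Rightarrow> real) \<Rightarrow> 'a \<Rightarrow> 'a" where
  "grad u x = (\<Sum>b\<in>Basis. partial_deriv u b x *\<^sub>R b)"

definition hess :: "('a::euclidean_space \<Rightarrow> real) \<Rightarrow> 'a \<Rightarrow> 'a \<Rightarrow> 'a" where
  "hess u x h = (\<Sum>b\<in>Basis. frechet_derivative (partial_deriv u b) (at x) h *\<^sub>R b)"

lemma has_derivative_grad:
  assumes "u differentiable (at x)"
  shows "(u has_derivative (\<lambda>h. grad u x \<bullet> h)) (at x)"
proof -
  have D: "(u has_derivative frechet_derivative u (at x)) (at x)"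
    using assms frechet_derivative_works by blast
  then have lin: "linear (frechet_derivative u (at x))"
    by (rule has_derivative_linear)
  have "frechet_derivative u (at x) h = grad u x \<bullet> h" for h
  proof -
    have "frechet_derivative u (at x) h = frechet_derivative u (at x) (\<Sum>b\<in>Basis. (h \<bullet> b) *\<^sub>R b)"
      by (simp add: euclidean_representation)
    also have "\<dots> = (\<Sum>b\<in>Basis. (h \<bullet> b) * frechet_derivative u (at x) b)"
      by (simp add: linear_sum[OF lin] linear_cmul[OF lin])
    also have "\<dots> = grad u x \<bullet> h"
      by (simp add: grad_def partial_deriv_def inner_sum_left inner_commute[of h] mult.commute)
    finally show ?thesis .
  qed
  then have "frechet_derivative u (at x) = (\<lambda>h. grad u x \<bullet> h)" by blast
  with D show ?thesis by simp
qed

lemma has_derivative_hess: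
  assumes "\<And>b. b \<in> Basis \<Longrightarrow> partial_deriv u b differentiable (at x)"
  shows "(grad u has_derivative hess u x) (at x)"
  unfolding grad_def hess_def
  by (intro has_derivative_sum has_derivative_scaleR_left frechet_derivative_works[THEN iffD1] assms)

lemma large_solution_radial:
  fixes u :: "'a::euclidean_space \<Rightarrow> real"
  assumes lip: "locally_lipschitz g" and conv: "convex_on {a..} g" and ko: "keller_osserman g a"
    and R: "R > 0" and sol: "large_solution g (ball c R) u"
  shows "radial_on c (ball c R) u"
proof -
  obtain b \<sigma> \<beta> F \<psi> where prof: "ko_profile g b \<sigma> \<beta> F \<psi>"
    using ko_profile_exists[OF locally_lipschitz_imp_continuous_on[OF lip] conv ko] by blast
  have C2: "C2_on (ball c R) u" and eq: "\<And>x. x \<in> ball c R \<Longrightarrow> - laplacian u x + g (u x) = 0"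
    and blow: "filterlim u at_top (inf (filtercomap (\<lambda>x. infdist x (frontier (ball c R))) (at_right 0)) (principal (ball c R)))"
    using sol by (auto simp: large_solution_def classical_solution_def)
  have sh: "((\<lambda>x. c + x) has_derivative (\<lambda>h. h)) (at x)" for x
    by (auto intro!: derivative_eq_intros)
  have inb: "c + x \<in> ball c R" if "norm x < R" for x
    using that by (simp add: dist_norm)
  have shb: "(\<lambda>x. c + x) ` ball 0 R \<subseteq> ball c R"
    by (auto simp: dist_norm)
  interpret large_sol g b \<sigma> \<beta> F \<psi> "\<lambda>x. u (c + x)" "\<lambda>x. grad u (c + x)" "\<lambda>x. hess u (c + x)" R
  proof (intro large_sol.intro[OF prof] large_sol_axioms.intro)
    show "R > 0" by fact
    show "locally_lipschitz g" by fact
    fix x :: 'a assume x: "norm x < R"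
    have "u differentiable (at (c + x))"
      using C2 inb[OF x] by (simp add: C2_on_def C1_on_def)
    from has_derivative_compose[OF sh has_derivative_grad[OF this]]
    show "((\<lambda>x. u (c + x)) has_derivative (\<bullet>) (grad u (c + x))) (at x)" .
    have "\<And>v. v \<in> Basis \<Longrightarrow> partial_deriv u v differentiable (at (c + x))"
      using C2 inb[OF x] by (simp add: C2_on_def C1_on_def)
    from has_derivative_compose[OF sh has_derivative_hess[OF this]]
    show "((\<lambda>x. grad u (c + x)) has_derivative hess u (c + x)) (at x)" .
    have "(\<Sum>v\<in>Basis. hess u (c + x) v \<bullet> v) = laplacian u (c + x)"
      unfolding laplacian_def hess_def partial_deriv_def[of "partial_deriv u _"]
      by (intro sum.cong refl) (simp add: inner_sum_left inner_Basis if_distrib[of "\<lambda>z. _ * z"] sum.delta cong: if_cong)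
    then show "(\<Sum>v\<in>Basis. hess u (c + x) v \<bullet> v) = g (u (c + x))"
      using eq[OF inb[OF x]] by simp
  next
    fix v :: 'a assume v: "v \<in> Basis"
    have "continuous_on (ball c R) (partial_deriv (partial_deriv u b) v)" if "b \<in> Basis" for b
      using C2 v that by (simp add: C2_on_def C1_on_def)
    then have "continuous_on (ball c R) (\<lambda>y. \<Sum>b\<in>Basis. partial_deriv (partial_deriv u b) v y *\<^sub>R b)"
      by (intro continuous_intros) auto
    then have "continuous_on (ball c R) (\<lambda>y. hess u y v)"
      by (simp add: hess_def partial_deriv_def)
    then show "continuous_on (ball 0 R) (\<lambda>x. hess u (c + x) v)"
      by (rule continuous_on_compose2) (use shb in \<open>auto intro!: continuous_intros\<close>)
  next
    fix M
    have "\<forall>\<^sub>F y in inf (filtercomap (\<lambda>x. infdist x (frontier (ball c R))) (at_right 0)) (principal (ball c R)). M < u y"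
      using blow by (simp add: filterlim_at_top_dense)
    then have "\<forall>\<^sub>F y in filtercomap (\<lambda>x. infdist x (frontier (ball c R))) (at_right 0). y \<in> ball c R \<longrightarrow> M < u y"
      by (simp add: eventually_inf_principal)
    then obtain Q where Q: "eventually Q (at_right (0::real))"
      "\<And>y. Q (infdist y (frontier (ball c R))) \<Longrightarrow> y \<in> ball c R \<Longrightarrow> M < u y"
      unfolding eventually_filtercomap by blast
    obtain d where d: "d > 0" "\<And>t. 0 < t \<Longrightarrow> t < d \<Longrightarrow> Q t"
      using Q(1) unfolding eventually_at_right_field by auto
    have fr: "frontier (ball c R) = sphere c R"
      using R by (simp add: frontier_ball)
    have "M < u (c + x)" if x: "max 0 (R - d) < norm x" "norm x < R" for x
    proof -
      have x0: "norm x > 0" using x by simp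
      \<comment> \<open>The radial projection of \<open>c + x\<close> to the sphere bounds the
        distance to the frontier by \<open>R - norm x\<close>.\<close>
      define p where "p = c + (R / norm x) *\<^sub>R x"
      have p: "p \<in> sphere c R" using x0 R by (simp add: p_def dist_norm)
      have "c + x - p = (1 - R / norm x) *\<^sub>R x"
        by (simp add: p_def algebra_simps)
      then have "dist (c + x) p = \<bar>1 - R / norm x\<bar> * norm x"
        by (simp add: dist_norm)
      also have "\<dots> = R - norm x"
        using x0 x by (simp add: abs_if field_simps)
      finally have "infdist (c + x) (sphere c R) < d"
        using infdist_le[OF p, of "c + x"] x by simp
      \<comment> \<open>\<open>at_right 0\<close> speaks only of strictly positive
        distances.\<close>
      moreover have "infdist (c + x) (sphere c R) \<noteq> 0"
        using in_closed_iff_infdist_zero[OF closed_sphere, of c R "c + x"] p x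
        by (auto simp: dist_norm)
      ultimately have "Q (infdist (c + x) (frontier (ball c R)))"
        unfolding fr using d(2) infdist_nonneg[of "c + x" "sphere c R"] by simp
      then show ?thesis using Q(2) inb[OF x(2)] by blast
    qed
    moreover have "max 0 (R - d) < R" using R d(1) by simp
    ultimately show "\<exists>r<R. \<forall>x. r < norm x \<longrightarrow> norm x < R \<longrightarrow> M < u (c + x)" by blast
  qed
  \<comment> \<open>\<open>u_radial\<close> makes the value independent of the chosen point at
    distance \<open>t\<close>.\<close>
  define \<phi> where "\<phi> = (\<lambda>t. u (SOME y. dist y c = t))"
  have "u x = \<phi> (dist x c)" if x: "x \<in> ball c R" for x
  proof -
    define y where "y = (SOME y. dist y c = dist x c)"
    have y: "dist y c = dist x c" unfolding y_def by (rule someI[of _ x]) simp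
    have "u (c + (x - c)) = u (c + (y - c))"
      by (rule u_radial) (use x y in \<open>auto simp: dist_norm norm_minus_commute\<close>)
    then show ?thesis by (simp add: \<phi>_def y_def)
  qed
  then show ?thesis unfolding radial_on_def by blast
qed

theorem mainTheorem2:
  fixes g :: "real \<Rightarrow> real"
    and u :: "real ^ 'n \<Rightarrow> real"
    and c :: "real ^ 'n"
    and R :: real
  assumes "CARD('n) \<ge> 2"
    and "locally_lipschitz g"
    and "\<exists>a>0. convex_on {a..} g \<and> keller_osserman g a"
    and "R > 0"
    and "large_solution g (ball c R) u"
  shows "radial_on c (ball c R) u"
  using assms large_solution_radial by blast

end
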